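(* Let $n\ge2$ and $1\le k\le n$. In the algebra $\overline{3HT_n(\beta,\boldsymbol h)}$ the shifted multiplicative Dunkl elements $\mathfrak{D}_1,\dots,\mathfrak{D}_n$ satisfy $$\sum_{I\subset[1,n],\,|I|=k}\mathfrak{D}_I\prod_{\substack{i\notin I,\ j\in I\\ i<j}}\bigl(1+t\beta-t^2q_{ij}\bigr)=\sum_{1\le i_1<\cdots<i_k\le n}\ \prod_{a=1}^{k}(1+t\beta)^{n-k-i_a+a}\left(z_{i_a}(1+t\beta)^{i_a-a}+1+h_{i_a}\frac{(1+t\beta)^{i_a-a}-1}{\beta}\right),$$ where $\mathfrak{D}_I=\prod_{a\in I}\mathfrak{D}_a$.
   Context: Let $\beta,t$, $h_2,\dots,h_n$ and $q_{ij}=q_{ji}$ ($1\le i\neq j\le n$) be commuting central parameters, $h_1:=0$, and let the coefficient ring be $\mathbb{Z}[\beta,t,h_2,\dots,h_n,\{q_{ij}\}]$ with all elements $1+\beta t-t^2q_{ij}$ inverted. The algebra $\overline{3HT_n(\beta,\boldsymbol h)}$ is the associative algebra over this ring generated by $u_{ij}$ ($1\le i<j\le n$) and pairwise commuting elements $z_1,\dots,z_n$ subject to: - $u_{ij}u_{kl}=u_{kl}u_{ij}$ if $\{i,j\}\cap\{k,l\}=\varnothing$; - for $i<j<k$: $u_{ij}u_{jk}=u_{ik}u_{ij}+u_{jk}u_{ik}-\beta u_{ik}$ and $u_{jk}u_{ij}=u_{ij}u_{ik}+u_{ik}u_{jk}-\beta u_{ik}$; - $u_{ij}^2-\beta u_{ij}=q_{ij}$;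 - $z_iu_{kl}=u_{kl}z_i$ if $i\notin\{k,l\}$; - for $i<j$: $z_iu_{ij}=u_{ij}z_j+\beta z_i+h_j$ and $z_ju_{ij}=u_{ij}z_i-\beta z_i-h_j$. For $i<j$ put $h_{ij}=1+t\,u_{ij}$; it is invertible, with $h_{ij}^{-1}=(1+\beta t-t^2q_{ij})^{-1}(1+t\beta-tu_{ij})$. The shifted multiplicative Dunkl elements are $$\mathfrak{D}_i=h_{i-1,i}^{-1}h_{i-2,i}^{-1}\cdots h_{1,i}^{-1}\,(1+z_i)\,h_{i,n}h_{i,n-1}\cdots h_{i,i+1};$$ they commute pairwise. The fraction $\frac{(1+t\beta)^m-1}{\beta}$ denotes the polynomial $\sum_{r\ge1}\binom mr t^r\beta^{r-1}$. *)

theory Defs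
  imports "HOL-Library.Poly_Mapping" "HOL-Library.FuncSet" "HOL-Library.Cardinality"
begin

text \<open>
  Throughout, \<open>n = CARD('n)\<close>, and indices are natural numbers in \<open>{1..n}\<close>.
  All families below (\<open>hpar i\<close>, \<open>qpar i j\<close>, \<open>u i j\<close>, \<open>z i\<close>, ...) are meaningful only for indices
  in range (and \<open>i \<noteq> j\<close>, respectively \<open>i < j\<close>); elsewhere their values are irrelevant.
\<close>

datatype raw_param = P_beta | P_t | P_h nat | P_q nat nat

typedef ('n::finite) param =
  "{P_beta, P_t} \<union> {P_h i | i. 2 \<le> i \<and> i \<le> CARD('n)}
    \<union> {P_q i j | i j. 1 \<le> i \<and> i < j \<and> j \<le> CARD('n)}"
  by blast

text \<open>Integer polynomials in the parameters: finitely supported maps from exponent vectors to \<open>int\<close>.\<close>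

type_synonym 'n par_poly = "('n param \<Rightarrow>\<^sub>0 nat) \<Rightarrow>\<^sub>0 int"

definition pvar :: "raw_param \<Rightarrow> ('n::finite) par_poly" where
  "pvar p = Poly_Mapping.single (Poly_Mapping.single (Abs_param p) 1) 1"

definition pkappa :: "nat \<Rightarrow> nat \<Rightarrow> ('n::finite) par_poly" where
  "pkappa i j = 1 + pvar P_beta * pvar P_t - pvar P_t ^ 2 * pvar (P_q i j)"

inductive_set denoms :: "('n::finite) par_poly set" where
  denoms_one: "1 \<in> denoms"
| denoms_mult:
    "s \<in> denoms \<Longrightarrow> 1 \<le> i \<Longrightarrow> i < j \<Longrightarrow> j \<le> CARD('n) \<Longrightarrow>
      s * (pkappa i j :: 'n par_poly) \<in> denoms"

lemma denoms_times: "r \<in> denoms \<Longrightarrow> s \<in> denoms \<Longrightarrow> s * r \<in> denoms"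
proof (induction rule: denoms.induct)
  case (denoms_mult r i j)
  then have "(s * r) * pkappa i j \<in> denoms"
    by (intro denoms.denoms_mult)
  then show ?case by (simp add: mult.assoc)
qed auto

text \<open>
  Localization at the multiplicative set generated by the \<open>1 + \<beta>t - t\<^sup>2 q\<^sub>i\<^sub>j\<close>:
  pairs \<open>(numerator, denominator)\<close> modulo the usual equivalence.
\<close>

definition frac_eq :: "('n::finite) par_poly \<times> 'n par_poly \<Rightarrow> 'n par_poly \<times> 'n par_poly \<Rightarrow> bool" where
  "frac_eq x y \<longleftrightarrow> snd x \<in> denoms \<and> snd y \<in> denoms \<and>
    (\<exists>w \<in> denoms. w * (fst x * snd y - fst y * snd x) = 0)"

lemma frac_eqI:
  "snd x \<in> denoms \<Longrightarrow> snd y \<in> denoms \<Longrightarrow> w \<in> denoms \<Longrightarrow>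
    w * (fst x * snd y - fst y * snd x) = 0 \<Longrightarrow> frac_eq x y"
  unfolding frac_eq_def by blast

lemma frac_eqI_strict:
  "snd x \<in> denoms \<Longrightarrow> snd y \<in> denoms \<Longrightarrow> fst x * snd y = fst y * snd x \<Longrightarrow> frac_eq x y"
  using denoms_one by (auto intro: frac_eqI[of _ _ 1])

lemma part_equivp_frac_eq: "part_equivp (frac_eq :: ('n::finite) par_poly \<times> _ \<Rightarrow> _)"
proof (rule part_equivpI)
  show "\<exists>x :: 'n par_poly \<times> 'n par_poly. frac_eq x x"
    by (rule exI[of _ "(0, 1)"]) (auto intro!: frac_eqI_strict denoms_one)
  show "symp (frac_eq :: 'n par_poly \<times> _ \<Rightarrow> _)"
  proof (rule sympI)
    fix x y :: "'n par_poly \<times> 'n par_poly"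
    assume "frac_eq x y"
    then obtain w where w: "snd x \<in> denoms" "snd y \<in> denoms" "w \<in> denoms"
      "w * (fst x * snd y - fst y * snd x) = 0" unfolding frac_eq_def by blast
    have "w * (fst y * snd x - fst x * snd y) = - (w * (fst x * snd y - fst y * snd x))"
      by (simp add: algebra_simps)
    with w show "frac_eq y x" by (auto intro: frac_eqI)
  qed
  show "transp (frac_eq :: 'n par_poly \<times> _ \<Rightarrow> _)"
  proof (rule transpI)
    fix x y z :: "'n par_poly \<times> 'n par_poly"
    assume "frac_eq x y" "frac_eq y z"
    then obtain v w where w: "snd x \<in> denoms" "snd y \<in> denoms" "snd z \<in> denoms"
        "v \<in> denoms" "w \<in> denoms"
        "v * (fst x * snd y - fst y * snd x) = 0" "w * (fst y * snd z - fst z * snd y) = 0"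
      unfolding frac_eq_def by blast
    have "(v * w * snd y) * (fst x * snd z - fst z * snd x) =
        w * snd z * (v * (fst x * snd y - fst y * snd x))
        + v * snd x * (w * (fst y * snd z - fst z * snd y))"
      by (simp add: algebra_simps)
    then have "(v * w * snd y) * (fst x * snd z - fst z * snd x) = 0"
      using w by simp
    with w show "frac_eq x z" by (auto intro: frac_eqI denoms_times)
  qed
qed

quotient_type 'n coeff = "('n::finite) par_poly \<times> 'n par_poly" / partial: "frac_eq"
  by (rule part_equivp_frac_eq)

lemma lookup_mult_zero:
  fixes f g :: "'k::monoid_add \<Rightarrow>\<^sub>0 'r::semiring_0"
  assumes key: "\<And>l r :: 'k. l + r = 0 \<longleftrightarrow> l = 0 \<and> r = 0"
  shows "Poly_Mapping.lookup (f * g) 0 = Poly_Mapping.lookup f 0 * Poly_Mapping.lookup g 0"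
proof -
  have key': "0 = l + r \<longleftrightarrow> l = 0 \<and> r = 0" for l r :: 'k
    using key by metis
  have inner: "(\<Sum>r. Poly_Mapping.lookup g r when 0 = l + r)
      = (Poly_Mapping.lookup g 0 when l = 0)" for l
  proof -
    have "(\<lambda>r. Poly_Mapping.lookup g r when 0 = l + r)
        = (\<lambda>r. (Poly_Mapping.lookup g 0 when l = 0) when r = 0)"
      by (auto simp: key' when_def fun_eq_iff)
    then show ?thesis by (simp only: Sum_any_when_equal)
  qed
  have "(\<lambda>l. Poly_Mapping.lookup f l * (Poly_Mapping.lookup g 0 when l = 0))
      = (\<lambda>l. (Poly_Mapping.lookup f 0 * Poly_Mapping.lookup g 0) when l = 0)"
    by (auto simp: when_def fun_eq_iff)
  then show ?thesis
    by (simp only: lookup_mult inner Sum_any_when_equal)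
qed

lemma lookup_mult_zero_poly:
  "Poly_Mapping.lookup (f * g) 0
    = Poly_Mapping.lookup f 0 * Poly_Mapping.lookup (g :: ('n::finite) par_poly) 0"
  by (rule lookup_mult_zero) (auto simp: poly_mapping_eq_iff fun_eq_iff lookup_add)

lemma lookup_pvar_zero: "Poly_Mapping.lookup (pvar p :: ('n::finite) par_poly) 0 = 0"
proof -
  have "Poly_Mapping.single (Abs_param p :: 'n param) (1::nat) \<noteq> 0"
    by (metis lookup_single_eq lookup_zero zero_neq_one)
  then show ?thesis
    by (simp add: pvar_def lookup_single when_def)
qed

lemma lookup_denoms_zero: "s \<in> denoms \<Longrightarrow> Poly_Mapping.lookup s 0 = 1"
  by (induction rule: denoms.induct)
    (simp_all add: pkappa_def lookup_add lookup_minus lookup_mult_zero_poly lookup_pvar_zero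
      power2_eq_square lookup_one)

lemma denoms_nonzero: "0 \<notin> denoms"
  using lookup_denoms_zero by force

instantiation coeff :: (finite) comm_ring_1
begin

lift_definition zero_coeff :: "'a coeff" is "(0, 1)"
  by (auto intro!: frac_eqI_strict denoms_one)

lift_definition one_coeff :: "'a coeff" is "(1, 1)"
  by (auto intro!: frac_eqI_strict denoms_one)

lift_definition plus_coeff :: "'a coeff \<Rightarrow> 'a coeff \<Rightarrow> 'a coeff"
  is "\<lambda>x y. (fst x * snd y + fst y * snd x, snd x * snd y)"
proof -
  fix x x' y y' :: "'a par_poly \<times> 'a par_poly"
  assume "frac_eq x x'" "frac_eq y y'"
  then obtain v w where w: "snd x \<in> denoms" "snd x' \<in> denoms" "snd y \<in> denoms" "snd y' \<in> denoms"
      "v \<in> denoms" "w \<in> denoms"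
      "v * (fst x * snd x' - fst x' * snd x) = 0" "w * (fst y * snd y' - fst y' * snd y) = 0"
    unfolding frac_eq_def by blast
  have "(v * w) * ((fst x * snd y + fst y * snd x) * (snd x' * snd y')
          - (fst x' * snd y' + fst y' * snd x') * (snd x * snd y))
      = w * snd y * snd y' * (v * (fst x * snd x' - fst x' * snd x))
        + v * snd x * snd x' * (w * (fst y * snd y' - fst y' * snd y))"
    by (simp add: algebra_simps)
  also have "\<dots> = 0" using w by simp
  finally show "frac_eq (fst x * snd y + fst y * snd x, snd x * snd y)
      (fst x' * snd y' + fst y' * snd x', snd x' * snd y')"
    using w by (intro frac_eqI[of _ _ "v * w"]) (auto intro: denoms_times)
qed

lift_definition uminus_coeff :: "'a coeff \<Rightarrow> 'a coeff" is "\<lambda>x. (- fst x, snd x)"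
proof -
  fix x x' :: "'a par_poly \<times> 'a par_poly"
  assume "frac_eq x x'"
  then obtain v where v: "snd x \<in> denoms" "snd x' \<in> denoms" "v \<in> denoms"
      "v * (fst x * snd x' - fst x' * snd x) = 0"
    unfolding frac_eq_def by blast
  have "v * (- fst x * snd x' - - fst x' * snd x) = - (v * (fst x * snd x' - fst x' * snd x))"
    by (simp add: algebra_simps)
  with v show "frac_eq (- fst x, snd x) (- fst x', snd x')"
    by (intro frac_eqI[of _ _ v]) auto
qed

definition minus_coeff :: "'a coeff \<Rightarrow> 'a coeff \<Rightarrow> 'a coeff" where
  "minus_coeff x y = x + (- y)"

lift_definition times_coeff :: "'a coeff \<Rightarrow> 'a coeff \<Rightarrow> 'a coeff"
  is "\<lambda>x y. (fst x * fst y, snd x * snd y)"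
proof -
  fix x x' y y' :: "'a par_poly \<times> 'a par_poly"
  assume "frac_eq x x'" "frac_eq y y'"
  then obtain v w where w: "snd x \<in> denoms" "snd x' \<in> denoms" "snd y \<in> denoms" "snd y' \<in> denoms"
      "v \<in> denoms" "w \<in> denoms"
      "v * (fst x * snd x' - fst x' * snd x) = 0" "w * (fst y * snd y' - fst y' * snd y) = 0"
    unfolding frac_eq_def by blast
  have "(v * w) * ((fst x * fst y) * (snd x' * snd y') - (fst x' * fst y') * (snd x * snd y))
      = w * fst y * snd y' * (v * (fst x * snd x' - fst x' * snd x))
        + v * fst x' * snd x * (w * (fst y * snd y' - fst y' * snd y))"
    by (simp add: algebra_simps)
  also have "\<dots> = 0" using w by simp
  finally show "frac_eq (fst x * fst y, snd x * snd y) (fst x' * fst y', snd x' * snd y')"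
    using w by (intro frac_eqI[of _ _ "v * w"]) (auto intro: denoms_times)
qed

instance
proof
  fix a b c :: "'a coeff"
  have D: "snd x \<in> denoms" if "frac_eq x x" for x :: "'a par_poly \<times> 'a par_poly"
    using that unfolding frac_eq_def by blast
  show "a + b + c = a + (b + c)"
    by transfer (auto intro!: frac_eqI_strict denoms_times dest!: D simp: algebra_simps)
  show "a + b = b + a"
    by transfer (auto intro!: frac_eqI_strict denoms_times dest!: D simp: algebra_simps)
  show "0 + a = a"
    by transfer (auto intro!: frac_eqI_strict denoms_times denoms_one dest!: D simp: algebra_simps)
  show "- a + a = 0"
    by transfer (auto intro!: frac_eqI_strict denoms_times denoms_one dest!: D simp: algebra_simps)
  show "a - b = a + - b"
    by (rule minus_coeff_def)
  show "a * b * c = a * (b * c)"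
    by transfer (auto intro!: frac_eqI_strict denoms_times dest!: D simp: algebra_simps)
  show "a * b = b * a"
    by transfer (auto intro!: frac_eqI_strict denoms_times dest!: D simp: algebra_simps)
  show "1 * a = a"
    by transfer (auto intro!: frac_eqI_strict denoms_times denoms_one dest!: D simp: algebra_simps)
  show "(a + b) * c = a * c + b * c"
    by transfer (auto intro!: frac_eqI_strict denoms_times dest!: D simp: algebra_simps)
  show "(0 :: 'a coeff) \<noteq> 1"
    by transfer (use denoms_nonzero in \<open>auto simp: frac_eq_def\<close>)
qed

end

definition coeff_of_poly :: "('n::finite) par_poly \<Rightarrow> 'n coeff" where
  "coeff_of_poly a = abs_coeff (a, 1)"

definition bpar :: "('n::finite) coeff" where
  "bpar = coeff_of_poly (pvar P_beta)"

definition tpar :: "('n::finite) coeff" where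
  "tpar = coeff_of_poly (pvar P_t)"

definition hpar :: "nat \<Rightarrow> ('n::finite) coeff" where
  "hpar i = (if i = 1 then 0 else coeff_of_poly (pvar (P_h i)))"

definition qpar :: "nat \<Rightarrow> nat \<Rightarrow> ('n::finite) coeff" where
  "qpar i j = coeff_of_poly (pvar (P_q (min i j) (max i j)))"

definition kappa :: "nat \<Rightarrow> nat \<Rightarrow> ('n::finite) coeff" where
  "kappa i j = 1 + bpar * tpar - tpar ^ 2 * qpar i j"

definition kappa_inv :: "nat \<Rightarrow> nat \<Rightarrow> ('n::finite) coeff" where
  "kappa_inv i j = abs_coeff (1, pkappa (min i j) (max i j))"

text \<open>The fraction \<open>((1 + t\<beta>)^m - 1) / \<beta>\<close>, read as a polynomial in \<open>t\<close> and \<open>\<beta>\<close>.\<close>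

definition beta_quot :: "nat \<Rightarrow> ('n::finite) coeff" where
  "beta_quot m = (\<Sum>r = 1..m. of_nat (m choose r) * tpar ^ r * bpar ^ (r - 1))"

lemma beta_quot_correct: "bpar * beta_quot m = (1 + tpar * bpar) ^ m - (1 :: ('n::finite) coeff)"
proof -
  have "(1 + tpar * bpar) ^ m = (\<Sum>r\<le>m. of_nat (m choose r) * (tpar * bpar :: 'n coeff) ^ r)"
    using binomial_ring[of "tpar * bpar :: 'n coeff" 1 m] by (simp add: add.commute)
  also have "\<dots> = 1 + (\<Sum>r = 1..m. of_nat (m choose r) * (tpar * bpar) ^ r)"
    by (simp add: atMost_atLeast0 sum.atLeast_Suc_atMost)
  also have "(\<Sum>r = 1..m. of_nat (m choose r) * (tpar * bpar :: 'n coeff) ^ r)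
      = bpar * beta_quot m"
    unfolding beta_quot_def sum_distrib_left
  proof (intro sum.cong refl)
    fix r assume "r \<in> {1..m}"
    then obtain s where "r = Suc s" by (cases r) auto
    then show "of_nat (m choose r) * (tpar * bpar) ^ r
        = (bpar * (of_nat (m choose r) * tpar ^ r * bpar ^ (r - 1)) :: 'n coeff)"
      by (simp add: power_mult_distrib algebra_simps)
  qed
  finally show ?thesis by simp
qed

lemma abs_coeff_eqI:
  "snd x \<in> denoms \<Longrightarrow> snd y \<in> denoms \<Longrightarrow> fst x * snd y = fst y * snd x \<Longrightarrow>
    abs_coeff x = abs_coeff y"
  using Quotient_rel_abs[OF Quotient_coeff] frac_eqI_strict by blast

lemma coeff_of_poly_hom:
  "coeff_of_poly 1 = 1"
  "coeff_of_poly (a + b) = coeff_of_poly a + coeff_of_poly b"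
  "coeff_of_poly (- a) = - coeff_of_poly a"
  "coeff_of_poly (a - b) = coeff_of_poly a - coeff_of_poly b"
  "coeff_of_poly (a * b) = coeff_of_poly a * coeff_of_poly b"
proof -
  have E: "frac_eq (c, 1) (c, 1)" for c :: "('n::finite) par_poly"
    by (auto intro!: frac_eqI_strict denoms_one)
  show "coeff_of_poly 1 = 1"
    by (simp add: coeff_of_poly_def one_coeff_def)
  show A: "coeff_of_poly (a + b) = coeff_of_poly a + coeff_of_poly b" for a b
    by (simp add: coeff_of_poly_def plus_coeff.abs_eq[OF E E])
  show U: "coeff_of_poly (- a) = - coeff_of_poly a" for a
    by (simp add: coeff_of_poly_def uminus_coeff.abs_eq[OF E])
  show "coeff_of_poly (a - b) = coeff_of_poly a - coeff_of_poly b"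
    using A[of a "- b"] U[of b] by simp
  show "coeff_of_poly (a * b) = coeff_of_poly a * coeff_of_poly b"
    by (simp add: coeff_of_poly_def times_coeff.abs_eq[OF E E])
qed

lemma kappa_inverse:
  assumes "1 \<le> i" "i < j" "j \<le> CARD('n)"
  shows "kappa i j * kappa_inv i j = (1 :: ('n::finite) coeff)"
proof -
  have d: "(pkappa i j :: 'n par_poly) \<in> denoms"
    using denoms_mult[OF denoms_one assms] by simp
  have m: "min i j = i" "max i j = j" using assms by auto
  have "kappa i j = coeff_of_poly (pkappa i j :: 'n par_poly)"
    by (simp add: kappa_def pkappa_def bpar_def tpar_def qpar_def m coeff_of_poly_hom
        power2_eq_square)
  moreover have "frac_eq (pkappa i j, 1) (pkappa i j, 1 :: 'n par_poly)"
      "frac_eq (1, pkappa i j) (1, pkappa i j :: 'n par_poly)"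
    using d denoms_one by (auto intro: frac_eqI_strict)
  ultimately have "kappa i j * kappa_inv i j = (abs_coeff (pkappa i j * 1, 1 * pkappa i j) :: 'n coeff)"
    by (simp add: kappa_inv_def coeff_of_poly_def m times_coeff.abs_eq)
  also have "\<dots> = 1"
    unfolding one_coeff_def using d denoms_one by (intro abs_coeff_eqI) auto
  finally show ?thesis .
qed

datatype raw_gen = G_u nat nat | G_z nat

typedef ('n::finite) gen =
  "{G_u i j | i j. 1 \<le> i \<and> i < j \<and> j \<le> CARD('n)} \<union> {G_z i | i. 1 \<le> i \<and> i \<le> CARD('n)}"
proof
  show "G_z 1 \<in> {G_u i j | i j. 1 \<le> i \<and> i < j \<and> j \<le> CARD('n)}
      \<union> {G_z i | i. 1 \<le> i \<and> i \<le> CARD('n)}"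
    by (auto simp: Suc_le_eq)
qed

text \<open>
  The free monoid, written additively because the convolution product of
  \<open>Poly_Mapping\<close> uses \<open>+\<close> on exponents; this addition is not commutative.
\<close>

datatype 'g fmonoid = Word (letters: "'g list")

instantiation fmonoid :: (type) monoid_add
begin

definition zero_fmonoid :: "'a fmonoid" where
  "0 = Word []"

definition plus_fmonoid :: "'a fmonoid \<Rightarrow> 'a fmonoid \<Rightarrow> 'a fmonoid" where
  "v + w = Word (letters v @ letters w)"

instance
  by standard (simp_all add: zero_fmonoid_def plus_fmonoid_def)

end

type_synonym 'n free_alg = "'n gen fmonoid \<Rightarrow>\<^sub>0 'n coeff"

definition fscalar :: "('n::finite) coeff \<Rightarrow> 'n free_alg" where
  "fscalar c = Poly_Mapping.single 0 c"

definition fu :: "nat \<Rightarrow> nat \<Rightarrow> ('n::finite) free_alg" where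
  "fu i j = Poly_Mapping.single (Word [Abs_gen (G_u i j)]) 1"

definition fz :: "nat \<Rightarrow> ('n::finite) free_alg" where
  "fz i = Poly_Mapping.single (Word [Abs_gen (G_z i)]) 1"

inductive_set relators :: "('n::finite) free_alg set" where
  uu_comm:
    "1 \<le> i \<Longrightarrow> i < j \<Longrightarrow> j \<le> CARD('n) \<Longrightarrow> 1 \<le> k \<Longrightarrow> k < l \<Longrightarrow> l \<le> CARD('n) \<Longrightarrow>
      {i, j} \<inter> {k, l} = {} \<Longrightarrow>
      fu i j * fu k l - fu k l * fu i j \<in> relators"
| uu_three_1:
    "1 \<le> i \<Longrightarrow> i < j \<Longrightarrow> j < k \<Longrightarrow> k \<le> CARD('n) \<Longrightarrow>
      fu i j * fu j k - (fu i k * fu i j + fu j k * fu i k - fscalar bpar * fu i k) \<in> relators"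
| uu_three_2:
    "1 \<le> i \<Longrightarrow> i < j \<Longrightarrow> j < k \<Longrightarrow> k \<le> CARD('n) \<Longrightarrow>
      fu j k * fu i j - (fu i j * fu i k + fu i k * fu j k - fscalar bpar * fu i k) \<in> relators"
| u_square:
    "1 \<le> i \<Longrightarrow> i < j \<Longrightarrow> j \<le> CARD('n) \<Longrightarrow>
      (fu i j) ^ 2 - fscalar bpar * fu i j - fscalar (qpar i j) \<in> relators"
| zz_comm:
    "1 \<le> i \<Longrightarrow> i \<le> CARD('n) \<Longrightarrow> 1 \<le> j \<Longrightarrow> j \<le> CARD('n) \<Longrightarrow>
      fz i * fz j - fz j * fz i \<in> relators"
| zu_comm:
    "1 \<le> i \<Longrightarrow> i \<le> CARD('n) \<Longrightarrow> 1 \<le> k \<Longrightarrow> k < l \<Longrightarrow> l \<le> CARD('n) \<Longrightarrow> i \<notin> {k, l} \<Longrightarrow>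
      fz i * fu k l - fu k l * fz i \<in> relators"
| zu_left:
    "1 \<le> i \<Longrightarrow> i < j \<Longrightarrow> j \<le> CARD('n) \<Longrightarrow>
      fz i * fu i j - (fu i j * fz j + fscalar bpar * fz i + fscalar (hpar j)) \<in> relators"
| zu_right:
    "1 \<le> i \<Longrightarrow> i < j \<Longrightarrow> j \<le> CARD('n) \<Longrightarrow>
      fz j * fu i j - (fu i j * fz i - fscalar bpar * fz i - fscalar (hpar j)) \<in> relators"

inductive_set two_sided_ideal :: "'a::ring_1 set \<Rightarrow> 'a set" for S where
  ideal_base: "x \<in> S \<Longrightarrow> x \<in> two_sided_ideal S"
| ideal_zero: "0 \<in> two_sided_ideal S"
| ideal_add: "x \<in> two_sided_ideal S \<Longrightarrow> y \<in> two_sided_ideal S \<Longrightarrow> x + y \<in> two_sided_ideal S"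
| ideal_mult_left: "x \<in> two_sided_ideal S \<Longrightarrow> a * x \<in> two_sided_ideal S"
| ideal_mult_right: "x \<in> two_sided_ideal S \<Longrightarrow> x * a \<in> two_sided_ideal S"

lemma ideal_uminus: "x \<in> two_sided_ideal S \<Longrightarrow> - x \<in> two_sided_ideal S"
  using ideal_mult_left[of x S "- 1"] by simp

lemma ideal_minus:
  "x \<in> two_sided_ideal S \<Longrightarrow> y \<in> two_sided_ideal S \<Longrightarrow> x - y \<in> two_sided_ideal S"
  using ideal_add[OF _ ideal_uminus, of x S y] by simp

definition rel_eq :: "('n::finite) free_alg \<Rightarrow> 'n free_alg \<Rightarrow> bool" where
  "rel_eq x y \<longleftrightarrow> x - y \<in> two_sided_ideal relators"

lemma equivp_rel_eq: "equivp (rel_eq :: ('n::finite) free_alg \<Rightarrow> _)"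
proof (rule equivpI)
  show "reflp (rel_eq :: 'n free_alg \<Rightarrow> _)"
    by (auto intro!: reflpI simp: rel_eq_def ideal_zero)
  show "symp (rel_eq :: 'n free_alg \<Rightarrow> _)"
    by (rule sympI) (use ideal_uminus in \<open>fastforce simp: rel_eq_def\<close>)
  show "transp (rel_eq :: 'n free_alg \<Rightarrow> _)"
    by (rule transpI) (use ideal_add in \<open>fastforce simp: rel_eq_def\<close>)
qed

text \<open>\<open>'n tht\<close> is the algebra \<open>3HT\<^sub>n(\<beta>, h)\<close> (written with an overline in the mathematics).\<close>

quotient_type 'n tht = "('n::finite) free_alg" / "rel_eq"
  by (rule equivp_rel_eq)

lemma abs_tht_eq_iff: "abs_tht x = abs_tht y \<longleftrightarrow> rel_eq x y"
  using Quotient_rel[OF Quotient_tht] equivp_rel_eq by (metis equivp_reflp)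

text \<open>
  Non-triviality, needed for the class \<open>ring_1\<close>: sending all parameters and all generators
  to \<open>0\<close> defines a ring homomorphism from the algebra to \<open>int\<close>.
\<close>

lift_definition coeff_at_zero :: "('n::finite) coeff \<Rightarrow> int"
  is "\<lambda>x. Poly_Mapping.lookup (fst x) 0"
proof -
  fix x y :: "'n par_poly \<times> 'n par_poly"
  assume "frac_eq x y"
  then obtain w where w: "snd x \<in> denoms" "snd y \<in> denoms" "w \<in> denoms"
      "w * (fst x * snd y - fst y * snd x) = 0"
    unfolding frac_eq_def by blast
  from arg_cong[OF w(4), of "\<lambda>p. Poly_Mapping.lookup p 0"]
  show "Poly_Mapping.lookup (fst x) 0 = Poly_Mapping.lookup (fst y) 0"
    using w(1-3) by (simp add: lookup_mult_zero_poly lookup_minus lookup_denoms_zero)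
qed

lemma coeff_at_zero_hom:
  fixes x y :: "('n::finite) coeff"
  shows "coeff_at_zero (0 :: 'n coeff) = 0" "coeff_at_zero (1 :: 'n coeff) = 1"
    "coeff_at_zero (x + y) = coeff_at_zero x + coeff_at_zero y"
    "coeff_at_zero (x * y) = coeff_at_zero x * coeff_at_zero y"
proof -
  show "coeff_at_zero (0 :: 'n coeff) = 0" by transfer simp
  show "coeff_at_zero (1 :: 'n coeff) = 1" by transfer (simp add: lookup_one)
  show "coeff_at_zero (x + y) = coeff_at_zero x + coeff_at_zero y"
    by transfer (auto simp: lookup_add lookup_mult_zero_poly lookup_denoms_zero frac_eq_def)
  show "coeff_at_zero (x * y) = coeff_at_zero x * coeff_at_zero y"
    by transfer (simp add: lookup_mult_zero_poly)
qed

lemma coeff_at_zero_minus: "coeff_at_zero (x - y) = coeff_at_zero x - coeff_at_zero y"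
  using coeff_at_zero_hom(3)[of "x - y" y] by simp

lemma coeff_at_zero_par:
  "coeff_at_zero (hpar i :: ('n::finite) coeff) = 0"
  "coeff_at_zero (qpar i j :: 'n coeff) = 0"
proof -
  have "coeff_at_zero (coeff_of_poly a) = Poly_Mapping.lookup a 0" for a :: "'n par_poly"
    unfolding coeff_of_poly_def
    by (subst coeff_at_zero.abs_eq) (auto intro!: frac_eqI_strict denoms_one)
  then show "coeff_at_zero (hpar i :: 'n coeff) = 0" "coeff_at_zero (qpar i j :: 'n coeff) = 0"
    by (simp_all add: hpar_def qpar_def lookup_pvar_zero coeff_at_zero_hom)
qed

definition aug :: "('n::finite) free_alg \<Rightarrow> int" where
  "aug x = coeff_at_zero (Poly_Mapping.lookup x 0)"

lemma aug_simps:
  "aug 0 = 0" "aug 1 = 1"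
  "aug (x + y) = aug x + aug y" "aug (x - y) = aug x - aug y" "aug (x * y) = aug x * aug y"
  "aug (fu i j) = 0" "aug (fz i) = 0" "aug (fscalar c) = coeff_at_zero c"
proof -
  have key: "l + r = 0 \<longleftrightarrow> l = 0 \<and> r = 0" for l r :: "'g fmonoid"
    by (cases l; cases r) (simp add: zero_fmonoid_def plus_fmonoid_def)
  show "aug (x * y) = aug x * aug y"
    by (simp add: aug_def lookup_mult_zero key coeff_at_zero_hom)
qed (simp_all add: aug_def lookup_add lookup_minus lookup_one lookup_single when_def
      coeff_at_zero_hom coeff_at_zero_minus fu_def fz_def fscalar_def zero_fmonoid_def)

lemma aug_ideal: "x \<in> two_sided_ideal relators \<Longrightarrow> aug x = 0"
proof (induction rule: two_sided_ideal.induct)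
  case (ideal_base x)
  then show ?case
    by (cases rule: relators.cases) (simp_all add: aug_simps coeff_at_zero_par power2_eq_square)
qed (simp_all add: aug_simps)

instantiation tht :: (finite) ring_1
begin

lift_definition zero_tht :: "'a tht" is "0" .

lift_definition one_tht :: "'a tht" is "1" .

lift_definition plus_tht :: "'a tht \<Rightarrow> 'a tht \<Rightarrow> 'a tht" is "(+)"
  unfolding rel_eq_def
proof -
  fix x x' y y' :: "'a free_alg"
  assume "x - x' \<in> two_sided_ideal relators" "y - y' \<in> two_sided_ideal relators"
  then have "(x - x') + (y - y') \<in> two_sided_ideal relators" by (rule ideal_add)
  then show "x + y - (x' + y') \<in> two_sided_ideal relators" by (simp add: algebra_simps)
qed

lift_definition uminus_tht :: "'a tht \<Rightarrow> 'a tht" is "uminus"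
  unfolding rel_eq_def by (metis ideal_uminus minus_diff_eq uminus_add_conv_diff diff_minus_eq_add)

lift_definition minus_tht :: "'a tht \<Rightarrow> 'a tht \<Rightarrow> 'a tht" is "(-)"
  unfolding rel_eq_def
proof -
  fix x x' y y' :: "'a free_alg"
  assume "x - x' \<in> two_sided_ideal relators" "y - y' \<in> two_sided_ideal relators"
  then have "(x - x') - (y - y') \<in> two_sided_ideal relators" by (rule ideal_minus)
  then show "x - y - (x' - y') \<in> two_sided_ideal relators" by (simp add: algebra_simps)
qed

lift_definition times_tht :: "'a tht \<Rightarrow> 'a tht \<Rightarrow> 'a tht" is "(*)"
  unfolding rel_eq_def
proof -
  fix x x' y y' :: "'a free_alg"
  assume "x - x' \<in> two_sided_ideal relators" "y - y' \<in> two_sided_ideal relators"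
  then have "(x - x') * y + x' * (y - y') \<in> two_sided_ideal relators"
    by (intro ideal_add ideal_mult_left ideal_mult_right)
  then show "x * y - x' * y' \<in> two_sided_ideal relators" by (simp add: algebra_simps)
qed

instance
proof
  fix a b c :: "'a tht"
  have refl: "rel_eq x y" if "x = y" for x y :: "'a free_alg"
    using that by (simp add: rel_eq_def ideal_zero)
  show "a + b + c = a + (b + c)" by transfer (auto intro!: refl simp: algebra_simps)
  show "a + b = b + a" by transfer (auto intro!: refl simp: algebra_simps)
  show "0 + a = a" by transfer (auto intro!: refl simp: algebra_simps)
  show "- a + a = 0" by transfer (auto intro!: refl simp: algebra_simps)
  show "a - b = a + - b" by transfer (auto intro!: refl simp: algebra_simps)
  show "a * b * c = a * (b * c)" by transfer (auto intro!: refl simp: algebra_simps)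
  show "1 * a = a" by transfer (auto intro!: refl simp: algebra_simps)
  show "a * 1 = a" by transfer (auto intro!: refl simp: algebra_simps)
  show "(a + b) * c = a * c + b * c" by transfer (auto intro!: refl simp: algebra_simps)
  show "a * (b + c) = a * b + a * c" by transfer (auto intro!: refl simp: algebra_simps)
  show "(0 :: 'a tht) \<noteq> 1"
  proof transfer
    show "\<not> rel_eq 0 (1 :: 'a free_alg)"
      using aug_ideal[of "0 - 1 :: 'a free_alg"]
      by (auto simp: rel_eq_def aug_simps simp del: diff_0)
  qed
qed

end

definition scalar :: "('n::finite) coeff \<Rightarrow> 'n tht" where
  "scalar c = abs_tht (fscalar c)"

definition u :: "nat \<Rightarrow> nat \<Rightarrow> ('n::finite) tht" where
  "u i j = abs_tht (fu i j)"

definition z :: "nat \<Rightarrow> ('n::finite) tht" where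
  "z i = abs_tht (fz i)"

lemma fscalar_hom:
  "fscalar 1 = 1" "fscalar (a + b) = fscalar a + fscalar b"
  "fscalar (a - b) = fscalar a - fscalar b" "fscalar (a * b) = fscalar a * fscalar b"
  by (simp_all add: fscalar_def single_add single_diff mult_single)

lemma scalar_hom:
  "scalar 1 = 1" "scalar (a + b) = scalar a + scalar b"
  "scalar (a - b) = scalar a - scalar b" "scalar (a * b) = scalar a * scalar b"
  by (simp_all add: scalar_def fscalar_hom one_tht_def plus_tht.abs_eq minus_tht.abs_eq
      times_tht.abs_eq)

lemma fscalar_central: "fscalar c * x = x * fscalar c"
proof (induction x rule: update_induct)
  case (update f w b)
  have "Poly_Mapping.update w b f = f + Poly_Mapping.single w b"
    using update.hyps
    by (intro poly_mapping_eqI) (auto simp: lookup_add lookup_update lookup_single when_def in_keys_iff)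
  with update show ?case
    by (simp add: distrib_left distrib_right fscalar_def mult_single mult.commute)
qed simp

lemma scalar_central: "scalar c * x = x * scalar c"
  unfolding scalar_def by (induction x) (simp add: times_tht.abs_eq fscalar_central)

lemma tht_u_square:
  assumes "1 \<le> i" "i < j" "j \<le> CARD('n)"
  shows "u i j * u i j = scalar bpar * u i j + (scalar (qpar i j) :: ('n::finite) tht)"
proof -
  have "rel_eq (fu i j * fu i j) (fscalar bpar * fu i j + fscalar (qpar i j) :: 'n free_alg)"
    using ideal_base[OF relators.u_square[OF assms]]
    by (simp add: rel_eq_def power2_eq_square algebra_simps)
  then show ?thesis
    by (simp add: u_def scalar_def times_tht.abs_eq plus_tht.abs_eq abs_tht_eq_iff)
qed

definition hh :: "nat \<Rightarrow> nat \<Rightarrow> ('n::finite) tht" where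
  "hh i j = 1 + scalar tpar * u i j"

definition hh_inv :: "nat \<Rightarrow> nat \<Rightarrow> ('n::finite) tht" where
  "hh_inv i j = scalar (kappa_inv i j) * (1 + scalar (tpar * bpar) - scalar tpar * u i j)"

lemma hh_inverse:
  assumes "1 \<le> i" "i < j" "j \<le> CARD('n)"
  shows "hh i j * hh_inv i j = (1 :: ('n::finite) tht)" "hh_inv i j * hh i j = (1 :: 'n tht)"
proof -
  define T B Q K where "T = (scalar tpar :: 'n tht)" and "B = (scalar bpar :: 'n tht)"
    and "Q = (scalar (qpar i j) :: 'n tht)" and "K = (scalar (kappa_inv i j) :: 'n tht)"
  define v where "v = (u i j :: 'n tht)"
  have c: "T * x = x * T" "B * x = x * B" "Q * x = x * Q" "K * x = x * K" for x
    by (simp_all add: T_def B_def Q_def K_def scalar_central)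
  have sq: "v * v = B * v + Q"
    using tht_u_square[OF assms] by (simp add: v_def B_def Q_def)
  have "scalar (kappa i j * kappa_inv i j) = (1 :: 'n tht)"
    by (simp add: kappa_inverse[OF assms] scalar_hom)
  then have k: "(1 + B * T - T * T * Q) * K = 1"
    by (simp add: kappa_def scalar_hom power2_eq_square T_def B_def Q_def K_def)
  have t1: "(T * v) * (T * v) = T * T * (B * v) + T * T * Q"
    by (metis c(1) distrib_left mult.assoc sq)
  have t2: "T * v * (T * B) = T * T * (B * v)"
    by (metis c(1) c(2) mult.assoc)
  have t3: "(T * B) * (T * v) = T * T * (B * v)"
    by (metis c(1) c(2) mult.assoc)
  have "(1 + T * v) * (1 + T * B - T * v) = 1 + B * T - T * T * Q"
    by (simp add: algebra_simps t1[simplified mult.assoc] t2[simplified mult.assoc] c(2)[of T])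
  moreover have "(1 + T * B - T * v) * (1 + T * v) = 1 + B * T - T * T * Q"
    by (simp add: algebra_simps t1[simplified mult.assoc] t3[simplified mult.assoc] c(2)[of T])
  ultimately show "hh i j * hh_inv i j = (1 :: 'n tht)" "hh_inv i j * hh i j = (1 :: 'n tht)"
    using k c(4)
    by (metis (no_types, lifting) K_def B_def T_def v_def hh_def hh_inv_def mult.assoc scalar_hom(4))+
qed

text \<open>\<open>\<DD>\<^sub>i = h\<^bsub>i-1,i\<^esub>\<inverse> \<cdots> h\<^bsub>1,i\<^esub>\<inverse> (1 + z\<^sub>i) h\<^bsub>i,n\<^esub> \<cdots> h\<^bsub>i,i+1\<^esub>\<close>\<close>

definition dunkl :: "nat \<Rightarrow> ('n::finite) tht" where
  "dunkl i = prod_list (map (\<lambda>j. hh_inv j i) (rev [1..<i])) * (1 + z i)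
    * prod_list (map (\<lambda>j. hh i j) (rev [Suc i..<Suc CARD('n)]))"

text \<open>The factors commute, so the increasing order of the product is immaterial.\<close>

definition dunkl_set :: "nat set \<Rightarrow> ('n::finite) tht" where
  "dunkl_set I = prod_list (map dunkl (sorted_list_of_set I))"

end

theory Submission imports Defs
begin

text \<open>
  Put \<open>b = 1 + t \<beta>\<close>, \<open>w\<^sub>i = 1 + z\<^sub>i\<close>, and extend the generators by \<open>u\<^sub>j\<^sub>i = \<beta> - u\<^sub>i\<^sub>j\<close> for \<open>i < j\<close>.  Then
  \<open>h\<^sub>j\<^sub>i = 1 + t u\<^sub>j\<^sub>i\<close> is \<open>1 + t \<beta> - t\<^sup>2 q\<^sub>i\<^sub>j\<close> times the inverse of \<open>h\<^sub>i\<^sub>j\<close>, and the relations look the same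
  for every order of the indices.  By the Yang--Baxter relation, the summand of a set \<open>I\<close> on the left
  side of the theorem equals the product of all \<open>h\<^sub>j\<^sub>i\<close> with \<open>j \<in> I\<close>, \<open>i \<notin> I\<close> and all \<open>w\<^sub>j\<close> with \<open>j \<in> I\<close>: the
  factors with \<open>i < j\<close> stand to the left of the \<open>w\<^sub>j\<close>, the others to the right (\<open>iprod_dunkl_elem\<close>).

  The sum \<open>S(m, k)\<close> of these products over the \<open>k\<close>-element subsets of \<open>{1..m}\<close> satisfies the recursion
  \<open>S(m+1, k+1) = b\<^sup>k\<^sup>+\<^sup>1 S(m, k+1) + S(m, k) (b\<^sup>m\<^sup>-\<^sup>k w\<^sub>m\<^sub>+\<^sub>1 + t (h\<^sub>m\<^sub>+\<^sub>1 - \<beta>) (1 + b + \<dots> + b\<^sup>m\<^sup>-\<^sup>k\<^sup>-\<^sup>1))\<close>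
  (\<open>sum_normal_form_Suc\<close>), and so does the right side of the theorem (\<open>sum_chains_Suc\<close>).
  For the recursion let \<open>s = m + 1\<close> be the new index.  Two expansions make the products of the \<open>h\<^sub>j\<^sub>s\<close>
  and of the \<open>h\<^sub>s\<^sub>i\<close> linear in the elements \<open>h\<^sub>c\<^sub>s - 1\<close>:
  \<open>W_times_iprod\<close> for the subsets without \<open>s\<close>, and \<open>dprod_expand\<close> for the subsets containing \<open>s\<close>.
  The linear terms of a set \<open>I\<close> of the first kind cancel those of the sets \<open>(I - {c}) \<union> {s}\<close> with \<open>c \<in> I\<close>.

  If the parameters \<open>h\<^sub>2, \<dots>, h\<^sub>n\<close> are not all equal, the expansion \<open>W_times_iprod\<close> leaves terms with a
  factor \<open>h\<^sub>k - h\<^sub>c\<close>.  They vanish: multiplying the three-term relation for \<open>i < c < k\<close> by \<open>w\<^sub>i\<close> and moving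
  \<open>w\<^sub>i\<close> through both sides yields \<open>(h\<^sub>k - h\<^sub>c) (u\<^sub>c\<^sub>k - \<beta>) = 0\<close> in the algebra (\<open>triangle_collapse\<close>).
\<close>

section \<open>Ordered products over finite sets of natural numbers\<close>

text \<open>
  The product of a family over a finite set of indices, in increasing order of the index.
  An infinite set gives the empty product.
\<close>

definition iprod :: "(nat \<Rightarrow> 'a::monoid_mult) \<Rightarrow> nat set \<Rightarrow> 'a" where
  "iprod f A = prod_list (map f (sorted_list_of_set A))"

text \<open>
  The same product in decreasing order of the index.
\<close>

definition dprod :: "(nat \<Rightarrow> 'a::monoid_mult) \<Rightarrow> nat set \<Rightarrow> 'a" where
  "dprod f A = prod_list (map f (rev (sorted_list_of_set A)))"

lemma iprod_empty [simp]: "iprod f {} = 1" and dprod_empty [simp]: "dprod f {} = 1"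
  by (simp_all add: iprod_def dprod_def)

lemma sorted_list_of_set_insert_max:
  assumes "finite A" "\<forall>a\<in>A. a < m"
  shows "sorted_list_of_set (insert m A) = sorted_list_of_set A @ [m]"
  using sorted_list_of_set.idem_if_sorted_distinct[of "sorted_list_of_set A @ [m]"] assms
  by (auto simp: sorted_append less_imp_le)

lemma sorted_list_of_set_insert_min:
  assumes "finite A" "\<forall>a\<in>A. m < a"
  shows "sorted_list_of_set (insert m A) = m # sorted_list_of_set A"
  using sorted_list_of_set.idem_if_sorted_distinct[of "m # sorted_list_of_set A"] assms
  by (auto simp: less_imp_le)

lemma iprod_insert_max: "finite A \<Longrightarrow> \<forall>a\<in>A. a < m \<Longrightarrow> iprod f (insert m A) = iprod f A * f m"
  and dprod_insert_max: "finite A \<Longrightarrow> \<forall>a\<in>A. a < m \<Longrightarrow> dprod f (insert m A) = f m * dprod f A"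
  and iprod_insert_min: "finite A \<Longrightarrow> \<forall>a\<in>A. m < a \<Longrightarrow> iprod f (insert m A) = f m * iprod f A"
  and dprod_insert_min: "finite A \<Longrightarrow> \<forall>a\<in>A. m < a \<Longrightarrow> dprod f (insert m A) = dprod f A * f m"
  by (simp_all add: iprod_def dprod_def sorted_list_of_set_insert_max sorted_list_of_set_insert_min
      del: sorted_list_of_set_insert_remove)

lemma prod_list_commute:
  fixes x :: "'a::monoid_mult"
  assumes "\<And>a. a \<in> set l \<Longrightarrow> x * f a = f a * x"
  shows "x * prod_list (map f l) = prod_list (map f l) * x"
  using assms
proof (induction l)
  case (Cons a l)
  then have "x * f a = f a * x" "x * prod_list (map f l) = prod_list (map f l) * x" by simp_all
  then show ?case by (simp, metis mult.assoc)
qed simp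

lemma iprod_commute:
  assumes "\<And>a. a \<in> A \<Longrightarrow> x * f a = f a * x"
  shows "x * iprod f A = iprod f A * x"
  using assms unfolding iprod_def
  by (cases "finite A") (auto intro: prod_list_commute simp: sorted_list_of_set.fold_insort_key.infinite)

lemma dprod_commute:
  assumes "\<And>a. a \<in> A \<Longrightarrow> x * f a = f a * x"
  shows "x * dprod f A = dprod f A * x"
  using assms unfolding dprod_def
  by (cases "finite A") (auto intro: prod_list_commute simp: sorted_list_of_set.fold_insort_key.infinite)

lemma iprod_cong:
  assumes "A = B" "\<And>a. a \<in> B \<Longrightarrow> f a = g a"
  shows "iprod f A = iprod g B"
  using assms unfolding iprod_def
  by (cases "finite A") (auto intro!: arg_cong[of _ _ prod_list])

lemma dprod_cong:
  assumes "A = B" "\<And>a. a \<in> B \<Longrightarrow> f a = g a"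
  shows "dprod f A = dprod g B"
  using assms unfolding dprod_def
  by (cases "finite A") (auto intro!: arg_cong[of _ _ prod_list])

lemma iprod_split:
  assumes "finite A" "\<And>x y. x \<in> A \<Longrightarrow> y \<in> B \<Longrightarrow> x < y" "finite B"
  shows "iprod f (A \<union> B) = iprod f A * iprod f B"
  using assms(3,1,2)
proof (induction B rule: finite_linorder_max_induct)
  case (insert x B)
  have "iprod f (A \<union> insert x B) = iprod f (A \<union> B) * f x"
    using insert iprod_insert_max[of "A \<union> B" x f] by auto
  also have "iprod f (A \<union> B) = iprod f A * iprod f B"
    using insert by simp
  finally show ?case using insert by (simp add: iprod_insert_max mult.assoc)
qed simp

lemma dprod_split:
  assumes "finite A" "\<And>x y. x \<in> A \<Longrightarrow> y \<in> B \<Longrightarrow> x < y" "finite B"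
  shows "dprod f (A \<union> B) = dprod f B * dprod f A"
  using assms(3,1,2)
proof (induction B rule: finite_linorder_max_induct)
  case (insert x B)
  have "dprod f (A \<union> insert x B) = f x * dprod f (A \<union> B)"
    using insert dprod_insert_max[of "A \<union> B" x f] by auto
  also have "dprod f (A \<union> B) = dprod f B * dprod f A"
    using insert by simp
  finally show ?case using insert by (simp add: dprod_insert_max mult.assoc)
qed simp

lemma commute_times:
  fixes x :: "'a::semigroup_mult"
  assumes "x * y = y * x" "x * v = v * x"
  shows "x * (y * v) = (y * v) * x"
  by (metis assms mult.assoc)

lemma iprod_insert_between:
  assumes "finite A" "finite B" "\<And>a. a \<in> A \<Longrightarrow> a < c" "\<And>a. a \<in> B \<Longrightarrow> c < a"
  shows "iprod f (A \<union> insert c B) = iprod f A * f c * iprod f B"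
proof -
  have "iprod f (A \<union> insert c B) = iprod f A * iprod f (insert c B)"
    using assms by (intro iprod_split) (auto intro: less_trans)
  then show ?thesis using assms by (simp add: iprod_insert_min mult.assoc)
qed

lemma dprod_insert_between:
  assumes "finite A" "finite B" "\<And>a. a \<in> A \<Longrightarrow> a < c" "\<And>a. a \<in> B \<Longrightarrow> c < a"
  shows "dprod f (A \<union> insert c B) = dprod f B * f c * dprod f A"
proof -
  have "dprod f (A \<union> insert c B) = dprod f (insert c B) * dprod f A"
    using assms by (intro dprod_split) (auto intro: less_trans)
  then show ?thesis using assms by (simp add: dprod_insert_min mult.assoc)
qed

lemma iprod_insert_commute:
  assumes "finite A" "c \<notin> A" "\<And>a. a \<in> A \<Longrightarrow> f c * f a = f a * f c"
  shows "iprod f (insert c A) = f c * iprod f A"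
proof -
  have "a < c \<or> c < a" if "a \<in> A" for a
    using that assms(2) by (cases a c rule: linorder_cases) auto
  then have parts: "A \<inter> {..<c} \<union> A \<inter> {c<..} = A" by auto
  have A: "iprod f A = iprod f (A \<inter> {..<c}) * iprod f (A \<inter> {c<..})"
    using iprod_split[of "A \<inter> {..<c}" "A \<inter> {c<..}" f] assms unfolding parts by auto
  have "insert c A = A \<inter> {..<c} \<union> insert c (A \<inter> {c<..})" using parts by auto
  then have "iprod f (insert c A) = iprod f (A \<inter> {..<c}) * f c * iprod f (A \<inter> {c<..})"
    using assms by (simp only:) (intro iprod_insert_between, auto)
  also have "iprod f (A \<inter> {..<c}) * f c = f c * iprod f (A \<inter> {..<c})"
    using assms by (intro iprod_commute[symmetric]) auto
  finally show ?thesis by (simp add: A mult.assoc)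
qed

lemma dprod_times:
  assumes "finite A" "\<And>m n. \<lbrakk>m \<in> A; n \<in> A; n < m\<rbrakk> \<Longrightarrow> e m * f n = f n * e m"
  shows "dprod f A * dprod e A = dprod (\<lambda>n. f n * e n) A"
  using assms
proof (induction A rule: finite_linorder_max_induct)
  case (insert x A)
  have c: "e x * dprod f A = dprod f A * e x"
    using insert by (intro dprod_commute) auto
  have "f x * dprod f A * (e x * dprod e A) = f x * (dprod f A * e x) * dprod e A"
    by (simp only: mult.assoc)
  also have "\<dots> = f x * e x * (dprod f A * dprod e A)"
    unfolding c[symmetric] by (simp only: mult.assoc)
  finally show ?case using insert by (simp add: dprod_insert_max)
qed simp

lemma inverse_commute:
  fixes x :: "'a::monoid_mult"
  assumes "x * y = y * x" "y * v = 1" "v * y = 1"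
  shows "x * v = v * x"
proof -
  have "x * v = (v * y) * x * v" using assms by simp
  also have "\<dots> = v * (x * y) * v" unfolding assms(1) by (simp only: mult.assoc)
  also have "\<dots> = v * x * (y * v)" by (simp only: mult.assoc)
  also have "\<dots> = v * x" unfolding assms(2) by simp
  finally show ?thesis .
qed

lemma iprod_inverse:
  assumes "finite A" "\<And>a. a \<in> A \<Longrightarrow> f a * g a = 1" "\<And>a. a \<in> A \<Longrightarrow> g a * f a = 1"
  shows "iprod f A * dprod g A = 1" "dprod g A * iprod f A = 1"
proof -
  have "iprod f A * dprod g A = 1 \<and> dprod g A * iprod f A = 1"
    using assms
  proof (induction A rule: finite_linorder_max_induct)
    case (insert x A)
    have IH: "iprod f A * dprod g A = 1" "dprod g A * iprod f A = 1" using insert by auto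
    have "iprod f A * f x * (g x * dprod g A) = iprod f A * (f x * g x) * dprod g A"
      "g x * dprod g A * (iprod f A * f x) = g x * (dprod g A * iprod f A) * f x"
      by (simp_all only: mult.assoc)
    then show ?case using insert IH by (simp add: iprod_insert_max dprod_insert_max)
  qed simp
  then show "iprod f A * dprod g A = 1" "dprod g A * iprod f A = 1" by auto
qed

section \<open>Sums over subsets and over increasing sequences\<close>

text \<open>
  The expansions below have a summand for each \<open>c \<in> A\<close> that depends on the part of \<open>A\<close> below \<open>c\<close> and
  the part above \<open>c\<close>.  These two rules describe such a sum when \<open>A\<close> gets a new largest or smallest
  element.
\<close>

lemma sum_insert_max_parts:
  fixes F :: "nat set \<Rightarrow> nat \<Rightarrow> nat set \<Rightarrow> 'a::comm_monoid_add"
  assumes "finite A" "\<forall>a\<in>A. a < x"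
  shows "(\<Sum>c\<in>insert x A. F (insert x A \<inter> {..<c}) c (insert x A \<inter> {c<..}))
    = F A x {} + (\<Sum>c\<in>A. F (A \<inter> {..<c}) c (insert x (A \<inter> {c<..})))"
proof -
  have "x \<notin> A" using assms by auto
  have 1: "insert x A \<inter> {..<x} = A" "insert x A \<inter> {x<..} = {}" using assms by auto
  have 2: "insert x A \<inter> {..<c} = A \<inter> {..<c}" "insert x A \<inter> {c<..} = insert x (A \<inter> {c<..})"
    if "c \<in> A" for c using assms that by auto
  show ?thesis using assms \<open>x \<notin> A\<close> by (simp add: 1 2 cong: sum.cong)
qed

lemma sum_insert_min_parts:
  fixes F :: "nat set \<Rightarrow> nat \<Rightarrow> nat set \<Rightarrow> 'a::comm_monoid_add"
  assumes "finite A" "\<forall>a\<in>A. x < a"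
  shows "(\<Sum>c\<in>insert x A. F (insert x A \<inter> {..<c}) c (insert x A \<inter> {c<..}))
    = F {} x A + (\<Sum>c\<in>A. F (insert x (A \<inter> {..<c})) c (A \<inter> {c<..}))"
proof -
  have "x \<notin> A" using assms by auto
  have 1: "insert x A \<inter> {..<x} = {}" "insert x A \<inter> {x<..} = A" using assms by auto
  have 2: "insert x A \<inter> {..<c} = insert x (A \<inter> {..<c})" "insert x A \<inter> {c<..} = A \<inter> {c<..}"
    if "c \<in> A" for c using assms that by auto
  show ?thesis using assms \<open>x \<notin> A\<close> by (simp add: 1 2 cong: sum.cong)
qed

lemma subsets_card_Suc:
  "{I. I \<subseteq> {1..Suc m} \<and> card I = Suc k}
    = {I. I \<subseteq> {1..m} \<and> card I = Suc k} \<union> insert (Suc m) ` {I. I \<subseteq> {1..m} \<and> card I = k}"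
proof (intro equalityI subsetI)
  fix I assume "I \<in> {I. I \<subseteq> {1..Suc m} \<and> card I = Suc k}"
  then have I: "I \<subseteq> {1..Suc m}" "card I = Suc k" "finite I" using finite_subset by auto
  show "I \<in> {I. I \<subseteq> {1..m} \<and> card I = Suc k} \<union> insert (Suc m) ` {I. I \<subseteq> {1..m} \<and> card I = k}"
  proof (cases "Suc m \<in> I")
    case True
    then have "I = insert (Suc m) (I - {Suc m})" "I - {Suc m} \<subseteq> {1..m}" "card (I - {Suc m}) = k"
      using I by (auto simp: le_Suc_eq)
    then show ?thesis by blast
  next
    case False
    then have "I \<subseteq> {1..m}" using I by (auto simp: le_Suc_eq)
    then show ?thesis using I by blast
  qed
next
  fix I assume "I \<in> {I. I \<subseteq> {1..m} \<and> card I = Suc k} \<union> insert (Suc m) ` {I. I \<subseteq> {1..m} \<and> card I = k}"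
  then show "I \<in> {I. I \<subseteq> {1..Suc m} \<and> card I = Suc k}"
  proof
    assume "I \<in> insert (Suc m) ` {I. I \<subseteq> {1..m} \<and> card I = k}"
    then obtain J where J: "I = insert (Suc m) J" "J \<subseteq> {1..m}" "card J = k" by auto
    then have "finite J" "Suc m \<notin> J" using finite_subset by auto
    then show ?thesis using J by auto
  qed auto
qed

lemma sum_subsets_Suc:
  fixes f :: "nat set \<Rightarrow> 'a::comm_monoid_add"
  shows "(\<Sum>I | I \<subseteq> {1..Suc m} \<and> card I = Suc k. f I)
    = (\<Sum>I | I \<subseteq> {1..m} \<and> card I = Suc k. f I)
      + (\<Sum>I | I \<subseteq> {1..m} \<and> card I = k. f (insert (Suc m) I))"
proof -
  have "inj_on (insert (Suc m)) {I. I \<subseteq> {1..m} \<and> card I = k}"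
  proof (rule inj_onI)
    fix I J assume IJ: "I \<in> {I. I \<subseteq> {1..m} \<and> card I = k}" "J \<in> {I. I \<subseteq> {1..m} \<and> card I = k}"
      and eq: "insert (Suc m) I = insert (Suc m) J"
    have "Suc m \<notin> I" "Suc m \<notin> J" using IJ by auto
    then show "I = J" using eq by (metis insert_ident)
  qed
  moreover have "finite {I. I \<subseteq> {1..m} \<and> card I = j}" for j
    by (rule finite_subset[of _ "Pow {1..m}"]) auto
  moreover have "{I. I \<subseteq> {1..m} \<and> card I = Suc k} \<inter> insert (Suc m) ` {I. I \<subseteq> {1..m} \<and> card I = k} = {}"
    by auto
  ultimately show ?thesis
    unfolding subsets_card_Suc by (simp add: sum.union_disjoint sum.reindex)
qed

lemma Int_atMost_Suc_eqD:
  assumes "I \<inter> {1..Suc m} = J \<inter> {1..Suc m}"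
  shows "I \<inter> {1..m} = J \<inter> {1..m}" "Suc m \<in> I \<longleftrightarrow> Suc m \<in> J"
proof -
  have "K \<inter> {1..m} = (K \<inter> {1..Suc m}) \<inter> {1..m}" "Suc m \<in> K \<longleftrightarrow> Suc m \<in> K \<inter> {1..Suc m}" for K
    by auto
  then show "I \<inter> {1..m} = J \<inter> {1..m}" "Suc m \<in> I \<longleftrightarrow> Suc m \<in> J"
    using assms by metis+
qed

text \<open>
  Double counting of the pairs \<open>c \<in> I\<close>, indexed on the right by \<open>J = I - {c}\<close>.
\<close>

lemma sum_remove_element:
  fixes f :: "nat set \<Rightarrow> nat \<Rightarrow> 'a::comm_monoid_add"
  assumes "finite A"
  shows "(\<Sum>I | I \<subseteq> A \<and> card I = Suc k. \<Sum>c\<in>I. f I c)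
    = (\<Sum>J | J \<subseteq> A \<and> card J = k. \<Sum>c\<in>A - J. f (insert c J) c)"
proof -
  have fin: "finite {I. I \<subseteq> A \<and> card I = j}" for j
    using assms by (auto intro: finite_subset[of _ "Pow A"])
  have fin': "finite I" if "I \<subseteq> A" for I using that assms finite_subset by blast
  have "(\<Sum>I | I \<subseteq> A \<and> card I = Suc k. \<Sum>c\<in>I. f I c)
      = (\<Sum>(I, c)\<in>(SIGMA I:{I. I \<subseteq> A \<and> card I = Suc k}. I). f I c)"
    using fin fin' by (intro sum.Sigma) auto
  also have "\<dots> = (\<Sum>(J, c)\<in>(SIGMA J:{J. J \<subseteq> A \<and> card J = k}. A - J). f (insert c J) c)"
  proof (rule sum.reindex_bij_witness[of _ "\<lambda>(J, c). (insert c J, c)" "\<lambda>(I, c). (I - {c}, c)"])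
    fix p assume "p \<in> (SIGMA I:{I. I \<subseteq> A \<and> card I = Suc k}. I)"
    then obtain I c where p: "p = (I, c)" "I \<subseteq> A" "card I = Suc k" "c \<in> I" by auto
    then have I: "insert c (I - {c}) = I" "card (I - {c}) = k"
      using fin'[OF p(2)] by auto
    show "(case case p of (I, c) \<Rightarrow> (I - {c}, c) of (J, c) \<Rightarrow> (insert c J, c)) = p"
      "(case case p of (I, c) \<Rightarrow> (I - {c}, c) of (J, c) \<Rightarrow> f (insert c J) c) = (case p of (I, c) \<Rightarrow> f I c)"
      unfolding p(1) prod.case I by (rule refl)+
    show "(case p of (I, c) \<Rightarrow> (I - {c}, c)) \<in> (SIGMA J:{J. J \<subseteq> A \<and> card J = k}. A - J)"
      unfolding p(1) prod.case using p I by blast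
  next
    fix p assume "p \<in> (SIGMA J:{J. J \<subseteq> A \<and> card J = k}. A - J)"
    then obtain J c where p: "p = (J, c)" "J \<subseteq> A" "card J = k" "c \<in> A" "c \<notin> J" by auto
    have J: "insert c J - {c} = J" "card (insert c J) = Suc k"
      using p fin'[OF p(2)] by auto
    show "(case case p of (J, c) \<Rightarrow> (insert c J, c) of (I, c) \<Rightarrow> (I - {c}, c)) = p"
      unfolding p(1) prod.case J by (rule refl)
    show "(case p of (J, c) \<Rightarrow> (insert c J, c)) \<in> (SIGMA I:{I. I \<subseteq> A \<and> card I = Suc k}. I)"
      unfolding p(1) prod.case using p J by blast
  qed
  also have "\<dots> = (\<Sum>J | J \<subseteq> A \<and> card J = k. \<Sum>c\<in>A - J. f (insert c J) c)"
    using fin assms by (intro sum.Sigma[symmetric]) auto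
  finally show ?thesis .
qed

text \<open>
  The sequences \<open>1 \<le> i 1 < \<dots> < i k \<le> n\<close>, as extensional functions on \<open>{1..k}\<close>.
\<close>

definition chains :: "nat \<Rightarrow> nat \<Rightarrow> (nat \<Rightarrow> nat) set" where
  "chains n k = {i. i \<in> {1..k} \<rightarrow>\<^sub>E {1..n} \<and> strict_mono_on {1..k} i}"

lemma chains_gap:
  assumes "i \<in> chains n k" "1 \<le> a" "a + d \<le> k"
  shows "i a + d \<le> i (a + d)"
  using assms(3)
proof (induction d)
  case (Suc d)
  have "strict_mono_on {1..k} i" using assms by (simp add: chains_def)
  then have "i (a + d) < i (a + Suc d)"
    using Suc.prems assms by (auto simp: strict_mono_on_def)
  then show ?case using Suc by simp
qed simp

lemma chains_bounds:
  assumes "i \<in> chains n k" "1 \<le> a" "a \<le> k"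
  shows "a \<le> i a" "i a + k \<le> n + a"
proof -
  have r: "i c \<in> {1..n}" if "c \<in> {1..k}" for c
    using assms that by (auto simp: chains_def PiE_def Pi_def)
  have "i 1 + (a - 1) \<le> i (1 + (a - 1))"
    using assms by (intro chains_gap) auto
  moreover have "1 \<le> i 1" using r[of 1] assms by auto
  ultimately show "a \<le> i a" using assms by simp
  have "i a + (k - a) \<le> i (a + (k - a))"
    using assms by (intro chains_gap) auto
  moreover have "i k \<le> n" using r[of k] assms by auto
  ultimately show "i a + k \<le> n + a" using assms by simp
qed

lemma finite_chains: "finite (chains n k)"
  by (rule finite_subset[of _ "{1..k} \<rightarrow>\<^sub>E {1..n}"]) (auto simp: chains_def intro: finite_PiE)

lemma chains_Suc:
  "chains (Suc n) (Suc k) = chains n (Suc k) \<union> (\<lambda>i. i(Suc k := Suc n)) ` chains n k"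
proof (intro equalityI subsetI)
  fix i assume i: "i \<in> chains (Suc n) (Suc k)"
  then have r: "i \<in> {1..Suc k} \<rightarrow>\<^sub>E {1..Suc n}" and mono: "strict_mono_on {1..Suc k} i"
    by (auto simp: chains_def)
  have lt: "i a < i (Suc k)" if "a \<in> {1..k}" for a
    using mono that by (auto simp: strict_mono_on_def)
  have rk: "i a \<in> {1..Suc n}" if "a \<in> {1..Suc k}" for a using r that by auto
  have lo: "i a \<in> {1..n}" if "a \<in> {1..k}" for a
    using lt[OF that] rk[of a] rk[of "Suc k"] that by auto
  show "i \<in> chains n (Suc k) \<union> (\<lambda>i. i(Suc k := Suc n)) ` chains n k"
  proof (cases "i (Suc k) = Suc n")
    case True
    define j where "j = i(Suc k := undefined)"
    have "j \<in> {1..k} \<rightarrow>\<^sub>E {1..n}"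
      using r lo by (auto simp: j_def PiE_def extensional_def)
    moreover have "strict_mono_on {1..k} j"
      using mono by (auto simp: j_def strict_mono_on_def)
    moreover have "i = j(Suc k := Suc n)" using True by (auto simp: j_def)
    ultimately show ?thesis by (auto simp: chains_def)
  next
    case False
    then have "i a \<in> {1..n}" if "a \<in> {1..Suc k}" for a
      using that rk[of "Suc k"] lo[of a] by (cases "a = Suc k") auto
    then have "i \<in> {1..Suc k} \<rightarrow>\<^sub>E {1..n}"
      using r by (auto simp: PiE_def)
    then show ?thesis using mono by (simp add: chains_def)
  qed
next
  fix i assume "i \<in> chains n (Suc k) \<union> (\<lambda>i. i(Suc k := Suc n)) ` chains n k"
  then show "i \<in> chains (Suc n) (Suc k)"
  proof
    assume "i \<in> chains n (Suc k)"
    then have "i \<in> {1..Suc k} \<rightarrow>\<^sub>E {1..n}" "strict_mono_on {1..Suc k} i" by (auto simp: chains_def)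
    moreover have "{1..Suc k} \<rightarrow>\<^sub>E {1..n} \<subseteq> {1..Suc k} \<rightarrow>\<^sub>E {1..Suc n}"
      by (rule PiE_mono) auto
    ultimately show ?thesis by (auto simp: chains_def)
  next
    assume "i \<in> (\<lambda>i. i(Suc k := Suc n)) ` chains n k"
    then obtain j where j: "i = j(Suc k := Suc n)" "j \<in> chains n k" by auto
    then have r: "j a \<in> {1..n}" if "a \<in> {1..k}" for a using that by (auto simp: chains_def PiE_def Pi_def)
    have ext: "j a = undefined" if "a \<notin> {1..k}" for a
      using j(2) that by (auto simp: chains_def PiE_def extensional_def)
    have "i \<in> {1..Suc k} \<rightarrow>\<^sub>E {1..Suc n}"
    proof (rule PiE_I)
      fix a assume "a \<in> {1..Suc k}"
      then show "i a \<in> {1..Suc n}" using r[of a] j(1) by (cases "a = Suc k") auto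
    next
      fix a assume "a \<notin> {1..Suc k}"
      then show "i a = undefined" using ext[of a] j(1) by auto
    qed
    moreover have "strict_mono_on {1..Suc k} i"
    proof (rule strict_mono_onI)
      fix a c assume "a \<in> {1..Suc k}" "c \<in> {1..Suc k}" "a < c"
      moreover have "strict_mono_on {1..k} j" using j by (simp add: chains_def)
      ultimately show "i a < i c"
        using r[of a] j(1) by (cases "c = Suc k") (auto simp: strict_mono_on_def)
    qed
    ultimately show ?thesis by (simp add: chains_def)
  qed
qed

text \<open>
  A sequence in \<open>chains (n + 1) (k + 1)\<close> either stays below \<open>n + 1\<close>, which raises each of the \<open>k + 1\<close>
  exponents of \<open>b\<close> by one, or ends in \<open>n + 1\<close>, where the last exponent vanishes.
\<close>

lemma sum_chains_Suc:
  fixes b :: "'a::ring_1" and v :: "nat \<Rightarrow> nat \<Rightarrow> 'a"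
  assumes central: "\<And>x. b * x = x * b"
  defines "S \<equiv> \<lambda>n k. \<Sum>i\<in>chains n k.
      prod_list (map (\<lambda>a. b ^ (n - k + a - i a) * v (i a) (i a - a)) [1..<Suc k])"
  shows "S (Suc n) (Suc k) = b ^ Suc k * S n (Suc k) + S n k * v (Suc n) (n - k)"
proof -
  define f where "f n k i = prod_list (map (\<lambda>a. b ^ (n - k + a - i a) * v (i a) (i a - a)) [1..<Suc k])"
    for n k and i :: "nat \<Rightarrow> nat"
  have S: "S n k = (\<Sum>i\<in>chains n k. f n k i)" for n k unfolding S_def f_def ..
  have disj: "chains n (Suc k) \<inter> (\<lambda>i. i(Suc k := Suc n)) ` chains n k = {}"
    by (auto simp: chains_def PiE_def Pi_def)
  have inj: "inj_on (\<lambda>i. i(Suc k := Suc n)) (chains n k)"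
  proof (rule inj_onI)
    fix i j assume ij: "i \<in> chains n k" "j \<in> chains n k" "i(Suc k := Suc n) = j(Suc k := Suc n)"
    then have "i (Suc k) = undefined" "j (Suc k) = undefined"
      by (auto simp: chains_def PiE_def extensional_def)
    then show "i = j" using ij(3) by (metis fun_upd_triv fun_upd_upd)
  qed
  have pw: "b ^ l * x = x * b ^ l" for l x
  proof (induction l)
    case (Suc l)
    then show ?case using commute_times[of x b "b ^ l"] central by simp
  qed simp
  have scale: "prod_list (map (\<lambda>a. b * e a) l) = b ^ length l * prod_list (map e l)"
    for e :: "nat \<Rightarrow> 'a" and l
  proof (induction l)
    case (Cons c l)
    have "b * e c * (b ^ length l * prod_list (map e l)) = b * (e c * b ^ length l) * prod_list (map e l)"
      by (simp only: mult.assoc)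
    also have "\<dots> = b ^ Suc (length l) * (e c * prod_list (map e l))"
      unfolding pw[symmetric] by (simp add: mult.assoc)
    finally show ?case using Cons by simp
  qed simp
  have low: "f (Suc n) (Suc k) i = b ^ Suc k * f n (Suc k) i" if i: "i \<in> chains n (Suc k)" for i
  proof -
    have "f (Suc n) (Suc k) i = prod_list (map (\<lambda>a. b * (b ^ (n - Suc k + a - i a) * v (i a) (i a - a)))
        [1..<Suc (Suc k)])"
      unfolding f_def
    proof (intro arg_cong[of _ _ prod_list] map_cong refl)
      fix a assume "a \<in> set [1..<Suc (Suc k)]"
      then have "1 \<le> a" "a \<le> Suc k" by auto
      from chains_bounds[OF i this] \<open>a \<le> Suc k\<close>
        chains_bounds(2)[OF i, of "Suc k"] chains_bounds(1)[OF i, of "Suc k"]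
      have e: "Suc n - Suc k + a - i a = Suc (n - Suc k + a - i a)" by auto
      show "b ^ (Suc n - Suc k + a - i a) * v (i a) (i a - a)
          = b * (b ^ (n - Suc k + a - i a) * v (i a) (i a - a))" unfolding e by (simp only: power_Suc mult.assoc)
    qed
    also have "\<dots> = b ^ Suc k * f n (Suc k) i"
      unfolding f_def scale by (simp del: upt_Suc)
    finally show ?thesis .
  qed
  have high: "f (Suc n) (Suc k) (i(Suc k := Suc n)) = f n k i * v (Suc n) (n - k)" if i: "i \<in> chains n k" for i
  proof -
    have "k \<le> n" using chains_bounds[OF i, of k] by (cases k) auto
    have up: "[1..<Suc (Suc k)] = [1..<Suc k] @ [Suc k]" by simp
    have low_part: "map (\<lambda>a. b ^ (Suc n - Suc k + a - (i(Suc k := Suc n)) a)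
        * v ((i(Suc k := Suc n)) a) ((i(Suc k := Suc n)) a - a)) [1..<Suc k]
      = map (\<lambda>a. b ^ (n - k + a - i a) * v (i a) (i a - a)) [1..<Suc k]"
      by (intro map_cong) auto
    show ?thesis
      unfolding f_def up map_append prod_list.append low_part
      using \<open>k \<le> n\<close> by (simp del: upt_Suc)
  qed
  have "S (Suc n) (Suc k) = (\<Sum>i\<in>chains n (Suc k). f (Suc n) (Suc k) i)
      + (\<Sum>i\<in>chains n k. f (Suc n) (Suc k) (i(Suc k := Suc n)))"
    unfolding S chains_Suc using disj inj finite_chains
    by (subst sum.union_disjoint) (auto simp: sum.reindex)
  also have "\<dots> = b ^ Suc k * S n (Suc k) + S n k * v (Suc n) (n - k)"
    unfolding S sum_distrib_left sum_distrib_right by (simp add: low high)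
  finally show ?thesis .
qed

section \<open>Exchange identities in the Yang--Baxter algebra\<close>

text \<open>
  The relations between the elements \<open>h i j = 1 + t u i j\<close>, where \<open>u j i = \<beta> - u i j\<close> for \<open>i < j\<close> and
  \<open>b = 1 + t \<beta>\<close>.  They are invariant under permutations of the indices, so \<open>i < j\<close> is not required.
  The assumption \<open>h_triangle\<close> is \<open>t\<^sup>2\<close> times the three-term relation for \<open>u\<close>.
\<close>

locale exchange_algebra =
  fixes N :: nat and b :: "'a::ring_1" and h :: "nat \<Rightarrow> nat \<Rightarrow> 'a"
  assumes b_central: "b * x = x * b"
    and h_swap: "\<lbrakk>i \<in> {1..N}; j \<in> {1..N}; i \<noteq> j\<rbrakk> \<Longrightarrow> h i j + h j i = 1 + b"
    and h_commute: "\<lbrakk>{i, j, k, l} \<subseteq> {1..N}; distinct [i, j, k, l]\<rbrakk>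
      \<Longrightarrow> h i j * h k l = h k l * h i j"
    and h_triangle: "\<lbrakk>{i, j, k} \<subseteq> {1..N}; distinct [i, j, k]\<rbrakk>
      \<Longrightarrow> (h i k - 1) * h j k = h j i * (h i k - 1) + (h j k - 1) * (h i j - 1)"
    and h_yang_baxter: "\<lbrakk>{i, j, k} \<subseteq> {1..N}; distinct [i, j, k]\<rbrakk>
      \<Longrightarrow> h i j * h i k * h j k = h j k * h i k * h i j"
begin

lemma b_left: "x * b = b * x" "x * (b * y) = b * (x * y)"
  by (metis b_central) (metis b_central mult.assoc)

lemma b_power_central: "b ^ k * x = x * b ^ k"
proof (induction k)
  case (Suc k)
  then show ?case by (metis b_central mult.assoc power_Suc)
qed simp

lemma h_swap': "\<lbrakk>i \<in> {1..N}; j \<in> {1..N}; i \<noteq> j\<rbrakk> \<Longrightarrow> h j i = 1 + b - h i j"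
  using h_swap[of i j] by (metis add_diff_cancel_left')

lemma h_triangle_left:
  assumes "{i, j, k} \<subseteq> {1..N}" "distinct [i, j, k]"
  shows "h k j * (h i k - 1) = (h i k - 1) * h i j - (h i j - 1) * (h j k - 1)"
proof -
  have 1: "h k j = 1 + b - h j k" and 2: "h j i = 1 + b - h i j"
    using assms by (auto intro: h_swap')
  have "(h j k - 1) * h i k = h i j * (h j k - 1) + (h i k - 1) * (h j i - 1)"
    using assms by (intro h_triangle) auto
  then have "h j k * h i k = h i k + h i j * (h j k - 1) + (h i k - 1) * (h j i - 1)"
    by (simp add: algebra_simps)
  then show ?thesis unfolding 1 2 by (simp add: algebra_simps b_left)
qed

lemma h_triangle_right:
  assumes "{i, j, k} \<subseteq> {1..N}" "distinct [i, j, k]"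
  shows "(h k i - 1) * h j k = h j i * (h k i - 1) - (h k j - 1) * (h j i - 1)"
proof -
  have 1: "h k i = 1 + b - h i k" and 2: "h k j = 1 + b - h j k"  and 3: "h i j = 1 + b - h j i"
    using assms by (auto intro: h_swap')
  have "h i k * h j k = h j k + h j i * (h i k - 1) + (h j k - 1) * (h i j - 1)"
    using h_triangle[OF assms] by (simp add: algebra_simps)
  then show ?thesis unfolding 1 2 3 by (simp add: algebra_simps b_left)
qed

text \<open>
  For a new index \<open>s\<close> the product of the \<open>h s i\<close> becomes linear in the elements \<open>h c s - 1\<close>.
  In the induction step a new largest index \<open>x\<close> is moved through by \<open>h_triangle_left\<close>, and the terms
  produced are collected by the induction hypothesis for \<open>s = x\<close>.
\<close>

lemma dprod_expand:
  assumes "A \<subseteq> {1..N}" "s \<in> {1..N}" "s \<notin> A"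
  shows "dprod (h s) A = b ^ card A
    - (\<Sum>c\<in>A. dprod (h c) (A \<inter> {..<c}) * (h c s - 1) * dprod (h c) (A \<inter> {c<..}))"
proof -
  have "finite A" using assms finite_subset by blast
  then show ?thesis using assms
  proof (induction A arbitrary: s rule: finite_linorder_max_induct)
    case (insert x A)
    define L R where "L c = dprod (h c) (A \<inter> {..<c})" and "R c = dprod (h c) (A \<inter> {c<..})" for c
    have x: "x \<notin> A" "x \<in> {1..N}" "x \<noteq> s" and A: "A \<subseteq> {1..N}" "s \<notin> A"
      using insert by auto
    have IHs: "dprod (h s) A = b ^ card A - (\<Sum>c\<in>A. L c * (h c s - 1) * R c)"
      unfolding L_def R_def using insert A by blast
    have IHx: "(\<Sum>c\<in>A. L c * (h c x - 1) * R c) = b ^ card A - dprod (h x) A"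
      using insert.IH[of x] x A unfolding L_def R_def by simp
    have step: "h s x * (L c * (h c s - 1) * R c)
        = L c * (h c s - 1) * (h c x * R c) - L c * (h c x - 1) * R c * (h x s - 1)" if c: "c \<in> A" for c
    proof -
      have 1: "h s x * L c = L c * h s x" unfolding L_def
        using x A c insert.prems by (intro dprod_commute h_commute) auto
      have 2: "(h x s - 1) * R c = R c * (h x s - 1)" unfolding R_def
        using x A c insert.prems
        by (intro dprod_commute) (auto simp: algebra_simps intro!: h_commute)
      have 3: "h s x * (h c s - 1) = (h c s - 1) * h c x - (h c x - 1) * (h x s - 1)"
        using x A c insert.prems by (intro h_triangle_left) auto
      have "h s x * (L c * (h c s - 1) * R c) = L c * (h s x * (h c s - 1)) * R c"
        using 1 by (metis mult.assoc)
      also have "\<dots> = L c * (h c s - 1) * (h c x * R c) - L c * (h c x - 1) * ((h x s - 1) * R c)"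
        unfolding 3 by (simp only: algebra_simps)
      finally show ?thesis by (simp only: 2 mult.assoc)
    qed
    have sw: "h x s - 1 = b - h s x"
      using x insert.prems h_swap'[of s x] by (simp add: algebra_simps)
    have R': "dprod (h c) (insert x (A \<inter> {c<..})) = h c x * R c" for c
      unfolding R_def using insert.hyps by (intro dprod_insert_max) auto
    have "dprod (h s) (insert x A) = h s x * b ^ card A - (\<Sum>c\<in>A. h s x * (L c * (h c s - 1) * R c))"
      using insert.hyps by (simp add: dprod_insert_max IHs right_diff_distrib sum_distrib_left)
    also have "(\<Sum>c\<in>A. h s x * (L c * (h c s - 1) * R c))
        = (\<Sum>c\<in>A. L c * (h c s - 1) * (h c x * R c)) - (b ^ card A - dprod (h x) A) * (h x s - 1)"
      by (simp add: step sum_subtractf flip: sum_distrib_right IHx)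
    also have "h s x * b ^ card A - \<dots>
        = b ^ Suc (card A) - (dprod (h x) A * (h x s - 1) * 1 + (\<Sum>c\<in>A. L c * (h c s - 1) * (h c x * R c)))"
      by (simp add: sw algebra_simps b_power_central[of _ "h s x"] b_power_central[of _ b])
    also have "b ^ Suc (card A) = b ^ card (insert x A)"
      using insert.hyps x by simp
    also have "dprod (h x) A * (h x s - 1) * 1 + (\<Sum>c\<in>A. L c * (h c s - 1) * (h c x * R c))
       = (\<Sum>c\<in>insert x A. dprod (h c) (insert x A \<inter> {..<c}) * (h c s - 1) * dprod (h c) (insert x A \<inter> {c<..}))"
      using insert.hyps sum_insert_max_parts[of A x "\<lambda>A c B. dprod (h c) A * (h c s - 1) * dprod (h c) B"]
      by (simp add: R' L_def)
    finally show ?case .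
  qed simp
qed

text \<open>
  This is the case of one-element subsets, with all \<open>w i\<close> equal to 1: the sum does not depend on \<open>h\<close>.
\<close>

lemma dprod_geometric:
  assumes "A \<subseteq> {1..N}"
  shows "(\<Sum>c\<in>A. dprod (h c) (A \<inter> {..<c}) * dprod (h c) (A \<inter> {c<..})) = (\<Sum>i<card A. b ^ i)"
proof -
  have "finite A" using assms finite_subset by blast
  then show ?thesis using assms
  proof (induction A rule: finite_linorder_max_induct)
    case (insert x A)
    define L R where "L c = dprod (h c) (A \<inter> {..<c})" and "R c = dprod (h c) (A \<inter> {c<..})" for c
    have x: "x \<notin> A" "x \<in> {1..N}" and A: "A \<subseteq> {1..N}" using insert by auto
    have R': "dprod (h c) (insert x (A \<inter> {c<..})) = h c x * R c" for c
      unfolding R_def using insert.hyps by (intro dprod_insert_max) auto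
    have "(\<Sum>c\<in>insert x A. dprod (h c) (insert x A \<inter> {..<c}) * dprod (h c) (insert x A \<inter> {c<..}))
        = dprod (h x) A + (\<Sum>c\<in>A. L c * (h c x * R c))"
      using insert.hyps sum_insert_max_parts[of A x "\<lambda>A c B. dprod (h c) A * dprod (h c) B"]
      by (simp add: R' L_def)
    also have "dprod (h x) A = b ^ card A - (\<Sum>c\<in>A. L c * (h c x - 1) * R c)"
      unfolding L_def R_def using x A by (intro dprod_expand) auto
    also have "\<dots> + (\<Sum>c\<in>A. L c * (h c x * R c)) = b ^ card A + (\<Sum>c\<in>A. L c * R c)"
      by (simp add: algebra_simps sum_subtractf)
    also have "(\<Sum>c\<in>A. L c * R c) = (\<Sum>i<card A. b ^ i)"
      unfolding L_def R_def using insert A by blast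
    finally show ?case using insert.hyps x by simp
  qed simp
qed

text \<open>
  The image of \<open>dprod_expand\<close> under \<open>h i j \<mapsto> h j i\<close>, which preserves all relations, with the order
  of the indices reversed.
\<close>

lemma iprod_expand:
  assumes "A \<subseteq> {1..N}" "s \<in> {1..N}" "s \<notin> A"
  shows "iprod (\<lambda>i. h i s) A = b ^ card A
    - (\<Sum>c\<in>A. iprod (\<lambda>i. h i c) (A \<inter> {c<..}) * (h s c - 1) * iprod (\<lambda>i. h i c) (A \<inter> {..<c}))"
proof -
  have "finite A" using assms finite_subset by blast
  then show ?thesis using assms
  proof (induction A arbitrary: s rule: finite_linorder_max_induct)
    case (insert x A)
    define L R where "L c = iprod (\<lambda>i. h i c) (A \<inter> {c<..})"
      and "R c = iprod (\<lambda>i. h i c) (A \<inter> {..<c})" for c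
    have x: "x \<notin> A" "x \<in> {1..N}" "x \<noteq> s" and A: "A \<subseteq> {1..N}" "s \<notin> A"
      using insert by auto
    have IHs: "iprod (\<lambda>i. h i s) A = b ^ card A - (\<Sum>c\<in>A. L c * (h s c - 1) * R c)"
      unfolding L_def R_def using insert A by blast
    have IHx: "(\<Sum>c\<in>A. L c * (h x c - 1) * R c) = b ^ card A - iprod (\<lambda>i. h i x) A"
      using insert.IH[of x] x A unfolding L_def R_def by simp
    have step: "L c * (h s c - 1) * R c * h x s
        = L c * h x c * (h s c - 1) * R c - (h s x - 1) * (L c * (h x c - 1) * R c)" if c: "c \<in> A" for c
    proof -
      have 1: "h x s * R c = R c * h x s" unfolding R_def
        using x A c insert.prems by (intro iprod_commute h_commute) auto
      have 2: "(h s x - 1) * L c = L c * (h s x - 1)" unfolding L_def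
        using x A c insert.prems
        by (intro iprod_commute) (auto simp: algebra_simps intro!: h_commute)
      have 3: "(h s c - 1) * h x s = h x c * (h s c - 1) - (h s x - 1) * (h x c - 1)"
        using x A c insert.prems by (intro h_triangle_right) auto
      have "L c * (h s c - 1) * R c * h x s = L c * ((h s c - 1) * h x s) * R c"
        using 1 by (metis mult.assoc)
      also have "\<dots> = L c * h x c * (h s c - 1) * R c - (L c * (h s x - 1)) * (h x c - 1) * R c"
        unfolding 3 by (simp only: algebra_simps)
      finally show ?thesis by (simp only: 2[symmetric] mult.assoc)
    qed
    have sw: "h s x - 1 = b - h x s"
      using x insert.prems h_swap'[of x s] by (simp add: algebra_simps)
    have L': "iprod (\<lambda>i. h i c) (insert x (A \<inter> {c<..})) = L c * h x c" for c
      unfolding L_def using insert.hyps by (intro iprod_insert_max) auto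
    have "iprod (\<lambda>i. h i s) (insert x A) = b ^ card A * h x s - (\<Sum>c\<in>A. L c * (h s c - 1) * R c * h x s)"
      using insert.hyps by (simp add: iprod_insert_max IHs left_diff_distrib sum_distrib_right)
    also have "(\<Sum>c\<in>A. L c * (h s c - 1) * R c * h x s)
        = (\<Sum>c\<in>A. L c * h x c * (h s c - 1) * R c) - (h s x - 1) * (b ^ card A - iprod (\<lambda>i. h i x) A)"
      by (simp add: step sum_subtractf flip: sum_distrib_left IHx)
    also have "b ^ card A * h x s - \<dots>
        = b ^ Suc (card A) - (1 * (h s x - 1) * iprod (\<lambda>i. h i x) A + (\<Sum>c\<in>A. L c * h x c * (h s c - 1) * R c))"
      by (simp add: sw algebra_simps b_power_central[of _ "h x s"] b_power_central[of _ b])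
    also have "b ^ Suc (card A) = b ^ card (insert x A)"
      using insert.hyps x by simp
    also have "1 * (h s x - 1) * iprod (\<lambda>i. h i x) A + (\<Sum>c\<in>A. L c * h x c * (h s c - 1) * R c)
       = (\<Sum>c\<in>insert x A. iprod (\<lambda>i. h i c) (insert x A \<inter> {c<..}) * (h s c - 1) * iprod (\<lambda>i. h i c) (insert x A \<inter> {..<c}))"
      using insert.hyps sum_insert_max_parts[of A x "\<lambda>A c B. iprod (\<lambda>i. h i c) B * (h s c - 1) * iprod (\<lambda>i. h i c) A"]
      by (simp add: L' R_def)
    finally show ?case .
  qed simp
qed

text \<open>
  The relation \<open>h_triangle\<close> with the single factor \<open>h j s\<close> replaced by a product.  Again the induction
  step uses the hypothesis for the new largest index in place of \<open>s\<close>.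
\<close>

lemma triangle_iprod:
  assumes "A \<subseteq> {1..N}" "s \<in> {1..N}" "s \<notin> A" "a \<in> {1..N}" "a \<notin> A" "a \<noteq> s"
  shows "(h a s - 1) * iprod (\<lambda>j. h j s) A = iprod (\<lambda>j. h j a) A * (h a s - 1)
    + (\<Sum>c\<in>A. iprod (\<lambda>j. h j c) (A \<inter> {c<..}) * ((h c s - 1) * (h a c - 1))
        * iprod (\<lambda>j. h j c) (A \<inter> {..<c}))"
proof -
  have "finite A" using assms finite_subset by blast
  then show ?thesis using assms
  proof (induction A arbitrary: s rule: finite_linorder_max_induct)
    case (insert x A)
    define L R where "L c = iprod (\<lambda>i. h i c) (A \<inter> {c<..})"
      and "R c = iprod (\<lambda>i. h i c) (A \<inter> {..<c})" for c
    have x: "x \<notin> A" "x \<in> {1..N}" "x \<noteq> s" "x \<noteq> a" and A: "A \<subseteq> {1..N}" "s \<notin> A" "a \<notin> A"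
      using insert by auto
    have IHs: "(h a s - 1) * iprod (\<lambda>j. h j s) A = iprod (\<lambda>j. h j a) A * (h a s - 1)
        + (\<Sum>c\<in>A. L c * ((h c s - 1) * (h a c - 1)) * R c)"
      unfolding L_def R_def using insert A by blast
    have IHx: "(h a x - 1) * iprod (\<lambda>j. h j x) A = iprod (\<lambda>j. h j a) A * (h a x - 1)
        + (\<Sum>c\<in>A. L c * ((h c x - 1) * (h a c - 1)) * R c)"
      using insert.IH[of x] x A insert.prems unfolding L_def R_def by simp
    have step: "L c * ((h c s - 1) * (h a c - 1)) * R c * h x s
        = L c * h x c * ((h c s - 1) * (h a c - 1)) * R c
          + (h x s - 1) * (L c * ((h c x - 1) * (h a c - 1)) * R c)" if c: "c \<in> A" for c
    proof -
      have 1: "h x s * R c = R c * h x s" unfolding R_def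
        using x A c insert.prems by (intro iprod_commute h_commute) auto
      have 4: "h x s * (h a c - 1) = (h a c - 1) * h x s"
        using x A c insert.prems by (auto simp: algebra_simps intro!: h_commute)
      have 2: "(h x s - 1) * L c = L c * (h x s - 1)" unfolding L_def
        using x A c insert.prems
        by (intro iprod_commute) (auto simp: algebra_simps intro!: h_commute)
      have 3: "(h c s - 1) * h x s = h x c * (h c s - 1) + (h x s - 1) * (h c x - 1)"
        using x A c insert.prems by (intro h_triangle) auto
      have "L c * ((h c s - 1) * (h a c - 1)) * R c * h x s = L c * ((h c s - 1) * h x s) * (h a c - 1) * R c"
        using 1 4 by (metis mult.assoc)
      also have "\<dots> = L c * h x c * ((h c s - 1) * (h a c - 1)) * R c
          + (L c * (h x s - 1)) * (h c x - 1) * (h a c - 1) * R c"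
        unfolding 3 by (simp only: algebra_simps)
      finally show ?thesis by (simp only: 2[symmetric] mult.assoc)
    qed
    have tri: "(h a s - 1) * h x s = h x a * (h a s - 1) + (h x s - 1) * (h a x - 1)"
      using x A insert.prems by (intro h_triangle) auto
    have com: "(h x s - 1) * iprod (\<lambda>j. h j a) A = iprod (\<lambda>j. h j a) A * (h x s - 1)"
      using x A insert.prems
      by (intro iprod_commute) (auto simp: algebra_simps intro!: h_commute)
    have L': "iprod (\<lambda>i. h i c) (insert x (A \<inter> {c<..})) = L c * h x c" for c
      unfolding L_def using insert.hyps by (intro iprod_insert_max) auto
    define P e S T U where "P = iprod (\<lambda>j. h j a) A" and "e = h x s - 1"
      and "S = (\<Sum>c\<in>A. L c * ((h c s - 1) * (h a c - 1)) * R c)"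
      and "T = (\<Sum>c\<in>A. L c * ((h c x - 1) * (h a c - 1)) * R c)"
      and "U = (\<Sum>c\<in>A. L c * h x c * ((h c s - 1) * (h a c - 1)) * R c)"
    have S: "S * h x s = U + e * T"
      unfolding S_def T_def U_def e_def sum_distrib_right sum_distrib_left
      by (simp only: step sum.distrib cong: sum.cong)
    have P: "P * e = e * P" unfolding P_def e_def using com by simp
    have "(h a s - 1) * iprod (\<lambda>j. h j s) (insert x A)
        = ((h a s - 1) * iprod (\<lambda>j. h j s) A) * h x s"
      using insert.hyps by (simp add: iprod_insert_max mult.assoc)
    also have "\<dots> = P * ((h a s - 1) * h x s) + S * h x s"
      unfolding IHs P_def[symmetric] S_def[symmetric] by (simp only: distrib_right mult.assoc)
    also have "\<dots> = P * h x a * (h a s - 1) + (P * e * (h a x - 1) + (U + e * T))"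
      unfolding S tri e_def[symmetric] by (simp only: distrib_left mult.assoc add.assoc)
    also have "P * e * (h a x - 1) + (U + e * T) = e * (P * (h a x - 1) + T) + U"
      unfolding P by (simp only: distrib_left mult.assoc add_ac)
    also have "P * (h a x - 1) + T = (h a x - 1) * iprod (\<lambda>j. h j x) A"
      unfolding IHx P_def T_def by simp
    also have "P * h x a = iprod (\<lambda>j. h j a) (insert x A)"
      using insert.hyps by (simp add: iprod_insert_max P_def)
    also have "e * ((h a x - 1) * iprod (\<lambda>j. h j x) A) + U
        = 1 * ((h x s - 1) * (h a x - 1)) * iprod (\<lambda>j. h j x) A
          + (\<Sum>c\<in>A. L c * h x c * ((h c s - 1) * (h a c - 1)) * R c)"
      by (simp only: e_def U_def mult.assoc mult_1_left)
    also have "1 * ((h x s - 1) * (h a x - 1)) * iprod (\<lambda>j. h j x) A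
          + (\<Sum>c\<in>A. L c * h x c * ((h c s - 1) * (h a c - 1)) * R c)
       = (\<Sum>c\<in>insert x A. iprod (\<lambda>i. h i c) (insert x A \<inter> {c<..})
          * ((h c s - 1) * (h a c - 1)) * iprod (\<lambda>i. h i c) (insert x A \<inter> {..<c}))"
      using insert.hyps sum_insert_max_parts[of A x "\<lambda>A c B. iprod (\<lambda>i. h i c) B
          * ((h c s - 1) * (h a c - 1)) * iprod (\<lambda>i. h i c) A"]
      by (simp add: L' R_def)
    finally show ?case .
  qed simp
qed

lemma yang_baxter_iprod:
  assumes "A \<subseteq> {1..N}" "x \<in> {1..N}" "y \<in> {1..N}" "x \<notin> A" "y \<notin> A" "x \<noteq> y"
  shows "h x y * iprod (\<lambda>j. h j y) A * iprod (\<lambda>j. h j x) A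
    = iprod (\<lambda>j. h j x) A * iprod (\<lambda>j. h j y) A * h x y"
proof -
  have "finite A" using assms finite_subset by blast
  then show ?thesis using assms
  proof (induction A rule: finite_linorder_max_induct)
    case (insert a A)
    define X Y where "X = iprod (\<lambda>j. h j x) A" and "Y = iprod (\<lambda>j. h j y) A"
    have IH: "h x y * Y * X = X * Y * h x y"
      unfolding X_def Y_def using insert by auto
    have a: "a \<notin> A" using insert by auto
    have 1: "h a y * X = X * h a y" unfolding X_def
      using insert a by (intro iprod_commute h_commute) auto
    have 2: "h a x * Y = Y * h a x" unfolding Y_def
      using insert a by (intro iprod_commute h_commute) auto
    have 3: "h a x * h a y * h x y = h x y * h a y * h a x"
      using insert a by (intro h_yang_baxter) auto
    have "h x y * (Y * h a y) * (X * h a x) = (h x y * Y * X) * h a y * h a x"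
      using 1 by (metis mult.assoc)
    also have "\<dots> = X * Y * (h a x * h a y * h x y)"
      using IH 3 by (metis mult.assoc)
    also have "\<dots> = (X * h a x) * (Y * h a y) * h x y"
      using 2 by (metis mult.assoc)
    finally show ?case using insert.hyps
      by (simp add: iprod_insert_max X_def Y_def)
  qed simp
qed

lemma yang_baxter_dprod:
  assumes "A \<subseteq> {1..N}" "x \<in> {1..N}" "y \<in> {1..N}" "x \<notin> A" "y \<notin> A" "x \<noteq> y"
  shows "h x y * dprod (h x) A * dprod (h y) A = dprod (h y) A * dprod (h x) A * h x y"
proof -
  have "finite A" using assms finite_subset by blast
  then show ?thesis using assms
  proof (induction A rule: finite_linorder_max_induct)
    case (insert a A)
    define X Y where "X = dprod (h x) A" and "Y = dprod (h y) A"
    have IH: "h x y * X * Y = Y * X * h x y"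
      unfolding X_def Y_def using insert by auto
    have a: "a \<notin> A" using insert by auto
    have 1: "h y a * X = X * h y a" unfolding X_def
      using insert a by (intro dprod_commute h_commute) auto
    have 2: "h x a * Y = Y * h x a" unfolding Y_def
      using insert a by (intro dprod_commute h_commute) auto
    have 3: "h x y * h x a * h y a = h y a * h x a * h x y"
      using insert a by (intro h_yang_baxter) auto
    have "h x y * (h x a * X) * (h y a * Y) = (h x y * h x a * h y a) * X * Y"
      using 1 by (metis mult.assoc)
    also have "\<dots> = h y a * h x a * (Y * X * h x y)"
      using IH 3 by (metis mult.assoc)
    also have "\<dots> = (h y a * Y) * (h x a * X) * h x y"
      using 2 by (metis mult.assoc)
    finally show ?case using insert.hyps
      by (simp add: dprod_insert_max X_def Y_def)
  qed simp
qed


text \<open>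
  For \<open>I \<subseteq> {1..m}\<close> the left part is the product of the \<open>h j i\<close> with \<open>j \<in> I\<close>, \<open>i \<notin> I\<close>, \<open>i < j\<close>, and the
  right part is the product of the \<open>h j i\<close> with \<open>j \<in> I\<close>, \<open>i \<notin> I\<close>, \<open>j < i \<le> m\<close>.  The orders of the factors
  are chosen so that the index \<open>m + 1\<close> contributes a block next to the middle of the product of the
  left part, the elements \<open>w\<close> and the right part.
\<close>

primrec left_part :: "nat set \<Rightarrow> nat \<Rightarrow> 'a" where
  "left_part I 0 = 1"
| "left_part I (Suc m) = (if Suc m \<in> I then left_part I m * dprod (h (Suc m)) ({1..m} - I) else left_part I m)"

primrec right_part :: "nat set \<Rightarrow> nat \<Rightarrow> 'a" where
  "right_part I 0 = 1"
| "right_part I (Suc m) = (if Suc m \<in> I then right_part I m else iprod (\<lambda>j. h j (Suc m)) (I \<inter> {1..m}) * right_part I m)"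

lemma left_part_cong: "I \<inter> {1..m} = J \<inter> {1..m} \<Longrightarrow> left_part I m = left_part J m"
proof (induction m)
  case (Suc m)
  note eqs = Int_atMost_Suc_eqD[OF Suc.prems]
  then have "{1..m} - I = {1..m} - J" by blast
  then show ?case using Suc.IH eqs by simp
qed simp

lemma right_part_cong: "I \<inter> {1..m} = J \<inter> {1..m} \<Longrightarrow> right_part I m = right_part J m"
proof (induction m)
  case (Suc m)
  then show ?case using Int_atMost_Suc_eqD[OF Suc.prems] by simp
qed simp

lemma right_part_commute:
  assumes "\<And>i j. \<lbrakk>1 \<le> j; j < i; i \<le> m\<rbrakk> \<Longrightarrow> x * h j i = h j i * x"
  shows "x * right_part I m = right_part I m * x"
  using assms
proof (induction m)
  case (Suc m)
  have "x * right_part I m = right_part I m * x" using Suc by auto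
  moreover have "x * iprod (\<lambda>j. h j (Suc m)) (I \<inter> {1..m}) = iprod (\<lambda>j. h j (Suc m)) (I \<inter> {1..m}) * x"
    using Suc.prems by (intro iprod_commute) auto
  ultimately show ?case by (auto intro: commute_times)
qed simp

text \<open>
  Passing from \<open>J\<close> to \<open>J \<union> {c}\<close> trades the factors \<open>h c i\<close> for the factors \<open>h j c\<close>; the order of the
  factors is restored by the Yang--Baxter relation.
\<close>

lemma left_part_insert:
  assumes "J \<subseteq> {1..N}" "c \<notin> J" "1 \<le> c" "c \<le> m" "m \<le> N"
  shows "left_part J m * dprod (h c) ({1..<c} - J) = left_part (insert c J) m * iprod (\<lambda>j. h j c) (J \<inter> {c<..m})"
  using assms(4,5)
proof (induction m)
  case (Suc m)
  consider "c = Suc m" | "c \<le> m" "Suc m \<notin> J" | "c \<le> m" "Suc m \<in> J"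
    using Suc.prems by linarith
  then show ?case
  proof cases
    case 1
    have "left_part (insert c J) m = left_part J m" using 1 by (intro left_part_cong) auto
    moreover have "{1..<c} - J = {1..m} - insert c J" "J \<inter> {c<..Suc m} = {}" using 1 by auto
    ultimately show ?thesis using 1 assms by simp
  next
    case 2
    then have "J \<inter> {c<..Suc m} = J \<inter> {c<..m}" by (auto simp: le_Suc_eq)
    then show ?thesis using 2 Suc by simp
  next
    case 3
    define n A B where "n = Suc m" and "A = {1..<c} - J" and "B = {c<..m} - J"
    define X Y P Q where "X = dprod (h n) A" and "Y = dprod (h n) B" and "P = dprod (h c) A"
      and "Q = iprod (\<lambda>j. h j c) (J \<inter> {c<..m})"
    have idx: "A \<subseteq> {1..N}" "B \<subseteq> {1..N}" "c \<in> {1..N}" "n \<in> {1..N}" "c \<noteq> n" "c \<notin> A" "c \<notin> B"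
        "n \<notin> A" "n \<notin> B"
      using 3 Suc.prems assms by (auto simp: A_def B_def n_def)
    have "{1..m} - J = A \<union> insert c B" "{1..m} - insert c J = A \<union> B"
      using 3 assms by (auto simp: A_def B_def)
    moreover have "dprod (h n) (A \<union> insert c B) = Y * h n c * X"
      unfolding X_def Y_def by (intro dprod_insert_between) (auto simp: A_def B_def)
    moreover have "dprod (h n) (A \<union> B) = Y * X"
      unfolding X_def Y_def by (intro dprod_split) (auto simp: A_def B_def)
    ultimately have s1: "dprod (h n) ({1..m} - J) = Y * h n c * X"
      and s2: "dprod (h n) ({1..m} - insert c J) = Y * X"
      by simp_all
    have "J \<inter> {c<..n} = insert n (J \<inter> {c<..m})"
      using 3 by (auto simp: n_def)
    then have s3: "iprod (\<lambda>j. h j c) (J \<inter> {c<..n}) = Q * h n c"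
      unfolding Q_def n_def by (simp add: iprod_insert_max)
    have yb: "h n c * X * P = P * X * h n c"
      unfolding X_def P_def using idx by (intro yang_baxter_dprod) auto
    have YP: "Y * P = P * Y"
      unfolding Y_def P_def
    proof (intro dprod_commute[symmetric])
      fix i j assume ij: "i \<in> B" "j \<in> A"
      then have "i \<noteq> j" by (auto simp: A_def B_def)
      then show "h n i * h c j = h c j * h n i"
        using idx ij by (intro h_commute) auto
    qed
    have QYX: "Q * (Y * X) = (Y * X) * Q"
      unfolding s2[symmetric] Q_def
    proof (intro iprod_commute[symmetric] dprod_commute[symmetric])
      fix i j assume ij: "i \<in> {1..m} - insert c J" "j \<in> J \<inter> {c<..m}"
      then have "i \<le> N" using Suc.prems by simp
      then show "h j c * h n i = h n i * h j c"
        using idx ij assms by (intro h_commute) (auto simp: n_def)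
    qed
    have IH: "left_part J m * P = left_part (insert c J) m * Q"
      unfolding P_def Q_def A_def using 3 Suc by auto
    have "left_part J m * (Y * h n c * X) * P = left_part J m * (Y * P) * (X * h n c)"
      using yb by (simp only: mult.assoc)
    also have "\<dots> = (left_part J m * P) * (Y * X * h n c)"
      unfolding YP by (simp only: mult.assoc)
    also have "\<dots> = left_part (insert c J) m * (Q * (Y * X)) * h n c"
      unfolding IH by (simp only: mult.assoc)
    also have "\<dots> = left_part (insert c J) m * (Y * X) * (Q * h n c)"
      unfolding QYX by (simp only: mult.assoc)
    finally show ?thesis
      using 3 s1 s2 s3 by (simp add: n_def A_def P_def)
  qed
qed (use assms in simp)

lemma right_part_insert:
  assumes "J \<subseteq> {1..N}" "c \<notin> J" "1 \<le> c" "c \<le> m" "m \<le> N"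
  shows "dprod (h c) ({c<..m} - J) * right_part J m = iprod (\<lambda>j. h j c) (J \<inter> {1..<c}) * right_part (insert c J) m"
  using assms(4,5)
proof (induction m)
  case (Suc m)
  consider "c = Suc m" | "c \<le> m" "Suc m \<in> J" | "c \<le> m" "Suc m \<notin> J"
    using Suc.prems by linarith
  then show ?case
  proof cases
    case 1
    have "right_part (insert c J) m = right_part J m" using 1 by (intro right_part_cong) auto
    moreover have "J \<inter> {1..<c} = J \<inter> {1..m}" using 1 by auto
    ultimately show ?thesis using 1 assms by simp
  next
    case 2
    then have "{c<..Suc m} - J = {c<..m} - J" by (auto simp: le_Suc_eq)
    then show ?thesis using 2 Suc by simp
  next
    case 3
    define n A B where "n = Suc m" and "A = J \<inter> {1..<c}" and "B = J \<inter> {c<..m}"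
    define X Y P Q where "X = iprod (\<lambda>j. h j n) A" and "Y = iprod (\<lambda>j. h j n) B"
      and "P = iprod (\<lambda>j. h j c) A" and "Q = dprod (h c) ({c<..m} - J)"
    have idx: "A \<subseteq> {1..N}" "B \<subseteq> {1..N}" "c \<in> {1..N}" "n \<in> {1..N}" "c \<noteq> n" "c \<notin> A" "c \<notin> B"
        "n \<notin> A" "n \<notin> B"
      using 3 Suc.prems assms by (auto simp: A_def B_def n_def)
    have "{1..m} = {1..<c} \<union> insert c {c<..m}" using 3 assms by auto
    then have "J \<inter> {1..m} = A \<union> B" "insert c J \<inter> {1..m} = A \<union> insert c B"
      using assms by (simp_all add: A_def B_def Int_Un_distrib)
    moreover have "iprod (\<lambda>j. h j n) (A \<union> insert c B) = X * h c n * Y"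
      unfolding X_def Y_def by (intro iprod_insert_between) (auto simp: A_def B_def)
    moreover have "iprod (\<lambda>j. h j n) (A \<union> B) = X * Y"
      unfolding X_def Y_def by (intro iprod_split) (auto simp: A_def B_def)
    ultimately have s1: "iprod (\<lambda>j. h j n) (J \<inter> {1..m}) = X * Y"
      and s2: "iprod (\<lambda>j. h j n) (insert c J \<inter> {1..m}) = X * h c n * Y"
      by simp_all
    have "{c<..n} - J = insert n ({c<..m} - J)"
      using 3 by (auto simp: n_def)
    then have s3: "dprod (h c) ({c<..n} - J) = h c n * Q"
      unfolding Q_def n_def by (simp add: dprod_insert_max)
    have yb: "h c n * X * P = P * X * h c n"
      unfolding X_def P_def using idx by (intro yang_baxter_iprod) auto
    have YP: "Y * P = P * Y"
      unfolding Y_def P_def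
    proof (intro iprod_commute[symmetric])
      fix i j assume ij: "i \<in> B" "j \<in> A"
      then have "i \<noteq> j" by (auto simp: A_def B_def)
      then show "h i n * h j c = h j c * h i n"
        using idx ij by (intro h_commute) auto
    qed
    have QXY: "Q * (X * Y) = (X * Y) * Q"
      unfolding s1[symmetric] Q_def
    proof (intro dprod_commute[symmetric] iprod_commute[symmetric])
      fix i j assume ij: "i \<in> {c<..m} - J" "j \<in> J \<inter> {1..m}"
      then have "i \<le> N" using Suc.prems by simp
      then show "h c i * h j n = h j n * h c i"
        using idx ij assms by (intro h_commute) (auto simp: n_def)
    qed
    have IH: "Q * right_part J m = P * right_part (insert c J) m"
      unfolding P_def Q_def A_def using 3 Suc by auto
    have "h c n * Q * (X * Y * right_part J m) = h c n * (Q * (X * Y)) * right_part J m"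
      by (simp only: mult.assoc)
    also have "\<dots> = h c n * (X * Y) * (Q * right_part J m)"
      unfolding QXY by (simp only: mult.assoc)
    also have "\<dots> = h c n * X * (Y * P) * right_part (insert c J) m"
      unfolding IH by (simp only: mult.assoc)
    also have "\<dots> = (h c n * X * P) * Y * right_part (insert c J) m"
      unfolding YP by (simp only: mult.assoc)
    also have "\<dots> = P * (X * h c n * Y * right_part (insert c J) m)"
      unfolding yb by (simp only: mult.assoc)
    finally show ?thesis
      using 3 s1 s2 s3 by (simp add: n_def A_def P_def)
  qed
qed (use assms in simp)

text \<open>
  The right part intertwines the order "complement of \<open>I\<close> first, then \<open>I\<close>" with the natural order.
\<close>

lemma right_part_sort:
  assumes "I \<subseteq> {1..N}" "m < a" "a \<le> N"
  shows "iprod (\<lambda>j. h j a) ({1..m} - I) * iprod (\<lambda>j. h j a) (I \<inter> {1..m}) * right_part I m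
    = right_part I m * iprod (\<lambda>j. h j a) {1..m}"
  using assms(2)
proof (induction m)
  case (Suc m)
  define n C A B where "n = Suc m" and "C = iprod (\<lambda>j. h j a) ({1..m} - I)"
    and "A = iprod (\<lambda>j. h j a) (I \<inter> {1..m})" and "B = iprod (\<lambda>j. h j a) {1..m}"
  have IH: "C * A * right_part I m = right_part I m * B"
    unfolding C_def A_def B_def using Suc by auto
  have full: "iprod (\<lambda>j. h j a) {1..n} = B * h n a"
    unfolding B_def n_def by (subst atLeastAtMostSuc_conv) (auto intro: iprod_insert_max)
  have hH: "h n a * right_part I m = right_part I m * h n a"
    using Suc.prems assms by (intro right_part_commute h_commute) (auto simp: n_def)
  show ?case
  proof (cases "n \<in> I")
    case True
    then have "{1..n} - I = {1..m} - I" "I \<inter> {1..n} = insert n (I \<inter> {1..m})"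
      by (auto simp: n_def le_Suc_eq)
    moreover have "iprod (\<lambda>j. h j a) (insert n (I \<inter> {1..m})) = A * h n a"
      unfolding A_def by (rule iprod_insert_max) (auto simp: n_def)
    ultimately have "iprod (\<lambda>j. h j a) ({1..n} - I) = C" "iprod (\<lambda>j. h j a) (I \<inter> {1..n}) = A * h n a"
      by (simp_all add: C_def)
    moreover have "C * (A * h n a) * right_part I m = C * A * (h n a * right_part I m)"
      by (simp only: mult.assoc)
    moreover have "C * A * (h n a * right_part I m) = (C * A * right_part I m) * h n a"
      unfolding hH by (simp only: mult.assoc)
    moreover have "(C * A * right_part I m) * h n a = right_part I m * (B * h n a)"
      unfolding IH by (simp only: mult.assoc)
    ultimately show ?thesis using True full by (simp add: n_def)
  next
    case False
    define P where "P = iprod (\<lambda>j. h j n) (I \<inter> {1..m})"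
    have "{1..n} - I = insert n ({1..m} - I)" "I \<inter> {1..n} = I \<inter> {1..m}"
      using False by (auto simp: n_def le_Suc_eq)
    moreover have "iprod (\<lambda>j. h j a) (insert n ({1..m} - I)) = C * h n a"
      unfolding C_def by (rule iprod_insert_max) (auto simp: n_def)
    ultimately have s: "iprod (\<lambda>j. h j a) ({1..n} - I) = C * h n a" "iprod (\<lambda>j. h j a) (I \<inter> {1..n}) = A"
      by (simp_all add: A_def)
    have yb: "h n a * A * P = P * A * h n a"
      unfolding A_def P_def using Suc.prems assms by (intro yang_baxter_iprod) (auto simp: n_def)
    have CP: "C * P = P * C"
      unfolding C_def P_def
    proof (intro iprod_commute[symmetric])
      fix i j assume "i \<in> {1..m} - I" "j \<in> I \<inter> {1..m}"
      then show "h i a * h j n = h j n * h i a"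
        using Suc.prems assms by (intro h_commute) (auto simp: n_def)
    qed
    have "C * h n a * A * (P * right_part I m) = C * (h n a * A * P) * right_part I m"
      by (simp only: mult.assoc)
    also have "\<dots> = C * P * A * (h n a * right_part I m)"
      unfolding yb by (simp only: mult.assoc)
    also have "\<dots> = P * (C * A * right_part I m) * h n a"
      unfolding CP hH by (simp only: mult.assoc)
    also have "\<dots> = P * right_part I m * (B * h n a)"
      unfolding IH by (simp only: mult.assoc)
    finally show ?thesis using False full s by (simp add: n_def P_def)
  qed
qed simp


end

section \<open>Moving the shifted variables through the exchange algebra\<close>

text \<open>
  The elements \<open>w i = 1 + z i\<close> are added, with \<open>\<zeta> i = t (h\<^sub>i - \<beta>)\<close>.  In terms of \<open>w\<close> and \<open>h\<close> the
  mixed relation has the same form for both orders of the indices.  The assumption \<open>collapse\<close> says that different parameters \<open>h\<^sub>c\<close> and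
  \<open>h\<^sub>k\<close> can be exchanged in front of \<open>h c k - b\<close>; in the algebra this is a consequence of the three-term and the mixed
  relations, see \<open>triangle_collapse\<close>.
\<close>

locale dunkl_algebra = exchange_algebra N b h
  for N :: nat and b :: "'a::ring_1" and h :: "nat \<Rightarrow> nat \<Rightarrow> 'a" +
  fixes w \<zeta> :: "nat \<Rightarrow> 'a"
  assumes \<zeta>_central: "\<zeta> i * x = x * \<zeta> i"
    and w_commute: "\<lbrakk>i \<in> {1..N}; j \<in> {1..N}\<rbrakk> \<Longrightarrow> w i * w j = w j * w i"
    and w_h_commute: "\<lbrakk>{i, j, k} \<subseteq> {1..N}; distinct [i, j, k]\<rbrakk> \<Longrightarrow> w i * h j k = h j k * w i"
    and w_h: "\<lbrakk>i \<in> {1..N}; j \<in> {1..N}; i \<noteq> j\<rbrakk>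
      \<Longrightarrow> w i * h i j = b * w i + (h i j - 1) * w j + \<zeta> (max i j)"
    and collapse: "\<lbrakk>1 < c; c < k; k \<le> N\<rbrakk> \<Longrightarrow> (\<zeta> k - \<zeta> c) * (h c k - b) = 0"
begin

lemma \<zeta>_left: "x * \<zeta> i = \<zeta> i * x" "x * (\<zeta> i * y) = \<zeta> i * (x * y)"
  by (metis \<zeta>_central) (metis \<zeta>_central mult.assoc)

lemma b_power_left: "x * b ^ k = b ^ k * x" "x * (b ^ k * y) = b ^ k * (x * y)"
  by (metis b_power_central) (metis b_power_central mult.assoc)

lemma w_pair:
  assumes "i \<in> {1..N}" "j \<in> {1..N}" "i \<noteq> j"
  shows "w i * w j * h i j = h i j * (w i * w j)"
proof -
  have ji: "h i j = 1 + b - h j i" using assms by (auto intro: h_swap')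
  have 1: "w j * h i j = w j - (b - h i j) * w i - \<zeta> (max i j)"
  proof -
    have "w j * h j i = b * w j + (h j i - 1) * w i + \<zeta> (max i j)"
      using w_h[of j i] assms by (simp add: max.commute)
    then show ?thesis unfolding ji by (simp add: algebra_simps b_left)
  qed
  have "w i * w j * h i j = w i * w j - b * w i * w i + (w i * h i j) * w i - \<zeta> (max i j) * w i"
    by (simp add: mult.assoc 1) (simp add: algebra_simps b_left \<zeta>_left)
  also have "\<dots> = w i * w j + (h i j - 1) * (w j * w i)"
    using assms by (simp add: w_h) (simp add: algebra_simps)
  also have "w j * w i = w i * w j" using assms w_commute by blast
  finally show ?thesis by (simp add: algebra_simps)
qed

abbreviation W :: "nat set \<Rightarrow> 'a" where "W \<equiv> iprod w"

lemma W_insert: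
  assumes "A \<subseteq> {1..N}" "c \<in> {1..N}" "c \<notin> A"
  shows "W (insert c A) = w c * W A" "W (insert c A) = W A * w c"
proof -
  show "W (insert c A) = w c * W A"
    using assms finite_subset[of A "{1..N}"] w_commute by (intro iprod_insert_commute) auto
  also have "\<dots> = W A * w c" using assms w_commute by (intro iprod_commute) auto
  finally show "W (insert c A) = W A * w c" .
qed

lemma h_W_disjoint:
  assumes "A \<subseteq> {1..N}" "i \<in> {1..N}" "j \<in> {1..N}" "i \<noteq> j" "i \<notin> A" "j \<notin> A"
  shows "h i j * W A = W A * h i j"
  using assms by (intro iprod_commute w_h_commute[symmetric]) auto

text \<open>
  Elements symmetric in \<open>w i\<close> and \<open>w j\<close> commute with \<open>h i j\<close>.
\<close>

lemma h_W_subset: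
  assumes "A \<subseteq> {1..N}" "i \<in> A" "j \<in> A" "i \<noteq> j"
  shows "h i j * W A = W A * h i j"
proof -
  define B where "B = A - {i, j}"
  have A: "A = insert i (insert j B)" "insert j B \<subseteq> {1..N}" "B \<subseteq> {1..N}"
    "i \<notin> insert j B" "j \<notin> B" "i \<notin> B" "i \<in> {1..N}" "j \<in> {1..N}"
    using assms by (auto simp: B_def)
  have "W A = w i * (w j * W B)"
    unfolding A(1) W_insert(1)[OF A(2,7,4)] W_insert(1)[OF A(3,8,5)] ..
  moreover have "h i j * W B = W B * h i j"
    using A assms by (intro h_W_disjoint) auto
  moreover have "w i * w j * h i j = h i j * (w i * w j)"
    using A assms by (intro w_pair) auto
  ultimately show ?thesis by (metis mult.assoc)
qed

text \<open>
  The key expansion: the factors \<open>h j s\<close> created by a new index \<open>s\<close> are absorbed, so that the left side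
  becomes linear in \<open>w s\<close> and \<open>\<zeta> s\<close>.  The induction adds a smallest index \<open>a\<close> and expands
  \<open>w a * h a s\<close> on the left and \<open>w a * h a c\<close> on the right.  What remains is a combination of the
  differences \<open>\<zeta> s - \<zeta> c\<close>, which \<open>collapse\<close> annihilates.
\<close>

lemma W_times_iprod:
  assumes "I \<subseteq> {1..N}" "s \<in> {1..N}" "\<And>i. i \<in> I \<Longrightarrow> i < s"
  shows "W I * iprod (\<lambda>j. h j s) I = b ^ card I * W I
    + (\<Sum>c\<in>I. iprod (\<lambda>j. h j c) (I \<inter> {c<..}) * (h c s - 1) * W (I - {c})
        * iprod (\<lambda>j. h j c) (I \<inter> {..<c})) * w s
    + \<zeta> s * (\<Sum>c\<in>I. iprod (\<lambda>j. h j c) (I \<inter> {c<..}) * W (I - {c})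
        * iprod (\<lambda>j. h j c) (I \<inter> {..<c}))"
proof -
  have "finite I" using assms finite_subset by blast
  then show ?thesis using assms
  proof (induction I rule: finite_linorder_min_induct)
    case (insert a A)
    have fA: "finite A" and aA: "\<forall>i\<in>A. a < i" using insert.hyps by auto
    have A: "A \<subseteq> {1..N}" "a \<notin> A" "a \<in> {1..N}" "a < s" "s \<notin> A" "s \<in> {1..N}" "s \<noteq> a"
      using insert by auto
    define r U V P where "r = card A" and "U c = iprod (\<lambda>j. h j c) (A \<inter> {c<..})"
      and "V c = iprod (\<lambda>j. h j c) (A \<inter> {..<c})" and "P = iprod (\<lambda>j. h j s) A" for c
    define Qc Yc where "Qc c = U c * (h c s - 1) * W (A - {c}) * V c"
      and "Yc c = U c * W (A - {c}) * V c" for c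
    define Q Y X where "Q = (\<Sum>c\<in>A. Qc c)" and "Y = (\<Sum>c\<in>A. Yc c)"
      and "X = (h a s - 1) * P"
    have IH: "W A * P = b ^ r * W A + Q * w s + \<zeta> s * Y"
      unfolding Q_def Y_def Qc_def Yc_def U_def V_def P_def r_def using insert by auto
    have X: "X = iprod (\<lambda>j. h j a) A * (h a s - 1) + (\<Sum>c\<in>A. U c * ((h c s - 1) * (h a c - 1)) * V c)"
      unfolding X_def P_def U_def V_def using A by (intro triangle_iprod) auto
    have geo: "iprod (\<lambda>j. h j a) A + (\<Sum>c\<in>A. U c * (h a c - 1) * V c) = b ^ r"
      using iprod_expand[of A a] A unfolding U_def V_def r_def by simp
    have ws: "w s * (W A * P) = P * (W A * w s)"
    proof -
      have "W (insert s A) * P = P * W (insert s A)"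
        unfolding P_def using A by (intro iprod_commute h_W_subset[symmetric]) auto
      then show ?thesis using W_insert[of A s] A by (metis mult.assoc)
    qed
    have lhs: "W (insert a A) * iprod (\<lambda>j. h j s) (insert a A)
        = (b * w a + \<zeta> s) * (b ^ r * W A + Q * w s + \<zeta> s * Y) + X * (W A * w s)"
    proof -
      have "W (insert a A) * iprod (\<lambda>j. h j s) (insert a A) = w a * W A * (h a s * P)"
        using W_insert[of A a] A iprod_insert_min[OF fA aA, of "\<lambda>j. h j s"] by (simp add: P_def)
      also have "\<dots> = (w a * h a s) * (W A * P)"
        using h_W_disjoint[of A a s] A by (metis mult.assoc)
      also have "w a * h a s = b * w a + (h a s - 1) * w s + \<zeta> s"
        using w_h[of a s] A by simp
      also have "(b * w a + (h a s - 1) * w s + \<zeta> s) * (W A * P)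
          = (b * w a + \<zeta> s) * (W A * P) + (h a s - 1) * (w s * (W A * P))"
        by (simp only: distrib_right mult.assoc add_ac)
      also have "\<dots> = (b * w a + \<zeta> s) * (W A * P) + X * (W A * w s)"
        unfolding ws X_def by (simp only: mult.assoc)
      finally show ?thesis unfolding IH .
    qed
    have split: "W (insert a A - {c}) * iprod (\<lambda>j. h j c) (insert a (A \<inter> {..<c}))
        = b * w a * (W (A - {c}) * V c) + (h a c - 1) * (V c * W A) + \<zeta> c * (W (A - {c}) * V c)"
      if c: "c \<in> A" for c
    proof -
      have ac: "a < c" using c aA by auto
      have "insert a A - {c} = insert a (A - {c})" using c A by auto
      then have Wc: "W (insert a A - {c}) = w a * W (A - {c})"
        using W_insert(1)[of "A - {c}" a] A by auto
      have Vc: "iprod (\<lambda>j. h j c) (insert a (A \<inter> {..<c})) = h a c * V c"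
        unfolding V_def using fA aA by (intro iprod_insert_min) auto
      have hW: "W (A - {c}) * h a c = h a c * W (A - {c})"
        using A c ac by (intro h_W_disjoint[symmetric]) auto
      have "W (insert a A - {c}) * iprod (\<lambda>j. h j c) (insert a (A \<inter> {..<c}))
          = w a * (W (A - {c}) * h a c) * V c" unfolding Wc Vc by (simp only: mult.assoc)
      also have "\<dots> = (w a * h a c) * (W (A - {c}) * V c)" unfolding hW by (simp only: mult.assoc)
      also have "w a * h a c = b * w a + (h a c - 1) * w c + \<zeta> c"
        using w_h[of a c] A c ac by (auto simp: max_def)
      also have "(b * w a + (h a c - 1) * w c + \<zeta> c) * (W (A - {c}) * V c)
          = b * w a * (W (A - {c}) * V c) + (h a c - 1) * (w c * W (A - {c}) * V c)
            + \<zeta> c * (W (A - {c}) * V c)"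
        by (simp only: distrib_right mult.assoc)
      also have "w c * W (A - {c}) = W A"
      proof -
        have "A - {c} \<subseteq> {1..N}" "c \<in> {1..N}" using A(1) c by blast+
        then show ?thesis using W_insert(1)[of "A - {c}" c] c by (simp add: insert_absorb)
      qed
      also have "W A * V c = V c * W A"
        unfolding V_def using A c by (intro iprod_commute h_W_subset[symmetric]) auto
      finally show ?thesis .
    qed
    have wU: "U c * (b * w a) = b * w a * U c" "(h c s - 1) * (b * w a) = b * w a * (h c s - 1)"
      if c: "c \<in> A" for c
    proof -
      have "w a * U c = U c * w a"
        unfolding U_def using A c by (intro iprod_commute w_h_commute) auto
      then show "U c * (b * w a) = b * w a * U c" by (metis b_central mult.assoc)
      have "w a * h c s = h c s * w a"
        using A c by (intro w_h_commute) auto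
      then show "(h c s - 1) * (b * w a) = b * w a * (h c s - 1)"
        by (simp add: algebra_simps b_left)
    qed
    have termQ: "U c * (h c s - 1) * W (insert a A - {c}) * iprod (\<lambda>j. h j c) (insert a (A \<inter> {..<c}))
        = b * w a * Qc c + U c * ((h c s - 1) * (h a c - 1)) * V c * W A + \<zeta> c * Qc c"
      if c: "c \<in> A" for c
    proof -
      have "U c * (h c s - 1) * W (insert a A - {c}) * iprod (\<lambda>j. h j c) (insert a (A \<inter> {..<c}))
          = U c * (h c s - 1) * (b * w a) * (W (A - {c}) * V c)
            + U c * ((h c s - 1) * (h a c - 1)) * V c * W A
            + U c * (h c s - 1) * \<zeta> c * (W (A - {c}) * V c)"
        using split[OF c] by (simp only: mult.assoc distrib_left)
      also have "U c * (h c s - 1) * (b * w a) = b * w a * (U c * (h c s - 1))"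
        using wU[OF c] by (metis mult.assoc)
      also have "U c * (h c s - 1) * \<zeta> c = \<zeta> c * (U c * (h c s - 1))"
        by (rule \<zeta>_left)
      finally show ?thesis by (simp only: Qc_def mult.assoc)
    qed
    have termY: "U c * W (insert a A - {c}) * iprod (\<lambda>j. h j c) (insert a (A \<inter> {..<c}))
        = b * w a * Yc c + U c * (h a c - 1) * V c * W A + \<zeta> c * Yc c"
      if c: "c \<in> A" for c
    proof -
      have "U c * W (insert a A - {c}) * iprod (\<lambda>j. h j c) (insert a (A \<inter> {..<c}))
          = U c * (b * w a) * (W (A - {c}) * V c) + U c * (h a c - 1) * V c * W A
            + U c * \<zeta> c * (W (A - {c}) * V c)"
        using split[OF c] by (simp only: mult.assoc distrib_left)
      also have "U c * (b * w a) = b * w a * U c" by (rule wU[OF c])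
      also have "U c * \<zeta> c = \<zeta> c * U c" by (rule \<zeta>_left)
      finally show ?thesis by (simp only: Yc_def mult.assoc)
    qed
    have newQ: "(\<Sum>c\<in>insert a A. iprod (\<lambda>j. h j c) (insert a A \<inter> {c<..}) * (h c s - 1)
          * W (insert a A - {c}) * iprod (\<lambda>j. h j c) (insert a A \<inter> {..<c}))
        = b * w a * Q + X * W A + (\<Sum>c\<in>A. \<zeta> c * Qc c)"
    proof -
      have "(\<Sum>c\<in>insert a A. iprod (\<lambda>j. h j c) (insert a A \<inter> {c<..}) * (h c s - 1)
          * W (insert a A - {c}) * iprod (\<lambda>j. h j c) (insert a A \<inter> {..<c}))
        = iprod (\<lambda>j. h j a) A * (h a s - 1) * W A
          + (\<Sum>c\<in>A. U c * (h c s - 1) * W (insert a A - {c}) * iprod (\<lambda>j. h j c) (insert a (A \<inter> {..<c})))"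
        using sum_insert_min_parts[OF fA aA, of "\<lambda>B c C. iprod (\<lambda>j. h j c) C * (h c s - 1)
          * W (insert a A - {c}) * iprod (\<lambda>j. h j c) B"] A
        by (simp add: U_def)
      also have "\<dots> = b * w a * Q + X * W A + (\<Sum>c\<in>A. \<zeta> c * Qc c)"
        unfolding X Q_def sum_distrib_left distrib_right sum_distrib_right
        by (simp add: termQ sum.distrib add_ac cong: sum.cong)
      finally show ?thesis .
    qed
    have newY: "(\<Sum>c\<in>insert a A. iprod (\<lambda>j. h j c) (insert a A \<inter> {c<..})
          * W (insert a A - {c}) * iprod (\<lambda>j. h j c) (insert a A \<inter> {..<c}))
        = b * w a * Y + b ^ r * W A + (\<Sum>c\<in>A. \<zeta> c * Yc c)"
    proof -
      have "(\<Sum>c\<in>insert a A. iprod (\<lambda>j. h j c) (insert a A \<inter> {c<..})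
          * W (insert a A - {c}) * iprod (\<lambda>j. h j c) (insert a A \<inter> {..<c}))
        = iprod (\<lambda>j. h j a) A * W A
          + (\<Sum>c\<in>A. U c * W (insert a A - {c}) * iprod (\<lambda>j. h j c) (insert a (A \<inter> {..<c})))"
        using sum_insert_min_parts[OF fA aA, of "\<lambda>B c C. iprod (\<lambda>j. h j c) C
          * W (insert a A - {c}) * iprod (\<lambda>j. h j c) B"] A
        by (simp add: U_def)
      also have "\<dots> = b * w a * Y + b ^ r * W A + (\<Sum>c\<in>A. \<zeta> c * Yc c)"
        unfolding geo[symmetric] Y_def sum_distrib_left distrib_right sum_distrib_right
        by (simp add: termY sum.distrib add_ac cong: sum.cong)
      finally show ?thesis .
    qed
    \<comment> \<open>Up to outer factors this is \<open>w c * (h c s - b)\<close>, where \<open>a\<close> provides an index below \<open>c\<close>.\<close>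
    have zero: "\<zeta> c * (Qc c * w s + \<zeta> s * Yc c) = \<zeta> s * (Qc c * w s + \<zeta> s * Yc c)" if c: "c \<in> A" for c
    proof -
      have cs: "a < c" "c < s" using c aA insert.prems by auto
      have "w s * W (A - {c}) = W (A - {c}) * w s"
        using A c w_commute by (intro iprod_commute) auto
      moreover have "w s * V c = V c * w s"
        unfolding V_def using A c by (intro iprod_commute w_h_commute) auto
      ultimately have "W (A - {c}) * V c * w s = w s * (W (A - {c}) * V c)"
        by (rule commute_times[symmetric])
      then have "Qc c * w s + \<zeta> s * Yc c = U c * ((h c s - 1) * w s + \<zeta> s) * (W (A - {c}) * V c)"
        unfolding Qc_def Yc_def by (simp add: mult.assoc distrib_left distrib_right \<zeta>_left)
      also have "(h c s - 1) * w s + \<zeta> s = w c * (h c s - b)"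
        using w_h[of c s] A c cs by (auto simp: algebra_simps b_left)
      finally have E: "Qc c * w s + \<zeta> s * Yc c = U c * (w c * (h c s - b)) * (W (A - {c}) * V c)" .
      have "(\<zeta> s - \<zeta> c) * (U c * (w c * (h c s - b)) * (W (A - {c}) * V c))
          = U c * (w c * ((\<zeta> s - \<zeta> c) * (h c s - b))) * (W (A - {c}) * V c)"
        by (simp add: algebra_simps \<zeta>_left)
      also have "(\<zeta> s - \<zeta> c) * (h c s - b) = 0"
        using cs A by (intro collapse) auto
      finally show ?thesis unfolding E by (simp add: left_diff_distrib)
    qed
    have zsum: "(\<Sum>c\<in>A. \<zeta> c * Qc c) * w s + \<zeta> s * (\<Sum>c\<in>A. \<zeta> c * Yc c)
        = \<zeta> s * (Q * w s + \<zeta> s * Y)"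
    proof -
      have "(\<Sum>c\<in>A. \<zeta> c * Qc c) * w s + \<zeta> s * (\<Sum>c\<in>A. \<zeta> c * Yc c)
          = (\<Sum>c\<in>A. \<zeta> c * (Qc c * w s + \<zeta> s * Yc c))"
        by (simp add: sum_distrib_left sum_distrib_right sum.distrib distrib_left mult.assoc
            \<zeta>_left(2)[of "\<zeta> s"])
      also have "\<dots> = (\<Sum>c\<in>A. \<zeta> s * (Qc c * w s + \<zeta> s * Yc c))"
        by (simp add: zero cong: sum.cong)
      also have "\<dots> = \<zeta> s * (Q * w s + \<zeta> s * Y)"
        by (simp add: Q_def Y_def sum_distrib_left sum_distrib_right sum.distrib distrib_left)
      finally show ?thesis .
    qed
    have card: "card (insert a A) = Suc r" using fA A by (simp add: r_def)
    have Wa: "W (insert a A) = w a * W A" using W_insert(1)[of A a] A by simp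
    have "b ^ card (insert a A) * W (insert a A)
        + (b * w a * Q + X * W A + (\<Sum>c\<in>A. \<zeta> c * Qc c)) * w s
        + \<zeta> s * (b * w a * Y + b ^ r * W A + (\<Sum>c\<in>A. \<zeta> c * Yc c))
      = b ^ Suc r * (w a * W A) + b * w a * Q * w s + X * W A * w s
        + \<zeta> s * (b * w a * Y) + \<zeta> s * (b ^ r * W A)
        + ((\<Sum>c\<in>A. \<zeta> c * Qc c) * w s + \<zeta> s * (\<Sum>c\<in>A. \<zeta> c * Yc c))"
      unfolding card Wa by (simp only: distrib_left distrib_right add_ac)
    also have "\<dots> = (b * w a + \<zeta> s) * (b ^ r * W A + Q * w s + \<zeta> s * Y) + X * (W A * w s)"
      unfolding zsum
      by (simp add: distrib_left distrib_right mult.assoc add_ac b_power_left(2)[of "w a"]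
          \<zeta>_left(2)[of "w a"] \<zeta>_left(2)[of b])
    finally show ?case unfolding lhs newQ newY by simp
  qed simp
qed


section \<open>Recursion in the number of variables\<close>

text \<open>
  For \<open>m = N\<close> this is the product of the Dunkl elements with index in \<open>I\<close>, up to a central factor.
\<close>

definition normal_form :: "nat \<Rightarrow> nat set \<Rightarrow> 'a" where
  "normal_form m I = left_part I m * W I * right_part I m"

text \<open>
  Let \<open>n = m + 1\<close>.  The subsets without \<open>n\<close> are expanded by \<open>W_times_iprod\<close>, the subsets containing \<open>n\<close>
  by \<open>dprod_expand\<close>.  The linear terms in the \<open>h c n - 1\<close> are indexed by the pairs \<open>c \<in> I\<close> in the first
  case and by the pairs \<open>c \<notin> J\<close> in the second case; they cancel for \<open>I = J \<union> {c}\<close>.  The coefficient of \<open>\<zeta> n\<close> is computed by \<open>dprod_geometric\<close>.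
\<close>

lemma sum_normal_form_Suc:
  assumes "Suc m \<le> N"
  shows "(\<Sum>I | I \<subseteq> {1..Suc m} \<and> card I = Suc k. normal_form (Suc m) I)
    = b ^ Suc k * (\<Sum>I | I \<subseteq> {1..m} \<and> card I = Suc k. normal_form m I)
      + (\<Sum>I | I \<subseteq> {1..m} \<and> card I = k. normal_form m I)
        * (b ^ (m - k) * w (Suc m) + \<zeta> (Suc m) * (\<Sum>i<m - k. b ^ i))"
proof -
  define n where "n = Suc m"
  \<comment> \<open>The common shape of the linear terms, with \<open>x = h c n - 1\<close> in the coefficient of \<open>w n\<close> and \<open>x = 1\<close>
      in the coefficient of \<open>\<zeta> n\<close>.\<close>
  define E where "E I c x = left_part I m * (iprod (\<lambda>j. h j c) (I \<inter> {c<..}) * x * W (I - {c})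
      * iprod (\<lambda>j. h j c) (I \<inter> {..<c})) * right_part I m" for I c x
  have wH: "w n * right_part I m = right_part I m * w n" for I
    using assms by (intro right_part_commute w_h_commute) (auto simp: n_def)
  have new: "normal_form n I = b ^ Suc k * normal_form m I + (\<Sum>c\<in>I. E I c (h c n - 1)) * w n + \<zeta> n * (\<Sum>c\<in>I. E I c 1)"
    if I: "I \<subseteq> {1..m}" "card I = Suc k" for I
  proof -
    have "I \<inter> {1..m} = I" "n \<notin> I" using I by (auto simp: n_def)
    then have "normal_form n I = left_part I m * (W I * iprod (\<lambda>j. h j n) I) * right_part I m"
      by (simp add: normal_form_def n_def mult.assoc)
    also have "W I * iprod (\<lambda>j. h j n) I = b ^ card I * W I
      + (\<Sum>c\<in>I. iprod (\<lambda>j. h j c) (I \<inter> {c<..}) * (h c n - 1) * W (I - {c})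
          * iprod (\<lambda>j. h j c) (I \<inter> {..<c})) * w n
      + \<zeta> n * (\<Sum>c\<in>I. iprod (\<lambda>j. h j c) (I \<inter> {c<..}) * W (I - {c})
          * iprod (\<lambda>j. h j c) (I \<inter> {..<c}))" (is "_ = _ + ?Q * w n + _ * ?Y")
      using I assms by (intro W_times_iprod) (auto simp: n_def)
    also have "left_part I m * (b ^ card I * W I + ?Q * w n + \<zeta> n * ?Y) * right_part I m
      = b ^ card I * (left_part I m * W I * right_part I m) + left_part I m * ?Q * (w n * right_part I m) + \<zeta> n * (left_part I m * ?Y * right_part I m)"
      by (simp add: distrib_left distrib_right mult.assoc b_power_left(2)[of "left_part I m"] \<zeta>_left(2)[of "left_part I m"])
    also have "left_part I m * ?Q * (w n * right_part I m) = (left_part I m * ?Q * right_part I m) * w n"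
      unfolding wH by (simp only: mult.assoc)
    also have "left_part I m * ?Q * right_part I m = (\<Sum>c\<in>I. E I c (h c n - 1))"
      by (simp add: E_def sum_distrib_left sum_distrib_right)
    also have "left_part I m * ?Y * right_part I m = (\<Sum>c\<in>I. E I c 1)"
      by (simp add: E_def sum_distrib_left sum_distrib_right)
    finally show ?thesis using I by (simp add: normal_form_def)
  qed
  have moved: "E (insert c J) c x
      = left_part J m * (dprod (h c) (({1..m} - J) \<inter> {..<c}) * x * dprod (h c) (({1..m} - J) \<inter> {c<..})) * W J * right_part J m"
    if J: "J \<subseteq> {1..m}" and c: "c \<in> {1..m} - J" for J c x
  proof -
    have sets: "({1..m} - J) \<inter> {..<c} = {1..<c} - J" "({1..m} - J) \<inter> {c<..} = {c<..m} - J"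
      "insert c J \<inter> {c<..} = J \<inter> {c<..m}" "insert c J \<inter> {..<c} = J \<inter> {1..<c}" "insert c J - {c} = J"
      using J c by auto
    have JN: "J \<subseteq> {1..N}" using J assms by auto
    have D: "dprod (h c) ({c<..m} - J) * W J = W J * dprod (h c) ({c<..m} - J)"
      using J c assms by (intro dprod_commute[symmetric] h_W_disjoint[symmetric]) auto
    have "E (insert c J) c x = (left_part (insert c J) m * iprod (\<lambda>j. h j c) (J \<inter> {c<..m})) * x * W J
        * (iprod (\<lambda>j. h j c) (J \<inter> {1..<c}) * right_part (insert c J) m)"
      unfolding E_def sets by (simp only: mult.assoc)
    also have "left_part (insert c J) m * iprod (\<lambda>j. h j c) (J \<inter> {c<..m}) = left_part J m * dprod (h c) ({1..<c} - J)"
      using JN c assms by (intro left_part_insert[symmetric]) auto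
    also have "iprod (\<lambda>j. h j c) (J \<inter> {1..<c}) * right_part (insert c J) m = dprod (h c) ({c<..m} - J) * right_part J m"
      using JN c assms by (intro right_part_insert[symmetric]) auto
    also have "left_part J m * dprod (h c) ({1..<c} - J) * x * W J * (dprod (h c) ({c<..m} - J) * right_part J m)
        = left_part J m * dprod (h c) ({1..<c} - J) * x * (W J * dprod (h c) ({c<..m} - J)) * right_part J m"
      by (simp only: mult.assoc)
    also have "\<dots> = left_part J m * (dprod (h c) ({1..<c} - J) * x * dprod (h c) ({c<..m} - J)) * W J * right_part J m"
      unfolding D[symmetric] by (simp only: mult.assoc)
    finally show ?thesis unfolding sets .
  qed
  have cardC: "card ({1..m} - J) = m - k" if "J \<subseteq> {1..m}" "card J = k" for J
    using that finite_subset[of J "{1..m}"] by (simp add: card_Diff_subset)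
  have ins: "normal_form n (insert n J) = normal_form m J * (b ^ (m - k) * w n)
      - (\<Sum>c\<in>{1..m} - J. E (insert c J) c (h c n - 1)) * w n"
    if J: "J \<subseteq> {1..m}" "card J = k" for J
  proof -
    have "left_part (insert n J) m = left_part J m" "right_part (insert n J) m = right_part J m" "n \<notin> J"
      using J by (auto simp: n_def intro!: left_part_cong right_part_cong)
    moreover have "{1..m} - insert n J = {1..m} - J" by (auto simp: n_def)
    ultimately have "normal_form n (insert n J) = left_part J m * dprod (h n) ({1..m} - J) * W (insert n J) * right_part J m"
      by (simp add: normal_form_def n_def)
    also have "W (insert n J) = W J * w n"
      using J assms by (intro W_insert) (auto simp: n_def)
    also have "left_part J m * dprod (h n) ({1..m} - J) * (W J * w n) * right_part J m
        = left_part J m * dprod (h n) ({1..m} - J) * W J * right_part J m * w n"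
      using wH by (simp add: mult.assoc)
    also have "dprod (h n) ({1..m} - J) = b ^ card ({1..m} - J)
        - (\<Sum>c\<in>{1..m} - J. dprod (h c) (({1..m} - J) \<inter> {..<c}) * (h c n - 1)
            * dprod (h c) (({1..m} - J) \<inter> {c<..}))" (is "_ = _ - ?S")
      using assms by (intro dprod_expand) (auto simp: n_def)
    also have "left_part J m * (b ^ card ({1..m} - J) - ?S) * W J * right_part J m * w n
        = normal_form m J * (b ^ card ({1..m} - J) * w n) - left_part J m * ?S * W J * right_part J m * w n"
      by (simp add: normal_form_def left_diff_distrib right_diff_distrib mult.assoc b_power_left)
    also have "left_part J m * ?S * W J * right_part J m = (\<Sum>c\<in>{1..m} - J. E (insert c J) c (h c n - 1))"
      unfolding sum_distrib_left sum_distrib_right by (intro sum.cong refl moved[OF J(1), symmetric])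
    finally show ?thesis using cardC[OF J] by simp
  qed
  have geo: "(\<Sum>c\<in>{1..m} - J. E (insert c J) c 1) = normal_form m J * (\<Sum>i<m - k. b ^ i)"
    if J: "J \<subseteq> {1..m}" "card J = k" for J
  proof -
    have "(\<Sum>c\<in>{1..m} - J. E (insert c J) c 1)
        = left_part J m * (\<Sum>c\<in>{1..m} - J. dprod (h c) (({1..m} - J) \<inter> {..<c})
            * dprod (h c) (({1..m} - J) \<inter> {c<..})) * W J * right_part J m"
      unfolding sum_distrib_left sum_distrib_right
      by (intro sum.cong refl) (simp only: moved[OF J(1)] mult_1_right)
    also have "\<dots> = left_part J m * (\<Sum>i<m - k. b ^ i) * W J * right_part J m"
      using assms cardC[OF J] by (subst dprod_geometric) auto
    also have "\<dots> = normal_form m J * (\<Sum>i<m - k. b ^ i)"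
      by (simp add: normal_form_def sum_distrib_left sum_distrib_right mult.assoc b_power_left)
    finally show ?thesis .
  qed
  define T0 T1 T2 where "T0 = (\<Sum>I | I \<subseteq> {1..m} \<and> card I = Suc k. normal_form m I)"
    and "T1 = (\<Sum>I | I \<subseteq> {1..m} \<and> card I = k. normal_form m I)"
    and "T2 = (\<Sum>J | J \<subseteq> {1..m} \<and> card J = k. \<Sum>c\<in>{1..m} - J. E (insert c J) c (h c n - 1))"
  have "(\<Sum>I | I \<subseteq> {1..n} \<and> card I = Suc k. normal_form n I)
      = (\<Sum>I | I \<subseteq> {1..m} \<and> card I = Suc k. normal_form n I)
        + (\<Sum>I | I \<subseteq> {1..m} \<and> card I = k. normal_form n (insert n I))"
    unfolding n_def by (rule sum_subsets_Suc)
  also have "(\<Sum>I | I \<subseteq> {1..m} \<and> card I = Suc k. normal_form n I)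
      = b ^ Suc k * T0 + T2 * w n + \<zeta> n * (T1 * (\<Sum>i<m - k. b ^ i))"
  proof -
    have "(\<Sum>I | I \<subseteq> {1..m} \<and> card I = Suc k. normal_form n I)
        = b ^ Suc k * T0 + (\<Sum>I | I \<subseteq> {1..m} \<and> card I = Suc k. \<Sum>c\<in>I. E I c (h c n - 1)) * w n
          + \<zeta> n * (\<Sum>I | I \<subseteq> {1..m} \<and> card I = Suc k. \<Sum>c\<in>I. E I c 1)"
      unfolding T0_def sum_distrib_left[of _ _ "{I. _ I}"] sum_distrib_right[of _ "{I. _ I}"] sum.distrib[symmetric]
      by (intro sum.cong refl new) auto
    moreover have "(\<Sum>I | I \<subseteq> {1..m} \<and> card I = Suc k. \<Sum>c\<in>I. E I c (h c n - 1)) = T2"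
      unfolding T2_def by (intro sum_remove_element) simp
    moreover have "(\<Sum>I | I \<subseteq> {1..m} \<and> card I = Suc k. \<Sum>c\<in>I. E I c 1) = T1 * (\<Sum>i<m - k. b ^ i)"
      unfolding T1_def sum_distrib_right[of _ "{I. _ I}"]
      by (subst sum_remove_element, simp, intro sum.cong refl geo) auto
    ultimately show ?thesis by simp
  qed
  also have "(\<Sum>I | I \<subseteq> {1..m} \<and> card I = k. normal_form n (insert n I)) = T1 * (b ^ (m - k) * w n) - T2 * w n"
    unfolding T1_def T2_def sum_distrib_right[of _ "{I. _ I}"] sum_subtractf[symmetric]
    by (intro sum.cong refl ins) auto
  finally show ?thesis
    unfolding n_def[symmetric] T0_def[symmetric] T1_def[symmetric]
    by (simp add: distrib_left \<zeta>_left(2)[of T1])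
qed


lemma sum_normal_form_eq_sum_chains:
  assumes "m \<le> N"
  shows "(\<Sum>I | I \<subseteq> {1..m} \<and> card I = k. normal_form m I)
    = (\<Sum>i\<in>chains m k. prod_list (map (\<lambda>a. b ^ (m - k + a - i a)
        * (b ^ (i a - a) * w (i a) + \<zeta> (i a) * (\<Sum>r<i a - a. b ^ r))) [1..<Suc k]))"
  using assms
proof (induction m arbitrary: k)
  case (0 k)
  show ?case
  proof (cases k)
    case 0
    moreover have "{I. I \<subseteq> {1..0::nat} \<and> card I = 0} = {{}}" by auto
    ultimately show ?thesis by (simp add: normal_form_def chains_def strict_mono_on_def)
  next
    case (Suc j)
    then have "chains 0 k = {}" using chains_bounds(2)[of _ 0 k 1] chains_bounds(1)[of _ 0 k 1]
      by (fastforce simp: chains_def)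
    moreover have none: "{I. I \<subseteq> {1..0::nat} \<and> card I = k} = {}" using Suc by auto
    ultimately show ?thesis unfolding none by simp
  qed
next
  case (Suc m k)
  show ?case
  proof (cases k)
    case 0
    have "{I. I \<subseteq> {1..Suc m} \<and> card I = 0} = {{}}"
      using finite_subset[of _ "{1..Suc m}"] by auto
    moreover have "normal_form l {} = 1" for l
    proof -
      have "left_part {} l = 1" "right_part {} l = 1" by (induction l) simp_all
      then show ?thesis by (simp add: normal_form_def)
    qed
    moreover have "chains (Suc m) 0 = {\<lambda>_. undefined}"
      by (auto simp: chains_def strict_mono_on_def)
    ultimately show ?thesis unfolding 0 by simp
  next
    case (Suc j)
    show ?thesis
      unfolding Suc sum_chains_Suc[OF b_central, where v = "\<lambda>c e. b ^ e * w c + \<zeta> c * (\<Sum>r<e. b ^ r)"]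
      using sum_normal_form_Suc[of m j] Suc.prems Suc.IH by simp
  qed
qed


section \<open>Products of Dunkl elements\<close>

lemma right_part_tail:
  assumes "I \<subseteq> {1..m}" "m \<le> n"
  shows "right_part I n = dprod (\<lambda>r. iprod (\<lambda>j. h j r) I) {m<..n} * right_part I m"
  using assms(2)
proof (induction rule: dec_induct)
  case (step n)
  have "{m<..Suc n} = insert (Suc n) {m<..n}" using step.hyps by auto
  moreover have "Suc n \<notin> I" "I \<inter> {1..n} = I" using assms step.hyps by auto
  ultimately show ?case using step.IH by (simp add: dprod_insert_max mult.assoc)
qed simp


end

text \<open>
  Here \<open>g i j\<close> is the inverse of \<open>h i j\<close> for \<open>i < j\<close>.
\<close>

locale dunkl_elements = dunkl_algebra N b h w \<zeta>
  for N :: nat and b :: "'a::ring_1" and h :: "nat \<Rightarrow> nat \<Rightarrow> 'a" and w \<zeta> :: "nat \<Rightarrow> 'a" +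
  fixes g :: "nat \<Rightarrow> nat \<Rightarrow> 'a"
  assumes h_g: "\<lbrakk>1 \<le> i; i < j; j \<le> N\<rbrakk> \<Longrightarrow> h i j * g i j = 1"
    and g_h: "\<lbrakk>1 \<le> i; i < j; j \<le> N\<rbrakk> \<Longrightarrow> g i j * h i j = 1"
begin

text \<open>
  The shifted multiplicative Dunkl elements.
\<close>

definition dunkl_elem :: "nat \<Rightarrow> 'a" where
  "dunkl_elem i = dprod (\<lambda>j. g j i) {1..<i} * w i * dprod (h i) {i<..N}"

text \<open>
  The left part with \<open>h j i\<close> replaced by \<open>g i j\<close>, which agrees with it up to a central factor because
  \<open>h i j\<close> and \<open>h j i\<close> have a central product.
\<close>

primrec left_part_inv :: "nat set \<Rightarrow> nat \<Rightarrow> 'a" where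
  "left_part_inv I 0 = 1"
| "left_part_inv I (Suc m) = (if Suc m \<in> I then left_part_inv I m * dprod (\<lambda>i. g i (Suc m)) ({1..m} - I) else left_part_inv I m)"

lemma left_part_inv_cong: "I \<inter> {1..m} = J \<inter> {1..m} \<Longrightarrow> left_part_inv I m = left_part_inv J m"
proof (induction m)
  case (Suc m)
  note eqs = Int_atMost_Suc_eqD[OF Suc.prems]
  then have "{1..m} - I = {1..m} - J" by blast
  then show ?case using Suc.IH eqs by simp
qed simp

lemma left_part_inv_tail:
  assumes "I \<subseteq> {1..m}" "m \<le> n"
  shows "left_part_inv I n = left_part_inv I m"
  using assms(2)
proof (induction rule: dec_induct)
  case (step n)
  then have "Suc n \<notin> I" using assms by auto
  then show ?case using step by simp
qed simp

text \<open>
  Multiplying by the Dunkl element of a new largest index \<open>a\<close>: by \<open>right_part_sort\<close> its inverse factors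
  \<open>g j a\<close> cancel against the \<open>h j a\<close> with \<open>j \<in> I\<close>, and the other factors \<open>g i a\<close> move to the left of
  \<open>W I\<close>.
\<close>

lemma iprod_dunkl_elem:
  assumes "I \<subseteq> {1..N}"
  shows "iprod dunkl_elem I = left_part_inv I N * W I * right_part I N"
proof -
  have "finite I" using assms finite_subset by blast
  then show ?thesis using assms
  proof (induction I rule: finite_linorder_max_induct)
    case empty
    have "left_part_inv {} m = 1" "right_part {} m = 1" for m by (induction m) simp_all
    then show ?case by simp
  next
    case (insert a I)
    define m J where "m = a - 1" and "J = insert a I"
    have a: "a = Suc m" "a \<le> N" "a \<in> {1..N}" using insert.prems by (auto simp: m_def)
    have rI: "1 \<le> i \<and> i \<le> m" if "i \<in> I" for i
    proof
      show "1 \<le> i" using insert.prems that by auto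
      show "i \<le> m" using insert.hyps(2) that a(1) by auto
    qed
    then have I: "I \<subseteq> {1..m}" "I \<subseteq> {1..a}" "I \<subseteq> {1..N}" "a \<notin> I" "I \<inter> {1..m} = I" "finite I"
      using insert.hyps insert.prems a(1) by force+
    have J: "J \<inter> {1..m} = I" "J \<subseteq> {1..a}" "J \<inter> {1..m} = I \<inter> {1..m}"
      using I a by (auto simp: J_def)
    define T E P R L where "T = dprod (\<lambda>r. iprod (\<lambda>j. h j r) I) {a<..N}"
      and "E = dprod (h a) {a<..N}" and "P = iprod (\<lambda>j. h j a) I"
      and "R = dprod (\<lambda>j. g j a) {1..m}" and "L = dprod (\<lambda>j. g j a) ({1..m} - I)"
    define C B where "C = iprod (\<lambda>j. h j a) ({1..m} - I)" and "B = iprod (\<lambda>j. h j a) {1..m}"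
    have CL: "L * C = 1"
      unfolding C_def L_def using a by (intro iprod_inverse(2)) (auto intro: h_g g_h)
    have BR: "B * R = 1"
      unfolding B_def R_def using a by (intro iprod_inverse(1)) (auto intro: h_g g_h)
    have sort: "C * P * right_part I m = right_part I m * B"
      using right_part_sort[of I m a] I a unfolding C_def P_def B_def by simp
    have HI: "right_part I N = T * (P * right_part I m)"
      using right_part_tail[OF I(2) a(2)] I a unfolding T_def P_def by simp
    have strip: "P * right_part I m * R = L * right_part I m"
    proof -
      have "P * right_part I m * R = (L * C) * P * right_part I m * R" unfolding CL by simp
      also have "\<dots> = L * (C * P * right_part I m) * R" by (simp only: mult.assoc)
      also have "\<dots> = L * right_part I m * (B * R)" unfolding sort by (simp only: mult.assoc)
      finally show ?thesis unfolding BR by simp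
    qed
    have Lh: "h j r * g i a = g i a * h j r"
      if "j \<in> I" "r \<in> {a<..N}" "i \<in> {1..m} - I" for i j r
    proof -
      have "1 \<le> j" "j < a" "a < r" "r \<le> N" "1 \<le> i" "i < a" "i \<noteq> j"
        using that rI[of j] a(1) by auto
      then show ?thesis
        using a(2) by (intro inverse_commute[OF h_commute h_g g_h]) auto
    qed
    have TL: "T * L = L * T"
      unfolding T_def L_def
    proof (intro dprod_commute)
      fix i assume "i \<in> {1..m} - I"
      then show "dprod (\<lambda>r. iprod (\<lambda>j. h j r) I) {a<..N} * g i a
          = g i a * dprod (\<lambda>r. iprod (\<lambda>j. h j r) I) {a<..N}"
        by (intro dprod_commute[symmetric] iprod_commute) (auto intro: Lh[symmetric])
    qed
    have WL: "W I * L = L * W I"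
      unfolding L_def
    proof (intro dprod_commute)
      fix i assume "i \<in> {1..m} - I"
      then have i: "1 \<le> i" "i < a" "i \<notin> I" using a(1) by auto
      have "w j * g i a = g i a * w j" if "j \<in> I" for j
      proof -
        have "1 \<le> j" "j < a" "i \<noteq> j" using that rI[of j] i a(1) by auto
        then show ?thesis
          using i a(2) by (intro inverse_commute[OF w_h_commute h_g g_h]) auto
      qed
      then show "W I * g i a = g i a * W I"
        by (intro iprod_commute[symmetric]) (rule sym)
    qed
    have wT: "T * w a = w a * T"
      unfolding T_def
    proof (intro dprod_commute[symmetric] iprod_commute)
      fix r j assume "r \<in> {a<..N}" "j \<in> I"
      then show "w a * h j r = h j r * w a"
        using a rI[of j] by (intro w_h_commute) auto
    qed
    have wH: "right_part I m * w a = w a * right_part I m"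
      using a by (intro right_part_commute[symmetric] w_h_commute) auto
    have HE: "right_part I m * E = E * right_part I m"
      unfolding E_def
    proof (intro dprod_commute right_part_commute[symmetric])
      fix r i j assume "r \<in> {a<..N}" "1 \<le> j" "j < i" "i \<le> m"
      then show "h a r * h j i = h j i * h a r"
        using a by (intro h_commute) auto
    qed
    have TE: "T * E = dprod (\<lambda>r. iprod (\<lambda>j. h j r) J) {a<..N}"
    proof -
      have "T * E = dprod (\<lambda>r. iprod (\<lambda>j. h j r) I * h a r) {a<..N}"
        unfolding T_def E_def
      proof (intro dprod_times iprod_commute)
        fix r s j assume "r \<in> {a<..N}" "s \<in> {a<..N}" "s < r" "j \<in> I"
        then show "h a r * h j s = h j s * h a r"
          using a rI[of j] by (intro h_commute) auto
      qed simp
      also have "\<dots> = dprod (\<lambda>r. iprod (\<lambda>j. h j r) J) {a<..N}"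
        unfolding J_def using insert.hyps by (intro dprod_cong) (auto simp: iprod_insert_max)
      finally show ?thesis .
    qed
    have "left_part_inv J N = left_part_inv J a" using J(2) a(2) by (rule left_part_inv_tail)
    also have "left_part_inv J a = left_part_inv J m * L"
      unfolding L_def using a(1) I J by (auto simp: J_def intro!: arg_cong2[of _ _ _ _ "(*)"] dprod_cong)
    also have "left_part_inv J m = left_part_inv I m" by (rule left_part_inv_cong[OF J(3)])
    also have "left_part_inv I m = left_part_inv I N" using I(1) a by (intro left_part_inv_tail[symmetric]) auto
    finally have GJ: "left_part_inv J N = left_part_inv I N * L" .
    have "right_part J N = dprod (\<lambda>r. iprod (\<lambda>j. h j r) J) {a<..N} * right_part J a"
      using J(2) a(2) by (rule right_part_tail)
    also have "right_part J a = right_part J m" using a(1) by (simp add: J_def)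
    also have "right_part J m = right_part I m" by (rule right_part_cong[OF J(3)])
    finally have HJ: "right_part J N = T * E * right_part I m" unfolding TE .
    have WJ: "W J = W I * w a"
      unfolding J_def using I a by (intro W_insert) auto
    have Da: "dunkl_elem a = R * w a * E"
      unfolding dunkl_elem_def R_def E_def using a(1) by (simp add: atLeastLessThanSuc_atLeastAtMost)
    have "iprod dunkl_elem J = iprod dunkl_elem I * dunkl_elem a"
      unfolding J_def using insert.hyps by (intro iprod_insert_max) auto
    also have "iprod dunkl_elem I = left_part_inv I N * W I * right_part I N"
      using insert I by blast
    also have "left_part_inv I N * W I * right_part I N * dunkl_elem a = left_part_inv I N * W I * T * (P * right_part I m * R) * w a * E"
      unfolding HI Da by (simp only: mult.assoc)
    also have "\<dots> = left_part_inv I N * W I * (T * L) * (right_part I m * w a) * E"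
      unfolding strip by (simp only: mult.assoc)
    also have "\<dots> = left_part_inv I N * (W I * L) * (T * w a) * (right_part I m * E)"
      unfolding TL wH by (simp only: mult.assoc)
    also have "\<dots> = left_part_inv I N * L * (W I * w a) * (T * E * right_part I m)"
      unfolding WL wT HE by (simp only: mult.assoc)
    also have "\<dots> = left_part_inv J N * W J * right_part J N"
      unfolding GJ HJ WJ by (simp only: mult.assoc)
    finally show ?case unfolding J_def .
  qed
qed

end

section \<open>Relations in the algebra\<close>

text \<open>
  With \<open>x\<close>, \<open>y\<close>, \<open>v\<close> standing for \<open>u i j\<close>, \<open>u i k\<close>, \<open>u j k\<close>, the three-term relations and one quadratic
  relation imply the Yang--Baxter relation.
\<close>

lemma yang_baxter_from_triangle:
  fixes x y v B Q T :: "'a::ring_1"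
  assumes central: "\<And>c. B * c = c * B" "\<And>c. Q * c = c * Q" "\<And>c. T * c = c * T"
    and R1: "x * v = y * x + v * y - B * y" and R2: "v * x = x * y + y * v - B * y"
    and sq: "v * v = B * v + Q"
  shows "(1 + T * x) * (1 + T * y) * (1 + T * v) = (1 + T * v) * (1 + T * y) * (1 + T * x)"
proof -
  have cl: "c * T = T * c" "c * (T * d) = T * (c * d)" for c d
    by (metis central(3)) (metis central(3) mult.assoc)
  have bl: "c * B = B * c" "c * (B * d) = B * (c * d)" "c * Q = Q * c" for c d
    by (metis central(1), metis central(1) mult.assoc, metis central(2))
  have two: "x * y + x * v + y * v = v * y + v * x + y * x"
    unfolding R1 R2 by (simp add: algebra_simps)
  have three: "x * y * v = v * y * x"
  proof -
    have xy: "x * y = v * x - y * v + B * y" and vy: "v * y = x * v - y * x + B * y"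
      using R1 R2 by (simp_all add: algebra_simps)
    have "x * y * v = v * x * v - y * (v * v) + B * (y * v)"
      unfolding xy by (simp add: algebra_simps)
    also have "\<dots> = v * x * v - Q * y"
      unfolding sq by (simp add: distrib_left bl[of y])
    also have "Q * y = v * v * y - B * (v * y)"
      unfolding sq by (simp add: algebra_simps)
    also have "v * x * v - (v * v * y - B * (v * y)) = v * (x * v - v * y + B * y)"
      by (simp add: algebra_simps bl[of v])
    also have "x * v - v * y + B * y = y * x"
      unfolding vy by simp
    finally show ?thesis by (simp only: mult.assoc)
  qed
  have "(1 + T * x) * (1 + T * y) * (1 + T * v)
      = 1 + T * (x + y + v) + T * (T * (x * y + x * v + y * v)) + T * (T * (T * (x * y * v)))"
    by (simp add: distrib_left distrib_right mult.assoc cl[of x] cl[of y] cl[of v] add_ac)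
  also have "\<dots> = 1 + T * (x + y + v) + T * (T * (v * y + v * x + y * x)) + T * (T * (T * (v * y * x)))"
    unfolding two three ..
  also have "\<dots> = (1 + T * v) * (1 + T * y) * (1 + T * x)"
    by (simp add: distrib_left distrib_right mult.assoc cl[of x] cl[of y] cl[of v] add_ac)
  finally show ?thesis .
qed

text \<open>
  Multiplying a three-term relation by \<open>w1\<close> from the left and moving \<open>w1\<close> to the right on both sides
  gives a relation free of \<open>w1\<close>, \<open>w2\<close> and \<open>w3\<close>.  Here \<open>E\<close> and \<open>F\<close> are the parameters of the second and the
  third index.
\<close>

lemma triangle_collapse:
  fixes x y v B E F :: "'a::ring_1"
  assumes central: "\<And>c. B * c = c * B" "\<And>c. E * c = c * E" "\<And>c. F * c = c * F"
    and R1: "x * v = y * x + v * y - B * y"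
    and w1x: "w1 * x = x * w2 + B * w1 + E" and w1y: "w1 * y = y * w3 + B * w1 + F"
    and w1v: "w1 * v = v * w1" and w2v: "w2 * v = v * w3 + B * w2 + F" and w3x: "w3 * x = x * w3"
  shows "(F - E) * (v - B) = 0"
proof -
  have cl: "c * B = B * c" "c * (B * d) = B * (c * d)" "c * E = E * c" "c * (E * d) = E * (c * d)"
      "c * F = F * c" "c * (F * d) = F * (c * d)" for c d
    by (metis central(1), metis central(1) mult.assoc, metis central(2), metis central(2) mult.assoc,
        metis central(3), metis central(3) mult.assoc)
  have 1: "w1 * (x * v) = x * v * w3 + B * (x * w2) + F * x + B * (v * w1) + E * v"
  proof -
    have "w1 * (x * v) = (w1 * x) * v" by (simp only: mult.assoc)
    also have "\<dots> = x * (w2 * v) + B * (w1 * v) + E * v"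
      unfolding w1x by (simp only: distrib_right mult.assoc)
    finally show ?thesis unfolding w2v w1v by (simp add: distrib_left cl[of x] mult.assoc)
  qed
  have 2: "w1 * (y * x) = y * x * w3 + B * (x * w2 + B * w1 + E) + F * x"
  proof -
    have "w1 * (y * x) = (w1 * y) * x" by (simp only: mult.assoc)
    also have "\<dots> = y * (w3 * x) + B * (w1 * x) + F * x"
      unfolding w1y by (simp only: distrib_right mult.assoc)
    finally show ?thesis unfolding w1x w3x by (simp only: mult.assoc)
  qed
  have 3: "w1 * (v * y) = v * y * w3 + B * (v * w1) + F * v"
  proof -
    have "w1 * (v * y) = (w1 * v) * y" by (simp only: mult.assoc)
    also have "\<dots> = v * (w1 * y)" unfolding w1v by (simp only: mult.assoc)
    finally show ?thesis unfolding w1y by (simp add: distrib_left cl[of v] mult.assoc)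
  qed
  have 4: "w1 * (B * y) = B * y * w3 + B * (B * w1) + B * F"
  proof -
    have "w1 * (B * y) = B * (w1 * y)" by (rule cl)
    then show ?thesis unfolding w1y by (simp add: distrib_left mult.assoc)
  qed
  have "w1 * (x * v) = w1 * (y * x) + w1 * (v * y) - w1 * (B * y)"
    unfolding R1 by (simp add: distrib_left right_diff_distrib)
  moreover have "x * v * w3 = y * x * w3 + v * y * w3 - B * y * w3"
    unfolding R1 by (simp add: distrib_right left_diff_distrib)
  ultimately have "E * v = B * E + F * v - B * F"
    unfolding 1 2 3 4 by (simp add: algebra_simps)
  then show ?thesis by (simp add: algebra_simps cl(1)[of E] cl(1)[of F])
qed

lemma tht_relation: "x - y \<in> relators \<Longrightarrow> abs_tht x = abs_tht y"
  by (simp add: abs_tht_eq_iff rel_eq_def ideal_base)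

lemma tht_uu_comm:
  assumes "1 \<le> i" "i < j" "j \<le> CARD('n)" "1 \<le> k" "k < l" "l \<le> CARD('n)" "{i, j} \<inter> {k, l} = {}"
  shows "u i j * u k l = (u k l * u i j :: ('n::finite) tht)"
  using tht_relation[OF relators.uu_comm[OF assms]] by (simp add: u_def times_tht.abs_eq)

lemma tht_uu_three:
  assumes "1 \<le> i" "i < j" "j < k" "k \<le> CARD('n)"
  shows "u i j * u j k = u i k * u i j + u j k * u i k - scalar bpar * (u i k :: ('n::finite) tht)"
    and "u j k * u i j = u i j * u i k + u i k * u j k - scalar bpar * (u i k :: 'n tht)"
  using tht_relation[OF relators.uu_three_1[OF assms]] tht_relation[OF relators.uu_three_2[OF assms]]
  by (simp_all add: u_def scalar_def times_tht.abs_eq plus_tht.abs_eq minus_tht.abs_eq)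

lemma tht_zz_comm:
  assumes "1 \<le> i" "i \<le> CARD('n)" "1 \<le> j" "j \<le> CARD('n)"
  shows "z i * z j = (z j * z i :: ('n::finite) tht)"
  using tht_relation[OF relators.zz_comm[OF assms]] by (simp add: z_def times_tht.abs_eq)

lemma tht_zu_comm:
  assumes "1 \<le> i" "i \<le> CARD('n)" "1 \<le> k" "k < l" "l \<le> CARD('n)" "i \<notin> {k, l}"
  shows "z i * u k l = (u k l * z i :: ('n::finite) tht)"
  using tht_relation[OF relators.zu_comm[OF assms]] by (simp add: z_def u_def times_tht.abs_eq)

lemma tht_zu:
  assumes "1 \<le> i" "i < j" "j \<le> CARD('n)"
  shows "z i * u i j = u i j * z j + scalar bpar * z i + (scalar (hpar j) :: ('n::finite) tht)"
    and "z j * u i j = u i j * z i - scalar bpar * z i - (scalar (hpar j) :: 'n tht)"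
  using tht_relation[OF relators.zu_left[OF assms]] tht_relation[OF relators.zu_right[OF assms]]
  by (simp_all add: u_def z_def scalar_def times_tht.abs_eq plus_tht.abs_eq minus_tht.abs_eq)

text \<open>
  The generators extended to all pairs of distinct indices by \<open>u j i = \<beta> - u i j\<close>.
  All relations then take the same form for every order of the indices.
\<close>

definition usym :: "nat \<Rightarrow> nat \<Rightarrow> ('n::finite) tht" where
  "usym i j = (if i < j then u i j else scalar bpar - u j i)"

text \<open>
  The shift by 1 of \<open>z i\<close>; it turns the parameter \<open>h\<^sub>i\<close> of the mixed relations into \<open>h\<^sub>i - \<beta>\<close>.
\<close>

definition wgen :: "nat \<Rightarrow> ('n::finite) tht" where
  "wgen i = 1 + z i"

lemma scalar_pull: "x * scalar c = scalar c * x" "x * (scalar c * y) = scalar c * (x * y)"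
  by (metis scalar_central) (metis scalar_central mult.assoc)

lemma scalar_swap:
  "scalar c * scalar d = scalar d * scalar c"
  "scalar c * (scalar d * x) = scalar d * (scalar c * x)"
  by (rule scalar_pull)+

lemmas scalar_left = scalar_swap scalar_pull[of "u i j" for i j] scalar_pull[of "z i" for i]
  scalar_pull[of "usym i j" for i j] scalar_pull[of "wgen i" for i]

lemma usym_swap: "i \<noteq> j \<Longrightarrow> usym j i = scalar bpar - usym i j"
  by (auto simp: usym_def)

lemma usym_commute:
  assumes "{i, j, k, l} \<subseteq> {1..CARD('n)}" "distinct [i, j, k, l]"
  shows "usym i j * usym k l = (usym k l * usym i j :: ('n::finite) tht)"
proof -
  have "u (min i j) (max i j) * u (min k l) (max k l) = (u (min k l) (max k l) * u (min i j) (max i j) :: 'n tht)"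
    using assms by (intro tht_uu_comm) (auto simp: min_def max_def)
  moreover have "usym i j = (u (min i j) (max i j) :: 'n tht) \<or> usym i j = scalar bpar - (u (min i j) (max i j) :: 'n tht)"
    "usym k l = (u (min k l) (max k l) :: 'n tht) \<or> usym k l = scalar bpar - (u (min k l) (max k l) :: 'n tht)"
    by (auto simp: usym_def min_def max_def)
  ultimately show ?thesis
    by (elim disjE) (simp_all add: left_diff_distrib right_diff_distrib scalar_left)
qed

lemma usym_triangle:
  assumes "{i, j, k} \<subseteq> {1..CARD('n)}" "distinct [i, j, k]"
  shows "usym i j * usym j k
    = usym i k * usym i j + usym j k * usym i k - scalar bpar * (usym i k :: ('n::finite) tht)"
proof -
  have T: "u a c * u c d = u a d * u a c + u c d * u a d - scalar bpar * (u a d :: 'n tht)"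
    "u c d * u a c = u a c * u a d + u a d * u c d - scalar bpar * (u a d :: 'n tht)"
    if "a < c" "c < d" "{a, c, d} = {i, j, k}" for a c d
    using assms that by (intro tht_uu_three; force)+
  consider "i < j" "j < k" | "i < k" "k < j" | "j < i" "i < k" | "j < k" "k < i" | "k < i" "i < j" | "k < j" "j < i"
    using assms(2) by (auto simp: neq_iff)
  then show ?thesis
  proof cases
    case 1
    then show ?thesis using T[of i j k] by (simp add: usym_def)
  next
    case 2
    then show ?thesis using T[of i k j] by (auto simp: usym_def algebra_simps scalar_left insert_commute)
  next
    case 3
    then show ?thesis using T[of j i k] by (auto simp: usym_def algebra_simps scalar_left insert_commute)
  next
    case 4
    then show ?thesis using T[of j k i] by (auto simp: usym_def algebra_simps scalar_left insert_commute)
  next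
    case 5
    then show ?thesis using T[of k i j] by (auto simp: usym_def algebra_simps scalar_left insert_commute)
  next
    case 6
    then show ?thesis using T[of k j i] by (auto simp: usym_def algebra_simps scalar_left insert_commute)
  qed
qed

lemma usym_square:
  assumes "{i, j} \<subseteq> {1..CARD('n)}" "i \<noteq> j"
  shows "usym i j * usym i j = scalar bpar * usym i j + (scalar (qpar i j) :: ('n::finite) tht)"
proof -
  have "qpar i j = (qpar j i :: 'n coeff)" by (simp add: qpar_def min.commute max.commute)
  then show ?thesis
    using tht_u_square[of i j, where 'n='n] tht_u_square[of j i, where 'n='n] assms
    by (cases i j rule: linorder_cases) (auto simp: usym_def algebra_simps scalar_left)
qed

text \<open>
  The shifted parameter \<open>h\<^sub>i - \<beta>\<close>.
\<close>

definition eta :: "nat \<Rightarrow> ('n::finite) coeff" where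
  "eta i = hpar i - bpar"

lemma wgen_usym_commute:
  assumes "{i, j, k} \<subseteq> {1..CARD('n)}" "distinct [i, j, k]"
  shows "wgen i * usym j k = (usym j k * wgen i :: ('n::finite) tht)"
proof -
  have "z i * u j k = (u j k * z i :: 'n tht)" if "j < k"
    using assms that by (intro tht_zu_comm) auto
  moreover have "z i * u k j = (u k j * z i :: 'n tht)" if "k < j"
    using assms that by (intro tht_zu_comm) auto
  ultimately show ?thesis
    using assms(2) by (cases j k rule: linorder_cases) (auto simp: wgen_def usym_def algebra_simps scalar_left)
qed

lemma wgen_usym:
  assumes "i \<in> {1..CARD('n)}" "j \<in> {1..CARD('n)}" "i \<noteq> j"
  shows "wgen i * usym i j
    = usym i j * wgen j + scalar bpar * wgen i + (scalar (eta (max i j)) :: ('n::finite) tht)"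
  using tht_zu[of i j, where 'n='n] tht_zu[of j i, where 'n='n] assms
  by (cases i j rule: linorder_cases)
    (auto simp: wgen_def usym_def eta_def scalar_hom max_def algebra_simps scalar_left)

text \<open>
  This is \<open>hh i j\<close> for \<open>i < j\<close>, and a central multiple of \<open>hh_inv j i\<close> for \<open>j < i\<close>.
\<close>

definition hsym :: "nat \<Rightarrow> nat \<Rightarrow> ('n::finite) tht" where
  "hsym i j = 1 + scalar tpar * usym i j"

lemma tht_dunkl_elements:
  "dunkl_elements CARD('n) (scalar (1 + tpar * bpar) :: ('n::finite) tht)
    hsym wgen (\<lambda>i. scalar (tpar * eta i)) hh_inv"
proof unfold_locales
  fix x :: "'n tht"
  show "scalar (1 + tpar * bpar) * x = x * scalar (1 + tpar * bpar)" by (rule scalar_central)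
next
  fix x :: "'n tht" and i
  show "scalar (tpar * eta i) * x = x * scalar (tpar * eta i)" by (rule scalar_central)
next
  fix i j assume ij: "i \<in> {1..CARD('n)}" "j \<in> {1..CARD('n)}" "i \<noteq> j"
  then show "hsym i j + hsym j i = 1 + (scalar (1 + tpar * bpar) :: 'n tht)"
    by (simp add: hsym_def usym_swap[of i j] scalar_hom algebra_simps scalar_swap)
next
  fix i j k l assume "{i, j, k, l} \<subseteq> {1..CARD('n)}" "distinct [i, j, k, l]"
  then have "usym i j * usym k l = (usym k l * usym i j :: 'n tht)" by (rule usym_commute)
  then show "hsym i j * hsym k l = (hsym k l * hsym i j :: 'n tht)"
    by (simp add: hsym_def distrib_left distrib_right mult.assoc scalar_left add_ac)
next
  fix i j k assume a: "{i, j, k} \<subseteq> {1..CARD('n)}" "distinct [i, j, k]"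
  have R: "usym i k * usym k j
      = usym i j * usym i k + usym k j * usym i j - scalar bpar * (usym i j :: 'n tht)"
    using a by (intro usym_triangle) auto
  have s: "usym k j = scalar bpar - (usym j k :: 'n tht)" "usym j i = scalar bpar - (usym i j :: 'n tht)"
    using a by (auto intro: usym_swap)
  have "usym i k * usym j k = usym j i * usym i k + usym j k * (usym i j :: 'n tht)"
    using R unfolding s by (simp add: algebra_simps scalar_left)
  then have E: "scalar tpar * (scalar tpar * (usym i k * usym j k))
      = scalar tpar * (scalar tpar * (usym j i * usym i k)) + scalar tpar * (scalar tpar * (usym j k * (usym i j :: 'n tht)))"
    by (simp add: distrib_left)
  show "(hsym i k - 1) * hsym j k = hsym j i * (hsym i k - 1) + (hsym j k - 1) * (hsym i j - 1 :: 'n tht)"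
    unfolding hsym_def by (simp add: distrib_left distrib_right mult.assoc scalar_left E)
next
  fix i j k assume a: "{i, j, k} \<subseteq> {1..CARD('n)}" "distinct [i, j, k]"
  have R: "usym k j * usym j i
      = usym k i * usym k j + usym j i * usym k i - scalar bpar * (usym k i :: 'n tht)"
    using a by (intro usym_triangle) auto
  have s: "usym k j = scalar bpar - (usym j k :: 'n tht)" "usym j i = scalar bpar - (usym i j :: 'n tht)"
    "usym k i = scalar bpar - (usym i k :: 'n tht)"
    using a by (auto intro: usym_swap)
  have R2: "usym j k * usym i j = usym i j * usym i k + usym i k * usym j k - scalar bpar * (usym i k :: 'n tht)"
    using R unfolding s by (simp add: algebra_simps scalar_left)
  show "hsym i j * hsym i k * hsym j k = (hsym j k * hsym i k * hsym i j :: 'n tht)"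
    unfolding hsym_def
    by (rule yang_baxter_from_triangle[OF scalar_central scalar_central scalar_central
          usym_triangle[OF a] R2 usym_square]) (use a in auto)
next
  fix i j assume "i \<in> {1..CARD('n)}" "j \<in> {1..CARD('n)}"
  then have "z i * z j = (z j * z i :: 'n tht)" by (intro tht_zz_comm) auto
  then show "wgen i * wgen j = (wgen j * wgen i :: 'n tht)"
    by (simp add: wgen_def algebra_simps)
next
  fix i j k assume "{i, j, k} \<subseteq> {1..CARD('n)}" "distinct [i, j, k]"
  then have "wgen i * usym j k = (usym j k * wgen i :: 'n tht)" by (rule wgen_usym_commute)
  then show "wgen i * hsym j k = (hsym j k * wgen i :: 'n tht)"
    by (simp add: hsym_def distrib_left distrib_right mult.assoc scalar_left)
next
  fix i j assume "i \<in> {1..CARD('n)}" "j \<in> {1..CARD('n)}" "i \<noteq> j"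
  from wgen_usym[OF this]
  show "wgen i * hsym i j = scalar (1 + tpar * bpar) * wgen i + (hsym i j - 1) * wgen j
      + (scalar (tpar * eta (max i j)) :: 'n tht)"
    by (simp add: hsym_def distrib_left distrib_right mult.assoc scalar_left scalar_hom add_ac)
next
  \<comment> \<open>The index 1 lies below \<open>c\<close> and \<open>k\<close>, so the three-term relation for \<open>1 < c < k\<close> applies.\<close>
  fix c k :: nat assume ck: "1 < c" "c < k" "k \<le> CARD('n)"
  have R1: "usym 1 c * usym c k = usym 1 k * usym 1 c + usym c k * usym 1 k - scalar bpar * (usym 1 k :: 'n tht)"
    using ck by (intro usym_triangle) auto
  have "(scalar (eta k) - scalar (eta c)) * (usym c k - scalar bpar) = (0 :: 'n tht)"
  proof (rule triangle_collapse[OF scalar_central scalar_central scalar_central R1])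
    show "wgen 1 * usym 1 c = usym 1 c * wgen c + scalar bpar * wgen 1 + (scalar (eta c) :: 'n tht)"
      "wgen 1 * usym 1 k = usym 1 k * wgen k + scalar bpar * wgen 1 + (scalar (eta k) :: 'n tht)"
      "wgen c * usym c k = usym c k * wgen k + scalar bpar * wgen c + (scalar (eta k) :: 'n tht)"
      using wgen_usym[of 1 c, where 'n='n] wgen_usym[of 1 k, where 'n='n] wgen_usym[of c k, where 'n='n] ck
      by (simp_all add: max_def)
    show "wgen 1 * usym c k = (usym c k * wgen 1 :: 'n tht)" "wgen k * usym 1 c = (usym 1 c * wgen k :: 'n tht)"
      using ck by (auto intro!: wgen_usym_commute)
  qed
  then have "scalar tpar * (scalar tpar * ((scalar (eta k) - scalar (eta c)) * (usym c k - scalar bpar))) = (0 :: 'n tht)"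
    by simp
  then show "(scalar (tpar * eta k) - scalar (tpar * eta c)) * (hsym c k - scalar (1 + tpar * bpar)) = (0 :: 'n tht)"
    by (simp add: hsym_def scalar_hom algebra_simps scalar_left)
next
  fix i j assume ij: "1 \<le> i" "i < j" "j \<le> CARD('n)"
  then have "hsym i j = (hh i j :: 'n tht)" by (simp add: hsym_def hh_def usym_def)
  then show "hsym i j * hh_inv i j = (1 :: 'n tht)" "hh_inv i j * hsym i j = (1 :: 'n tht)"
    using hh_inverse[OF ij] by simp_all
qed

section \<open>Evaluation of the coefficients\<close>

lemma scalar_0 [simp]: "scalar 0 = 0"
  using scalar_hom(3)[of 0 0] by simp

lemma scalar_power: "scalar (c ^ m) = scalar c ^ m"
  by (induction m) (simp_all add: scalar_hom)

lemma scalar_sum: "scalar (sum f A) = (\<Sum>r\<in>A. scalar (f r))"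
  by (induction A rule: infinite_finite_induct) (simp_all add: scalar_hom)

lemma beta_quot_geometric:
  "beta_quot m = tpar * (\<Sum>r<m. (1 + tpar * bpar) ^ r :: ('n::finite) coeff)"
proof (induction m)
  case 0
  show ?case by (simp add: beta_quot_def)
next
  case (Suc m)
  have "beta_quot (Suc m) = (\<Sum>r<Suc m. of_nat (Suc m choose Suc r) * tpar ^ Suc r * (bpar ^ r :: 'n coeff))"
    unfolding beta_quot_def
    by (rule sum.reindex_bij_witness[of _ Suc "\<lambda>r. r - 1"]) auto
  also have "\<dots> = (\<Sum>r<Suc m. of_nat (m choose Suc r) * tpar ^ Suc r * (bpar ^ r :: 'n coeff))
      + (\<Sum>r<Suc m. of_nat (m choose r) * tpar ^ Suc r * (bpar ^ r :: 'n coeff))"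
    by (simp add: sum.distrib[symmetric] algebra_simps)
  also have "(\<Sum>r<Suc m. of_nat (m choose Suc r) * tpar ^ Suc r * (bpar ^ r :: 'n coeff))
      = (\<Sum>r<m. of_nat (m choose Suc r) * tpar ^ Suc r * bpar ^ r)"
    by (simp add: binomial_eq_0)
  also have "\<dots> = beta_quot m"
    unfolding beta_quot_def
    by (rule sum.reindex_bij_witness[of _ "\<lambda>r. r - 1" Suc]) auto
  also have "(\<Sum>r<Suc m. of_nat (m choose r) * tpar ^ Suc r * (bpar ^ r :: 'n coeff))
      = tpar * (\<Sum>r\<le>m. of_nat (m choose r) * (tpar * bpar) ^ r)"
    by (simp add: sum_distrib_left lessThan_Suc_atMost power_mult_distrib algebra_simps)
  also have "(\<Sum>r\<le>m. of_nat (m choose r) * (tpar * bpar :: 'n coeff) ^ r) = (1 + tpar * bpar) ^ m"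
    using binomial_ring[of "tpar * bpar :: 'n coeff" 1 m] by (simp add: add.commute)
  finally show ?case using Suc by (simp add: algebra_simps)
qed

lemma dprod_scalar:
  assumes "finite A" "\<And>i. i \<in> A \<Longrightarrow> f i = scalar (c i) * g i"
  shows "dprod f A = scalar (\<Prod>i\<in>A. c i) * dprod g A"
  using assms
proof (induction A rule: finite_linorder_max_induct)
  case (insert x A)
  have "x \<notin> A" using insert.hyps by auto
  have "dprod f (insert x A) = scalar (c x) * (g x * scalar (\<Prod>i\<in>A. c i)) * dprod g A"
    using insert by (simp add: dprod_insert_max mult.assoc)
  also have "\<dots> = scalar (\<Prod>i\<in>insert x A. c i) * (g x * dprod g A)"
    unfolding scalar_pull(1) using insert.hyps \<open>x \<notin> A\<close> by (simp add: scalar_hom mult.assoc)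
  finally show ?case using insert.hyps by (simp add: dprod_insert_max)
qed (simp add: scalar_hom)

lemma hsym_eq_kappa_hh_inv:
  assumes "1 \<le> i" "i < j" "j \<le> CARD('n)"
  shows "hsym j i = scalar (kappa i j) * (hh_inv i j :: ('n::finite) tht)"
proof -
  have "scalar (kappa i j) * (hh_inv i j :: 'n tht)
      = scalar (kappa i j * kappa_inv i j) * (1 + scalar (tpar * bpar) - scalar tpar * u i j)"
    by (simp add: hh_inv_def scalar_hom mult.assoc)
  also have "\<dots> = 1 + scalar (tpar * bpar) - scalar tpar * u i j"
    by (simp add: kappa_inverse[OF assms] scalar_hom)
  also have "\<dots> = hsym j i"
    using assms by (simp add: hsym_def usym_def scalar_hom algebra_simps scalar_swap)
  finally show ?thesis ..
qed

text \<open>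
  The pairs \<open>i \<notin> I\<close>, \<open>j \<in> I\<close>, \<open>i < j\<close> grouped by \<open>j\<close>, as in the recursive definition of the left part.
\<close>

lemma prod_inversions:
  fixes f :: "nat \<Rightarrow> nat \<Rightarrow> 'a::comm_monoid_mult"
  assumes "I \<subseteq> {1..n}"
  shows "(\<Prod>(i, j)\<in>{(i, j). i \<in> {1..n} - I \<and> j \<in> I \<and> i < j}. f i j)
    = (\<Prod>j\<in>I. \<Prod>i\<in>{1..<j} - I. f i j)"
proof -
  have "finite I" using assms finite_subset by blast
  then have "(\<Prod>j\<in>I. \<Prod>i\<in>{1..<j} - I. f i j) = (\<Prod>(j, i)\<in>(SIGMA j:I. {1..<j} - I). f i j)"
    by (intro prod.Sigma) auto
  also have "\<dots> = (\<Prod>(i, j)\<in>{(i, j). i \<in> {1..n} - I \<and> j \<in> I \<and> i < j}. f i j)"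
    using assms
    by (intro prod.reindex_bij_witness[of _ "\<lambda>(i, j). (j, i)" "\<lambda>(j, i). (i, j)"]) force+
  finally show ?thesis ..
qed

theorem theorem3p4:
  fixes n k :: nat
  assumes "n = CARD('n::finite)" and "n \<ge> 2" and "1 \<le> k" and "k \<le> n"
  shows
    "(\<Sum>I | I \<subseteq> {1..n} \<and> card I = k.
        dunkl_set I *
        scalar (\<Prod>(i, j) \<in> {(i, j). i \<in> {1..n} - I \<and> j \<in> I \<and> i < j}.
          1 + tpar * bpar - tpar ^ 2 * qpar i j))
     = (\<Sum>i | i \<in> {1..k} \<rightarrow>\<^sub>E {1..n} \<and> strict_mono_on {1..k} i.
        prod_list (map (\<lambda>a.
          scalar ((1 + tpar * bpar) ^ (n - k + a - i a)) *
          (z (i a) * scalar ((1 + tpar * bpar) ^ (i a - a)) + 1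
            + scalar (hpar (i a) * beta_quot (i a - a))))
          [1..<Suc k]) :: 'n tht)"
proof -
  interpret tht: dunkl_elements "CARD('n)" "scalar (1 + tpar * bpar) :: 'n tht"
    hsym wgen "\<lambda>i. scalar (tpar * eta i)" hh_inv
    by (rule tht_dunkl_elements)
  define \<kappa> :: "nat \<Rightarrow> nat \<Rightarrow> 'n coeff" where "\<kappa> i j = 1 + tpar * bpar - tpar ^ 2 * qpar i j" for i j
  have dunkl: "dunkl i = tht.dunkl_elem i" if "i \<in> {1..n}" for i
  proof -
    have "dprod (hsym i) {i<..CARD('n)} = (dprod (hh i) {i<..CARD('n)} :: 'n tht)"
      by (intro dprod_cong) (auto simp: hsym_def usym_def hh_def)
    moreover have "{i<..CARD('n)} = {Suc i..<Suc CARD('n)}" by auto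
    ultimately show ?thesis
      by (simp add: tht.dunkl_elem_def dunkl_def wgen_def dprod_def del: upt_Suc)
  qed
  have left_part: "tht.left_part I m = scalar (\<Prod>j\<in>I \<inter> {1..m}. \<Prod>i\<in>{1..<j} - I. \<kappa> i j) * tht.left_part_inv I m"
    if "m \<le> n" for I m
    using that
  proof (induction m)
    case (Suc m)
    define c where "c j = (\<Prod>i\<in>{1..<j} - I. \<kappa> i j)" for j
    have IH: "tht.left_part I m = scalar (prod c (I \<inter> {1..m})) * tht.left_part_inv I m"
      using Suc unfolding c_def by simp
    show ?case
    proof (cases "Suc m \<in> I")
      case True
      have "dprod (hsym (Suc m)) ({1..m} - I)
          = scalar (\<Prod>i\<in>{1..m} - I. \<kappa> i (Suc m)) * dprod (\<lambda>i. hh_inv i (Suc m)) ({1..m} - I)"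
        using Suc.prems assms(1)
        by (intro dprod_scalar)
          (auto simp: hsym_eq_kappa_hh_inv kappa_def \<kappa>_def mult.commute)
      also have "(\<Prod>i\<in>{1..m} - I. \<kappa> i (Suc m)) = c (Suc m)"
        unfolding c_def by (simp add: atLeastLessThanSuc_atLeastAtMost)
      finally have "tht.left_part I (Suc m) = scalar (prod c (I \<inter> {1..m})) * (tht.left_part_inv I m * scalar (c (Suc m)))
          * dprod (\<lambda>i. hh_inv i (Suc m)) ({1..m} - I)"
        using True IH by (simp add: mult.assoc)
      also have "\<dots> = scalar (prod c (I \<inter> {1..m}) * c (Suc m)) * tht.left_part_inv I (Suc m)"
        unfolding scalar_pull(1) using True by (simp add: scalar_hom mult.assoc)
      also have "prod c (I \<inter> {1..m}) * c (Suc m) = prod c (I \<inter> {1..Suc m})"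
      proof -
        have "I \<inter> {1..Suc m} = insert (Suc m) (I \<inter> {1..m})" using True by auto
        then show ?thesis by (simp add: mult.commute)
      qed
      finally show ?thesis unfolding c_def .
    next
      case False
      then have "I \<inter> {1..Suc m} = I \<inter> {1..m}" by (auto simp: le_Suc_eq)
      then show ?thesis using False IH unfolding c_def by simp
    qed
  qed (simp add: scalar_hom)
  have left: "dunkl_set I * scalar (\<Prod>(i, j) \<in> {(i, j). i \<in> {1..n} - I \<and> j \<in> I \<and> i < j}. \<kappa> i j)
      = tht.normal_form n I" if I: "I \<subseteq> {1..n}" for I
  proof -
    have "dunkl_set I = iprod tht.dunkl_elem I"
      unfolding dunkl_set_def iprod_def[symmetric] using I dunkl by (intro iprod_cong) auto
    also have "\<dots> = tht.left_part_inv I n * tht.W I * tht.right_part I n"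
      using tht.iprod_dunkl_elem[of I] I assms(1) by simp
    finally have "dunkl_set I * scalar c = (scalar c * tht.left_part_inv I n) * tht.W I * tht.right_part I n" for c
      by (simp add: scalar_pull(1) mult.assoc)
    moreover have "I \<inter> {1..n} = I" using I by auto
    ultimately show ?thesis
      unfolding prod_inversions[OF I] tht.normal_form_def using left_part[of n I] by simp
  qed
  \<comment> \<open>Since \<open>\<beta> ((b\<^sup>m - 1) / \<beta>) = b\<^sup>m - 1\<close>, replacing \<open>z\<close> and \<open>h\<^sub>j\<close> by \<open>1 + z\<close> and \<open>h\<^sub>j - \<beta>\<close> absorbs the
      summand 1.\<close>
  have factor: "scalar ((1 + tpar * bpar) ^ e) * (z j * scalar ((1 + tpar * bpar) ^ m) + 1
        + scalar (hpar j * beta_quot m))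
      = scalar (1 + tpar * bpar) ^ e * (scalar (1 + tpar * bpar) ^ m * wgen j
        + scalar (tpar * eta j) * (\<Sum>r<m. scalar (1 + tpar * bpar) ^ r :: 'n tht))" for e m j
  proof -
    have "scalar (tpar * eta j) * (\<Sum>r<m. scalar (1 + tpar * bpar) ^ r :: 'n tht)
        = scalar (eta j * beta_quot m)"
      by (simp add: beta_quot_geometric scalar_power[symmetric] scalar_sum[symmetric] mult_ac
          flip: scalar_hom(4))
    also have "eta j * beta_quot m = hpar j * beta_quot m + 1 - (1 + tpar * bpar :: 'n coeff) ^ m"
      using beta_quot_correct[of m, where 'n='n] by (simp add: eta_def algebra_simps)
    finally have "scalar (1 + tpar * bpar) ^ m * wgen j
        + scalar (tpar * eta j) * (\<Sum>r<m. scalar (1 + tpar * bpar) ^ r :: 'n tht)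
      = scalar ((1 + tpar * bpar) ^ m) * wgen j
        + (scalar (hpar j * beta_quot m) + 1 - scalar ((1 + tpar * bpar) ^ m))"
      by (simp only: scalar_power scalar_hom(1) scalar_hom(2)[of "hpar j * beta_quot m"] scalar_hom(3))
    also have "\<dots> = z j * scalar ((1 + tpar * bpar) ^ m) + 1 + scalar (hpar j * beta_quot m)"
      by (simp add: wgen_def distrib_left scalar_pull(1)[of "z j"])
    finally have "scalar (1 + tpar * bpar) ^ m * wgen j
        + scalar (tpar * eta j) * (\<Sum>r<m. scalar (1 + tpar * bpar) ^ r :: 'n tht)
      = z j * scalar ((1 + tpar * bpar) ^ m) + 1 + scalar (hpar j * beta_quot m)" .
    then show ?thesis by (simp only: scalar_power)
  qed
  have "(\<Sum>I | I \<subseteq> {1..n} \<and> card I = k. dunkl_set I *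
        scalar (\<Prod>(i, j) \<in> {(i, j). i \<in> {1..n} - I \<and> j \<in> I \<and> i < j}. \<kappa> i j))
      = (\<Sum>I | I \<subseteq> {1..n} \<and> card I = k. tht.normal_form n I)"
    by (intro sum.cong refl left) auto
  also have "\<dots> = (\<Sum>i\<in>chains n k. prod_list (map (\<lambda>a. scalar (1 + tpar * bpar) ^ (n - k + a - i a)
        * (scalar (1 + tpar * bpar) ^ (i a - a) * wgen (i a)
          + scalar (tpar * eta (i a)) * (\<Sum>r<i a - a. scalar (1 + tpar * bpar) ^ r))) [1..<Suc k]))"
    using assms(1) by (intro tht.sum_normal_form_eq_sum_chains) simp
  finally show ?thesis
    unfolding \<kappa>_def factor chains_def .
qed

end
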